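(* Fix a power-sum friendly family of partial orders $\geq$ and write $P_{(\phi,\lambda)}=P^{\geq}_{(\phi,\lambda)}$. For $\phi\in L[K]$ ($K\neq\emptyset$) and $\lambda\in\mathcal S^\phi$ let $Q_{(\phi,\lambda)}=\Psi_{(1_\phi,K)}(P_{(\phi,\lambda)})$, where $1_\phi$ is the $\phi$-smallest element of $K$. Then the elements $Q_{(\phi,\lambda)}$ with $(\phi,\lambda)$ atomic are primitive elements of $\mathbf{scf}(U)$ that are algebraically independent and generate $\mathbf{scf}(U)$ (as a monoid in species), i.e. they form a full system of algebraically independent primitive generators of $\mathbf{scf}(U)$.
   Context: Fix a prime power $q$. For a finite set $K$, $L[K]$ is the set of linear orders on $K$; an order $\phi$ is identified with the word listing $K$ in increasing order ($i\prec_\phi j$: $i$ before $j$). $\phi|_J$ is restriction to $J$, $\phi\tau$ concatenation of orders on disjoint sets. A set composition $J=(J_1,\dots,J_\ell)\models K$ is a sequence of nonempty disjoint sets with union $K$. For $\phi\in L[K]$, a set partition w.r.t. $\phi$ is a set $\lambda$ of arcs $i\frown j$ with $i\frown j\in\lambda\Rightarrow i\prec_\phi j$ and, for $i\frown l,j\frown k\in\lambda$, $i=j$ iff $k=l$; $\mathcal S^\phi$ is the set of these. $\lambda_J=\{i\frown j\in\lambda:i,j\in J\}$. $U^\phi$ is the group of invertible $\mathbb F_q$-matrices indexed by $K$ with $u_{ii}=1$, $u_{ij}=0$ unless $i=j$ or $i\prec_\phi j$; $u,v$ are in the same superclass if $v-1=ta(u-1)b^{-1}t^{-1}$ ($a,b\in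 U^\phi$, $t$ invertible diagonal); superclasses are indexed by $\mu\in\mathcal S^\phi$ (containing $1+\sum_{i\frown j\in\mu}e_{ij}$); $\kappa_{(\phi,\mu)}$ is the indicator of superclass $\mu$, $\mathrm{scf}^\phi$ their span. The (cocommutative) Hopf monoid in vector species $\mathbf{scf}(U)$ has $\mathbf{scf}(U)[K]=\bigoplus_{\phi\in L[K]}\mathrm{scf}^\phi$, product $m_{I,J}$ by inflation along $U^{\phi\tau}\to U^\phi\times U^\tau$ (diagonal blocks), coproduct $\Delta_{I,J}$ by restriction to the block-diagonal subgroup $U^{\phi|_I}\times U^{\phi|_J}$; concretely $\kappa_{(\phi,\mu)}\kappa_{(\tau,\nu)}=\sum_{\lambda\in\mathcal S^{\phi\tau},\lambda_I=\mu,\lambda_J=\nu}\kappa_{(\phi\tau,\lambda)}$ and $\Delta_{I,J}(\kappa_{(\phi,\mu)})=\kappa_{(\phi|_I,\mu_I)}\otimes\kappa_{(\phi|_J,\mu_J)}$ if $\mu=\mu_I\cup\mu_J$, else $0$. An element $x\in\mathbf{scf}(U)[K]$ is primitive if $\Delta_{I,J}(x)=0$ for all $(I,J)\models K$. For $J\models K$, $\Delta_J$ is the iterated coproduct ($\Delta_{(K)}=\mathrm{id}$, $\Delta_J=(\Delta_{J_1,J_2}\otimes\mathrm{id}\otimes\cdots)\circ\cdots\circ\Delta_{K\setminus J_\ell,J_\ell}$) and $m_J=m_{K\setminus J_\ell,J_\ell}\circ\cdots\circ(m_{J_1,J_2}\otimes\mathrm{id}\otimes\cdots)$ the iterated product.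 For $k\in K$, $\Psi_{(k,K)}=\sum_{J=(J_1,\dots,J_\ell)\models K,\ k\in J_1}(-1)^{\ell-1}m_J\circ\Delta_J$. Atomic: $(\phi,\lambda)$ is atomic if there is no set composition $(A,B)\models K$ with $\phi=\phi|_A\phi|_B$ and $\lambda=\lambda_A\cup\lambda_B$. Power-sum friendly: partial orders $\leq_\phi$ on each $\mathcal S^\phi$ with (1) for $\phi\in L[I]$, $\tau\in L[J]$ ($I\cap J=\emptyset$), $\rho\in L[I\cup J]$ with $\rho|_I=\phi,\rho|_J=\tau$, and $\lambda\in\mathcal S^\phi,\nu\in\mathcal S^\tau,\mu\in\mathcal S^\rho$: $\mu_I\ge_\phi\lambda$ and $\mu_J\ge_\tau\nu$ iff $\mu\ge_\rho\lambda\cup\nu$; (2) for $\phi,\tau\in L[K]$, $\lambda\in\mathcal S^\phi\setminus\mathcal S^\tau$ implies $\mu\in\mathcal S^\phi\setminus\mathcal S^\tau$ for all $\mu\ge_\phi\lambda$. $P^\ge_{(\phi,\lambda)}=\sum_{\mu\ge_\phi\lambda}\kappa_{(\phi,\mu)}$. *)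

theory Defs
  imports
    Complex_Main
    "HOL-Library.Function_Algebras"
    "HOL-Combinatorics.Multiset_Permutations"
    "HOL-Algebra.Group"
begin

section \<open>Orders, set compositions and set partitions\<close>

text \<open>A linear order on a finite set \<open>K\<close> is the word listing \<open>K\<close> in increasing order.\<close>

abbreviation lin_orders :: "'a set \<Rightarrow> 'a list set" where
  "lin_orders K \<equiv> permutations_of_set K"

definition before :: "'a list \<Rightarrow> 'a \<Rightarrow> 'a \<Rightarrow> bool" where
  "before \<phi> i j \<longleftrightarrow> (\<exists>a b. a < b \<and> b < length \<phi> \<and> \<phi> ! a = i \<and> \<phi> ! b = j)"

definition restr_order :: "'a set \<Rightarrow> 'a list \<Rightarrow> 'a list" where
  "restr_order J \<phi> = filter (\<lambda>i. i \<in> J) \<phi>"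

text \<open>The empty list is the unique composition of the empty set.\<close>

definition set_compositions :: "'a set \<Rightarrow> 'a set list set" where
  "set_compositions K =
     {Js. {} \<notin> set Js \<and> distinct Js \<and> pairwise disjnt (set Js) \<and> \<Union>(set Js) = K}"

text \<open>The pair \<open>(i, j)\<close> is the arc from \<open>i\<close> to \<open>j\<close>.\<close>

type_synonym 'a arcs = "('a \<times> 'a) set"

definition set_partitions :: "'a list \<Rightarrow> 'a arcs set" where
  "set_partitions \<phi> =
     {\<mu>. (\<forall>(i, j)\<in>\<mu>. before \<phi> i j) \<and> (\<forall>(i, l)\<in>\<mu>. \<forall>(j, k)\<in>\<mu>. i = j \<longleftrightarrow> k = l)}"

definition restr_arcs :: "'a set \<Rightarrow> 'a arcs \<Rightarrow> 'a arcs" where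
  "restr_arcs J \<mu> = {(i, j) \<in> \<mu>. i \<in> J \<and> j \<in> J}"

definition atomic_pairs :: "('a list \<times> 'a arcs) set" where
  "atomic_pairs =
     {(\<phi>, \<mu>). distinct \<phi> \<and> \<phi> \<noteq> [] \<and> \<mu> \<in> set_partitions \<phi> \<and>
        \<not> (\<exists>A B. [A, B] \<in> set_compositions (set \<phi>) \<and>
             \<phi> = restr_order A \<phi> @ restr_order B \<phi> \<and> \<mu> = restr_arcs A \<mu> \<union> restr_arcs B \<mu>)}"

text \<open>\<open>(\<kappa>, \<mu>) \<in> R \<phi>\<close> means that \<open>\<kappa>\<close> is below \<open>\<mu>\<close> in the partial order
  attached to \<open>\<phi>\<close>.\<close>

definition power_sum_friendly :: "('a list \<Rightarrow> 'a arcs rel) \<Rightarrow> bool" where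
  "power_sum_friendly R \<longleftrightarrow>
     (\<forall>\<phi>. distinct \<phi> \<longrightarrow> partial_order_on (set_partitions \<phi>) (R \<phi>)) \<and>
     (\<forall>I J. finite I \<and> finite J \<and> I \<inter> J = {} \<longrightarrow>
       (\<forall>\<phi>\<in>lin_orders I. \<forall>\<tau>\<in>lin_orders J. \<forall>\<rho>\<in>lin_orders (I \<union> J).
         restr_order I \<rho> = \<phi> \<and> restr_order J \<rho> = \<tau> \<longrightarrow>
         (\<forall>\<kappa>\<in>set_partitions \<phi>. \<forall>\<nu>\<in>set_partitions \<tau>. \<forall>\<mu>\<in>set_partitions \<rho>.
           (\<kappa>, restr_arcs I \<mu>) \<in> R \<phi> \<and> (\<nu>, restr_arcs J \<mu>) \<in> R \<tau> \<longleftrightarrow>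
           (\<kappa> \<union> \<nu>, \<mu>) \<in> R \<rho>))) \<and>
     (\<forall>K. finite K \<longrightarrow>
       (\<forall>\<phi>\<in>lin_orders K. \<forall>\<tau>\<in>lin_orders K. \<forall>\<kappa>\<in>set_partitions \<phi> - set_partitions \<tau>.
         \<forall>\<mu>. (\<kappa>, \<mu>) \<in> R \<phi> \<longrightarrow> \<mu> \<in> set_partitions \<phi> - set_partitions \<tau>))"


section \<open>Unitriangular groups and superclasses\<close>

text \<open>Matrices indexed by \<open>K\<close> are functions on pairs that vanish outside \<open>K \<times> K\<close>, so that
  block sums of matrices are pointwise sums.\<close>

type_synonym ('a, 'f) mat = "'a \<Rightarrow> 'a \<Rightarrow> 'f"

definition matrices :: "'a set \<Rightarrow> ('a, 'f::field) mat monoid" where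
  "matrices K =
     \<lparr>carrier = {u. \<forall>i j. u i j \<noteq> 0 \<longrightarrow> i \<in> K \<and> j \<in> K},
      monoid.mult = (\<lambda>u v i j. \<Sum>k\<in>K. u i k * v k j),
      one = (\<lambda>i j. if i = j \<and> i \<in> K then 1 else 0)\<rparr>"

definition restr_mat :: "'a set \<Rightarrow> ('a, 'f::field) mat \<Rightarrow> ('a, 'f) mat" where
  "restr_mat J u = (\<lambda>i j. if i \<in> J \<and> j \<in> J then u i j else 0)"

definition unitriangular :: "'a list \<Rightarrow> ('a, 'f::field) mat set" where
  "unitriangular \<phi> =
     {u \<in> Units (matrices (set \<phi>)).
        (\<forall>i\<in>set \<phi>. u i i = 1) \<and> (\<forall>i j. u i j \<noteq> 0 \<longrightarrow> i = j \<or> before \<phi> i j)}"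

definition inv_diagonal :: "'a set \<Rightarrow> ('a, 'f::field) mat set" where
  "inv_diagonal K = {t \<in> Units (matrices K). \<forall>i j. i \<noteq> j \<longrightarrow> t i j = 0}"

definition superclass_rel :: "'a list \<Rightarrow> ('a, 'f::field) mat \<Rightarrow> ('a, 'f) mat \<Rightarrow> bool" where
  "superclass_rel \<phi> u v \<longleftrightarrow>
     (let M = matrices (set \<phi>) in
      \<exists>a\<in>unitriangular \<phi>. \<exists>b\<in>unitriangular \<phi>. \<exists>t\<in>inv_diagonal (set \<phi>).
        v - \<one>\<^bsub>M\<^esub> = t \<otimes>\<^bsub>M\<^esub> a \<otimes>\<^bsub>M\<^esub> (u - \<one>\<^bsub>M\<^esub>) \<otimes>\<^bsub>M\<^esub> inv\<^bsub>M\<^esub> b \<otimes>\<^bsub>M\<^esub> inv\<^bsub>M\<^esub> t)"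

definition elem_mat :: "'a \<Rightarrow> 'a \<Rightarrow> ('a, 'f::field) mat" where
  "elem_mat i j = (\<lambda>r s. if r = i \<and> s = j then 1 else 0)"

definition superclass_rep :: "'a list \<Rightarrow> 'a arcs \<Rightarrow> ('a, 'f::field) mat" where
  "superclass_rep \<phi> \<mu> = \<one>\<^bsub>matrices (set \<phi>)\<^esub> + (\<Sum>(i, j)\<in>\<mu>. elem_mat i j)"


section \<open>The Hopf monoid of superclass functions\<close>

text \<open>The direct sum over \<open>\<phi>\<close> of the spaces of functions on the groups \<open>U\<^sup>\<phi>\<close> is the
  space of functions on pairs \<open>(\<phi>, u)\<close> with \<open>u \<in> U\<^sup>\<phi>\<close>, extended by zero to all pairs.\<close>

type_synonym ('a, 'f) point = "'a list \<times> ('a, 'f) mat"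
type_synonym ('a, 'f) sfun = "('a, 'f) point \<Rightarrow> complex"

definition points :: "'a set \<Rightarrow> ('a, 'f::field) point set" where
  "points K = Sigma (lin_orders K) unitriangular"

definition cscale :: "complex \<Rightarrow> ('b \<Rightarrow> complex) \<Rightarrow> 'b \<Rightarrow> complex" where
  "cscale c x = (\<lambda>p. c * x p)"

interpretation cfun: vector_space cscale
  by unfold_locales (auto simp: cscale_def algebra_simps fun_eq_iff)

definition kappa :: "'a list \<Rightarrow> 'a arcs \<Rightarrow> ('a, 'f::field) sfun" where
  "kappa \<phi> \<mu> = (\<lambda>(\<tau>, v). if \<tau> = \<phi> \<and> v \<in> unitriangular \<phi> \<and>
     superclass_rel \<phi> (superclass_rep \<phi> \<mu>) v then 1 else 0)"

definition scf :: "'a set \<Rightarrow> ('a, 'f::field) sfun set" where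
  "scf K = cfun.span {kappa \<phi> \<mu> | \<phi> \<mu>. \<phi> \<in> lin_orders K \<and> \<mu> \<in> set_partitions \<phi>}"

text \<open>Elements of a tensor product of \<open>\<ell>\<close> components are functions of \<open>\<ell>\<close> points. Binary tensors
  are functions on pairs; for iterated structure maps, tensors are functions on lists of
  points.\<close>

definition tensor2 :: "('a, 'f) sfun \<Rightarrow> ('a, 'f) sfun \<Rightarrow> ('a, 'f) point \<times> ('a, 'f) point \<Rightarrow> complex"
  where "tensor2 x y = (\<lambda>(p, q). x p * y q)"

definition tensor :: "('a, 'f) sfun list \<Rightarrow> ('a, 'f) point list \<Rightarrow> complex" where
  "tensor xs = (\<lambda>ps. if length ps = length xs then \<Prod>i<length xs. (xs ! i) (ps ! i) else 0)"

text \<open>Inflation: the value at \<open>w \<in> U\<^sup>\<rho>\<close>, where \<open>\<rho> = \<phi>\<tau>\<close>, is the value at the two diagonal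
  blocks of \<open>w\<close>.\<close>

definition mult2 :: "'a set \<Rightarrow> 'a set \<Rightarrow>
    (('a, 'f::field) point \<times> ('a, 'f) point \<Rightarrow> complex) \<Rightarrow> ('a, 'f) sfun" where
  "mult2 I J z = (\<lambda>(\<rho>, w).
     if (\<rho>, w) \<in> points (I \<union> J) \<and> \<rho> = restr_order I \<rho> @ restr_order J \<rho>
     then z ((restr_order I \<rho>, restr_mat I w), (restr_order J \<rho>, restr_mat J w)) else 0)"

text \<open>Restriction: the summand indexed by \<open>\<rho>\<close> is sent to functions on \<open>U\<^sup>\<phi> \<times> U\<^sup>\<tau>\<close>, where \<open>\<phi>\<close> and
  \<open>\<tau>\<close> are the restrictions of \<open>\<rho>\<close>; \<open>u + v\<close> is the block-diagonal matrix with blocks \<open>u\<close>, \<open>v\<close>.\<close>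

definition comult2 :: "'a set \<Rightarrow> 'a set \<Rightarrow> ('a, 'f::field) sfun \<Rightarrow>
    ('a, 'f) point \<times> ('a, 'f) point \<Rightarrow> complex" where
  "comult2 I J x = (\<lambda>((\<phi>, u), (\<tau>, v)).
     if (\<phi>, u) \<in> points I \<and> (\<tau>, v) \<in> points J
     then \<Sum>\<rho> | \<rho> \<in> lin_orders (I \<union> J) \<and> restr_order I \<rho> = \<phi> \<and> restr_order J \<rho> = \<tau>. x (\<rho>, u + v)
     else 0)"

definition unit_elem :: "('a, 'f::field) sfun" where
  "unit_elem = kappa [] {}"

text \<open>For the empty composition the iterated maps are the unit and the counit.\<close>

fun mult_iter :: "'a set list \<Rightarrow> (('a, 'f::field) point list \<Rightarrow> complex) \<Rightarrow> ('a, 'f) sfun" where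
  "mult_iter [] z = cscale (z []) unit_elem"
| "mult_iter [A] z = (\<lambda>p. z [p])"
| "mult_iter (A # B # Js) z = mult_iter ((A \<union> B) # Js)
     (\<lambda>ps. case ps of [] \<Rightarrow> 0 | p # rs \<Rightarrow> mult2 A B (\<lambda>(q, r). z (q # r # rs)) p)"

fun comult_iter :: "'a set list \<Rightarrow> ('a, 'f::field) sfun \<Rightarrow> ('a, 'f) point list \<Rightarrow> complex" where
  "comult_iter [] x = (\<lambda>ps. if ps = [] then x ([], 0) else 0)"
| "comult_iter [A] x = (\<lambda>ps. case ps of [p] \<Rightarrow> x p | _ \<Rightarrow> 0)"
| "comult_iter (A # B # Js) x = (\<lambda>ps. case ps of
     q # r # rs \<Rightarrow> comult2 A B (\<lambda>p. comult_iter ((A \<union> B) # Js) x (p # rs)) (q, r) | _ \<Rightarrow> 0)"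

definition primitive :: "'a set \<Rightarrow> ('a, 'f::field) sfun \<Rightarrow> bool" where
  "primitive K x \<longleftrightarrow> x \<in> scf K \<and> (\<forall>I J. [I, J] \<in> set_compositions K \<longrightarrow> comult2 I J x = 0)"

definition Psi :: "'a \<Rightarrow> 'a set \<Rightarrow> ('a, 'f::field) sfun \<Rightarrow> ('a, 'f) sfun" where
  "Psi k K x = (\<Sum>Js | Js \<in> set_compositions K \<and> Js \<noteq> [] \<and> k \<in> hd Js.
     cscale ((-1) ^ (length Js - 1)) (mult_iter Js (comult_iter Js x)))"

definition power_sum :: "('a list \<Rightarrow> 'a arcs rel) \<Rightarrow> 'a list \<Rightarrow> 'a arcs \<Rightarrow> ('a, 'f::field) sfun" where
  "power_sum R \<phi> \<kappa> = (\<Sum>\<mu> | \<mu> \<in> set_partitions \<phi> \<and> (\<kappa>, \<mu>) \<in> R \<phi>. kappa \<phi> \<mu>)"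

definition Q_elem :: "('a list \<Rightarrow> 'a arcs rel) \<Rightarrow> 'a list \<times> 'a arcs \<Rightarrow> ('a, 'f::field) sfun" where
  "Q_elem R = (\<lambda>(\<phi>, \<kappa>). Psi (hd \<phi>) (set \<phi>) (power_sum R \<phi> \<kappa>))"


section \<open>Generation and algebraic independence\<close>

text \<open>A family \<open>g\<close> of elements of the monoid is indexed by \<open>X\<close>, with \<open>g i\<close> in the component of the
  finite set \<open>D i\<close>. Its monomials in the component of \<open>K\<close> are the iterated products of those
  sequences of members whose supports form a composition of \<open>K\<close>; the monoid is not commutative,
  so the order of the factors matters.\<close>

definition monomial_words :: "('i \<Rightarrow> 'a set) \<Rightarrow> 'i set \<Rightarrow> 'a set \<Rightarrow> 'i list set" where
  "monomial_words D X K = {ws. set ws \<subseteq> X \<and> map D ws \<in> set_compositions K}"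

definition monomial :: "('i \<Rightarrow> 'a set) \<Rightarrow> ('i \<Rightarrow> ('a, 'f::field) sfun) \<Rightarrow> 'i list \<Rightarrow> ('a, 'f) sfun"
  where "monomial D g ws = mult_iter (map D ws) (tensor (map g ws))"

definition alg_independent ::
    "('i \<Rightarrow> 'a set) \<Rightarrow> 'i set \<Rightarrow> ('i \<Rightarrow> ('a, 'f::field) sfun) \<Rightarrow> bool" where
  "alg_independent D X g \<longleftrightarrow> (\<forall>K. finite K \<longrightarrow>
     inj_on (monomial D g) (monomial_words D X K) \<and>
     cfun.independent (monomial D g ` monomial_words D X K))"

definition scf_submonoid :: "('a set \<Rightarrow> ('a, 'f::field) sfun set) \<Rightarrow> bool" where
  "scf_submonoid W \<longleftrightarrow>
     (\<forall>K. finite K \<longrightarrow> cfun.subspace (W K) \<and> W K \<subseteq> scf K) \<and>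
     unit_elem \<in> W {} \<and>
     (\<forall>I J. finite I \<and> finite J \<and> I \<inter> J = {} \<longrightarrow>
       (\<forall>x\<in>W I. \<forall>y\<in>W J. mult2 I J (tensor2 x y) \<in> W (I \<union> J)))"

text \<open>Closure of \<open>W\<close> under relabelling bijections is not required, which makes the following
  condition stronger than the one in which it is.\<close>

definition generates_scf ::
    "('i \<Rightarrow> 'a set) \<Rightarrow> 'i set \<Rightarrow> ('i \<Rightarrow> ('a, 'f::field) sfun) \<Rightarrow> bool" where
  "generates_scf D X g \<longleftrightarrow> (\<forall>i\<in>X. g i \<in> scf (D i)) \<and>
     (\<forall>W. scf_submonoid W \<and> (\<forall>i\<in>X. g i \<in> W (D i)) \<longrightarrow> (\<forall>K. finite K \<longrightarrow> W K = scf K))"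

end

theory Submission
  imports Defs
begin

text \<open>
  Every \<open>u - 1\<close> with \<open>u \<in> U\<^sup>\<phi>\<close> can be reduced by row and column operations to a unique
  partial permutation matrix \<open>e\<^sub>\<mu>\<close>, and this reduction is compatible with diagonal blocks and
  block sums. Friendliness of the orders then makes the power sums a basis on which product and
  coproduct are set-theoretic: \<open>P\<^sub>(\<phi>,\<lambda>) P\<^sub>(\<tau>,\<nu>) = P\<^sub>(\<phi>\<tau>,\<lambda>\<union>\<nu>)\<close>, and \<open>\<Delta>\<^sub>I\<^sub>,\<^sub>J\<close> sends \<open>P\<^sub>(\<phi>,\<lambda>)\<close> to the
  tensor of its restrictions if no arc of \<open>\<lambda>\<close> joins \<open>I\<close> and \<open>J\<close>, and to \<open>0\<close> otherwise.

  Hence \<open>\<Psi>\<^sub>k P\<^sub>(\<phi>,\<lambda>)\<close> is an alternating sum of power sums of rearrangements of \<open>\<phi>\<close>, and a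
  sign-reversing involution on set compositions shows that it is primitive. The basis elements are
  the free monoid on the atomic ones, and for an atomic pair all terms of \<open>\<Psi>\<^sub>k P\<^sub>(\<phi>,\<lambda>)\<close> other
  than \<open>P\<^sub>(\<phi>,\<lambda>)\<close> itself have at least two atomic factors. So the monomials in the \<open>Q\<close> are
  unitriangular over the power sums with respect to the number of atomic factors.
\<close>

section \<open>Words and arcs\<close>

text \<open>Product and coproduct are defined on functions of matrices, not on labels, so everything
  about power sums rests on how the label of a matrix reacts to the two structure maps. The diagonal
  blocks of a concatenated word are order-convex, which makes the reduction restrict to them. The
  coproduct instead meets arbitrary shuffles of two words, where it is evaluated on block-diagonal
  matrices only. The friendliness condition on restrictions settles the product and the split case
  of the coproduct; the condition comparing two orders settles the remaining case, by testing an
  order in which one side is moved in front of the other.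

  The root \<open>k\<close> makes the cancellation possible: given \<open>I\<close> and
  \<open>J\<close>, the involution splits along the side without \<open>k\<close>, so the first
  block is never contained in that side and goes on containing \<open>k\<close>. Splitting and
  merging change neither restricted word, hence not the coproduct.

  Independence is a matter of counting: the components are finite-dimensional, a unitriangular
  family spans, and unique factorization into atomic pairs gives it the same index set as the
  basis.\<close>

lemma before_Nil [simp]: "\<not> before [] i j"
  by (simp add: before_def)

text \<open>Replaces the positions in \<open>before_def\<close> by recursion on the word; positions
  do not occur again after this.\<close>

lemma before_Cons [simp]: "before (x # xs) i j \<longleftrightarrow> (i = x \<and> j \<in> set xs) \<or> before xs i j"
proof
  assume "before (x # xs) i j"
  then obtain a b where ab: "a < b" "b < Suc (length xs)" "(x # xs) ! a = i" "(x # xs) ! b = j"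
    by (auto simp: before_def)
  then obtain b' where b: "b = Suc b'" by (cases b) auto
  show "(i = x \<and> j \<in> set xs) \<or> before xs i j"
  proof (cases a)
    case 0
    then show ?thesis using ab b by auto
  next
    case (Suc a')
    then show ?thesis using ab b by (auto simp: before_def)
  qed
next
  assume "(i = x \<and> j \<in> set xs) \<or> before xs i j"
  then show "before (x # xs) i j"
  proof
    assume "i = x \<and> j \<in> set xs"
    then obtain b where "b < length xs" "xs ! b = j" "i = x" by (auto simp: in_set_conv_nth)
    then show ?thesis unfolding before_def by (intro exI[of _ 0] exI[of _ "Suc b"]) auto
  next
    assume "before xs i j"
    then obtain a b where "a < b" "b < length xs" "xs ! a = i" "xs ! b = j"
      by (auto simp: before_def)
    then show ?thesis unfolding before_def by (intro exI[of _ "Suc a"] exI[of _ "Suc b"]) auto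
  qed
qed

lemma before_append [simp]:
  "before (xs @ ys) i j \<longleftrightarrow> before xs i j \<or> before ys i j \<or> (i \<in> set xs \<and> j \<in> set ys)"
  by (induction xs) auto

lemma before_in_set: "before xs i j \<Longrightarrow> i \<in> set xs \<and> j \<in> set xs"
  by (induction xs) auto

lemma before_restr_order [simp]:
  "before (restr_order J xs) i j \<longleftrightarrow> i \<in> J \<and> j \<in> J \<and> before xs i j"
  unfolding restr_order_def by (induction xs) (auto dest: before_in_set)

lemma before_asym: "distinct xs \<Longrightarrow> before xs i j \<Longrightarrow> \<not> before xs j i"
  by (induction xs) (auto dest: before_in_set)

lemma before_irrefl: "distinct xs \<Longrightarrow> \<not> before xs i i"
  using before_asym by fastforce

lemma before_trans: "distinct xs \<Longrightarrow> before xs i j \<Longrightarrow> before xs j k \<Longrightarrow> before xs i k"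
  by (induction xs) (auto dest: before_in_set)

lemma set_restr_order [simp]: "set (restr_order J xs) = set xs \<inter> J"
  by (auto simp: restr_order_def)

lemma distinct_restr_order [simp]: "distinct xs \<Longrightarrow> distinct (restr_order J xs)"
  by (simp add: restr_order_def)

lemma restr_order_append [simp]: "restr_order J (xs @ ys) = restr_order J xs @ restr_order J ys"
  by (simp add: restr_order_def)

lemma restr_order_restr_order [simp]:
  "restr_order I (restr_order J xs) = restr_order (I \<inter> J) xs"
  by (simp add: restr_order_def conj_commute)

lemma restr_order_id: "set xs \<subseteq> J \<Longrightarrow> restr_order J xs = xs"
  by (simp add: restr_order_def subset_iff)

lemma restr_order_disjoint: "set xs \<inter> J = {} \<Longrightarrow> restr_order J xs = []"
  by (auto simp: restr_order_def filter_empty_conv)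

lemma lin_orders_iff: "xs \<in> lin_orders K \<longleftrightarrow> distinct xs \<and> set xs = K"
  by (auto simp: permutations_of_set_def)

lemma restr_arcs_iff [simp]: "(i, j) \<in> restr_arcs J \<mu> \<longleftrightarrow> (i, j) \<in> \<mu> \<and> i \<in> J \<and> j \<in> J"
  by (simp add: restr_arcs_def)

lemma restr_arcs_restr_arcs [simp]: "restr_arcs I (restr_arcs J \<mu>) = restr_arcs (I \<inter> J) \<mu>"
  by (auto simp: restr_arcs_def)

lemma restr_arcs_Un [simp]: "restr_arcs I (\<mu> \<union> \<nu>) = restr_arcs I \<mu> \<union> restr_arcs I \<nu>"
  by (auto simp: restr_arcs_def)

lemma set_partitions_iff:
  "\<mu> \<in> set_partitions \<phi> \<longleftrightarrow> (\<forall>i j. (i, j) \<in> \<mu> \<longrightarrow> before \<phi> i j) \<and>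
     (\<forall>i j k. (i, j) \<in> \<mu> \<longrightarrow> (i, k) \<in> \<mu> \<longrightarrow> j = k) \<and>
     (\<forall>i j k. (i, k) \<in> \<mu> \<longrightarrow> (j, k) \<in> \<mu> \<longrightarrow> i = j)"
  unfolding set_partitions_def by blast

lemma set_partitions_before: "\<mu> \<in> set_partitions \<phi> \<Longrightarrow> (i, j) \<in> \<mu> \<Longrightarrow> before \<phi> i j"
  by (auto simp: set_partitions_iff)

lemma set_partitions_subset: "\<mu> \<in> set_partitions \<phi> \<Longrightarrow> \<mu> \<subseteq> set \<phi> \<times> set \<phi>"
  by (auto dest!: set_partitions_before before_in_set)

lemma finite_set_partition: "\<mu> \<in> set_partitions \<phi> \<Longrightarrow> finite \<mu>"
  by (rule finite_subset[OF set_partitions_subset]) auto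

lemma finite_set_partitions [simp]: "finite (set_partitions \<phi>)"
  by (rule finite_subset[of _ "Pow (set \<phi> \<times> set \<phi>)"]) (auto dest!: set_partitions_subset)

lemma restr_arcs_id: "\<mu> \<in> set_partitions \<phi> \<Longrightarrow> set \<phi> \<subseteq> J \<Longrightarrow> restr_arcs J \<mu> = \<mu>"
  by (auto simp: restr_arcs_def dest: set_partitions_subset)

lemma restr_arcs_disjoint: "\<mu> \<in> set_partitions \<phi> \<Longrightarrow> set \<phi> \<inter> J = {} \<Longrightarrow> restr_arcs J \<mu> = {}"
  by (auto simp: restr_arcs_def dest: set_partitions_subset)

lemma restr_arcs_set_partitions:
  "\<mu> \<in> set_partitions \<phi> \<Longrightarrow> restr_arcs J \<mu> \<in> set_partitions (restr_order J \<phi>)"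
  unfolding set_partitions_iff by auto

text \<open>Arcs of \<mu> have both ends in \<open>I\<close> and arcs of \<nu> both ends in
  \<open>J\<close>, so no endpoint is shared. The word \<rho> may interleave the two parts, as the
  coproduct requires; concatenation is the special case
  \<open>set_partitions_append\<close>.\<close>

lemma Un_set_partitions:
  assumes "\<mu> \<in> set_partitions (restr_order I \<rho>)" "\<nu> \<in> set_partitions (restr_order J \<rho>)" "I \<inter> J = {}"
  shows "\<mu> \<union> \<nu> \<in> set_partitions \<rho>"
  using assms unfolding set_partitions_iff by (simp) blast

lemma set_partitions_append:
  assumes "\<mu> \<in> set_partitions \<phi>" "\<nu> \<in> set_partitions \<tau>" "set \<phi> \<inter> set \<tau> = {}"
  shows "\<mu> \<union> \<nu> \<in> set_partitions (\<phi> @ \<tau>)"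
  by (rule Un_set_partitions[of _ "set \<phi>" _ _ "set \<tau>"])
    (use assms in \<open>simp_all add: restr_order_id restr_order_disjoint Int_commute\<close>)


section \<open>Upper triangular matrices\<close>

definition upper :: "'a list \<Rightarrow> ('a, 'f::field) mat set" where
  "upper \<phi> = {u. \<forall>i j. u i j \<noteq> 0 \<longrightarrow> i \<in> set \<phi> \<and> (i = j \<or> before \<phi> i j)}"

text \<open>A Borel group containing both the unitriangular and the invertible diagonal matrices, so
  that \<open>t a\<close> and the inverse of \<open>t b\<close> live in one group.\<close>

definition upper_inv :: "'a list \<Rightarrow> ('a, 'f::field) mat set" where
  "upper_inv \<phi> = {u \<in> upper \<phi>. \<forall>i\<in>set \<phi>. u i i \<noteq> 0}"

definition strict_upper :: "'a list \<Rightarrow> ('a, 'f::field) mat set" where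
  "strict_upper \<phi> = {u. \<forall>i j. u i j \<noteq> 0 \<longrightarrow> before \<phi> i j}"

definition mmult :: "'a set \<Rightarrow> ('a, 'f::field) mat \<Rightarrow> ('a, 'f) mat \<Rightarrow> ('a, 'f) mat" where
  "mmult K u v = (\<lambda>i j. \<Sum>k\<in>K. u i k * v k j)"

definition mone :: "'a set \<Rightarrow> ('a, 'f::field) mat" where
  "mone K = (\<lambda>i j. if i = j \<and> i \<in> K then 1 else 0)"

lemma mult_matrices [simp]: "u \<otimes>\<^bsub>matrices K\<^esub> v = mmult K u v"
  by (simp add: matrices_def mmult_def)

lemma one_matrices [simp]: "\<one>\<^bsub>matrices K\<^esub> = mone K"
  by (simp add: matrices_def mone_def)

lemma carrier_matrices: "u \<in> carrier (matrices K) \<longleftrightarrow> (\<forall>i j. u i j \<noteq> 0 \<longrightarrow> i \<in> K \<and> j \<in> K)"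
  by (simp add: matrices_def)

lemma mmult_nonzero:
  assumes "mmult K u v i j \<noteq> 0"
  obtains k where "k \<in> K" "u i k \<noteq> 0" "v k j \<noteq> 0"
proof -
  obtain k where "k \<in> K" "u i k * v k j \<noteq> 0"
    using assms unfolding mmult_def by (rule sum.not_neutral_contains_not_neutral)
  then show ?thesis using that by auto
qed

lemma mmult_carrier:
  "u \<in> carrier (matrices K) \<Longrightarrow> v \<in> carrier (matrices K) \<Longrightarrow> mmult K u v \<in> carrier (matrices K)"
  unfolding carrier_matrices by (meson mmult_nonzero)

lemma mmult_assoc: "mmult K (mmult K u v) w = mmult K u (mmult K v w)"
proof (intro ext)
  fix i j
  have "mmult K (mmult K u v) w i j = (\<Sum>k\<in>K. \<Sum>l\<in>K. u i l * v l k * w k j)"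
    by (simp add: mmult_def sum_distrib_right)
  also have "\<dots> = (\<Sum>l\<in>K. \<Sum>k\<in>K. u i l * v l k * w k j)" by (rule sum.swap)
  also have "\<dots> = mmult K u (mmult K v w) i j"
    by (simp add: mmult_def sum_distrib_left mult.assoc)
  finally show "mmult K (mmult K u v) w i j = mmult K u (mmult K v w) i j" .
qed

lemma mmult_one_right:
  assumes "finite K" "u \<in> carrier (matrices K)"
  shows "mmult K u (mone K) = u"
proof (intro ext)
  fix i j
  have "mmult K u (mone K) i j = (\<Sum>k\<in>K. if k = j then u i j else 0)"
    unfolding mmult_def mone_def by (intro sum.cong) auto
  then show "mmult K u (mone K) i j = u i j" using assms by (auto simp: carrier_matrices)
qed

lemma mmult_one_left:
  assumes "finite K" "u \<in> carrier (matrices K)"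
  shows "mmult K (mone K) u = u"
proof (intro ext)
  fix i j
  have "mmult K (mone K) u i j = (\<Sum>k\<in>K. if k = i then u i j else 0)"
    unfolding mmult_def mone_def by (intro sum.cong) auto
  then show "mmult K (mone K) u i j = u i j" using assms by (auto simp: carrier_matrices)
qed

lemma mone_carrier: "mone K \<in> carrier (matrices K)"
  by (simp add: carrier_matrices mone_def)

lemma monoid_matrices: "finite K \<Longrightarrow> Group.monoid (matrices K :: ('a, 'f::field) mat monoid)"
  by unfold_locales
    (simp_all add: mmult_carrier mmult_assoc mmult_one_left mmult_one_right mone_carrier)

lemma upper_carrier: "u \<in> upper \<phi> \<Longrightarrow> u \<in> carrier (matrices (set \<phi>))"
  unfolding carrier_matrices upper_def by (auto dest: before_in_set)

lemma strict_upper_carrier: "u \<in> strict_upper \<phi> \<Longrightarrow> u \<in> carrier (matrices (set \<phi>))"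
  unfolding carrier_matrices strict_upper_def by (auto dest: before_in_set)

lemma strict_upper_upper: "u \<in> strict_upper \<phi> \<Longrightarrow> u \<in> upper \<phi>"
  unfolding strict_upper_def upper_def by (auto dest: before_in_set)

lemma mmult_upper:
  assumes "distinct \<phi>" "u \<in> upper \<phi>" "v \<in> upper \<phi>"
  shows "mmult (set \<phi>) u v \<in> upper \<phi>"
  unfolding upper_def
proof (clarify)
  fix i j assume "mmult (set \<phi>) u v i j \<noteq> 0"
  then obtain k where "k \<in> set \<phi>" "u i k \<noteq> 0" "v k j \<noteq> 0" by (rule mmult_nonzero)
  then show "i \<in> set \<phi> \<and> (i = j \<or> before \<phi> i j)"
    using assms before_trans[OF assms(1)] unfolding upper_def by blast
qed

lemma mmult_diag:
  assumes "distinct \<phi>" "u \<in> upper \<phi>" "v \<in> upper \<phi>"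
  shows "mmult (set \<phi>) u v i i = u i i * v i i"
proof -
  have "u i k * v k i = 0" if "k \<noteq> i" for k
    using assms that before_asym[OF assms(1), of i k] unfolding upper_def by auto
  then have "mmult (set \<phi>) u v i i = (\<Sum>k\<in>set \<phi>. if k = i then u i i * v i i else 0)"
    unfolding mmult_def by (intro sum.cong) auto
  moreover have "i \<notin> set \<phi> \<Longrightarrow> u i i = 0" using assms by (auto simp: upper_def)
  ultimately show ?thesis by auto
qed

lemma mmult_upper_inv:
  "distinct \<phi> \<Longrightarrow> u \<in> upper_inv \<phi> \<Longrightarrow> v \<in> upper_inv \<phi> \<Longrightarrow> mmult (set \<phi>) u v \<in> upper_inv \<phi>"
  by (simp add: upper_inv_def mmult_upper mmult_diag)

lemma mone_upper_inv: "mone (set \<phi>) \<in> upper_inv \<phi>"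
  by (auto simp: mone_def upper_inv_def upper_def)

text \<open>The strictly upper triangular matrices form a two-sided ideal, so superclass moves stay
  among the matrices \<open>u - 1\<close>.\<close>

lemma mmult_strict_upper:
  assumes "distinct \<phi>" "u \<in> upper \<phi>" "n \<in> strict_upper \<phi>" "v \<in> upper \<phi>"
  shows "mmult (set \<phi>) (mmult (set \<phi>) u n) v \<in> strict_upper \<phi>"
  unfolding strict_upper_def
proof (clarify)
  fix i j assume "mmult (set \<phi>) (mmult (set \<phi>) u n) v i j \<noteq> 0"
  then obtain l where l: "mmult (set \<phi>) u n i l \<noteq> 0" "v l j \<noteq> 0" by (rule mmult_nonzero)
  then obtain k where k: "u i k \<noteq> 0" "n k l \<noteq> 0" using mmult_nonzero[OF l(1)] by blast
  have "i = k \<or> before \<phi> i k" "before \<phi> k l" "l = j \<or> before \<phi> l j"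
    using assms k l unfolding upper_def strict_upper_def by auto
  then show "before \<phi> i j" using before_trans[OF assms(1)] by metis
qed

text \<open>Peel off the first letter \<open>x\<close>. If \<open>v\<close> inverts the remaining
  block and \<open>r\<close> is the rest of row \<open>x\<close>, the inverse has first row
  \<open>1 / u x x\<close> followed by \<open>- r v / u x x\<close>. A right inverse suffices: it
  has a right inverse itself, and that must be \<open>u\<close>.\<close>

lemma upper_right_inverse:
  "distinct \<phi> \<Longrightarrow> u \<in> upper_inv \<phi> \<Longrightarrow> \<exists>v\<in>upper_inv \<phi>. mmult (set \<phi>) u v = mone (set \<phi>)"
proof (induction \<phi> arbitrary: u)
  case Nil
  then show ?case by (auto simp: mmult_def mone_def upper_inv_def upper_def fun_eq_iff)
next
  case (Cons x \<phi>)
  let ?K = "set \<phi>"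
  have x: "x \<notin> ?K" using Cons.prems by simp
  have "restr_mat ?K u \<in> upper_inv \<phi>"
    using Cons.prems unfolding upper_inv_def upper_def restr_mat_def by auto
  then obtain v where v: "v \<in> upper_inv \<phi>" "mmult ?K (restr_mat ?K u) v = mone ?K"
    using Cons by auto
  have v0: "v i j = 0" if "i = x \<or> j = x" for i j
    using v(1) x that unfolding upper_inv_def upper_def by (auto dest: before_in_set)
  have vK: "v i j = 0" if "j \<notin> ?K" for i j
    using v(1) x that unfolding upper_inv_def upper_def by (auto dest: before_in_set)
  have ux: "u x x \<noteq> 0" using Cons.prems unfolding upper_inv_def by auto
  have u0: "u k x = 0" if "k \<noteq> x" for k
    using Cons.prems that unfolding upper_inv_def upper_def by (auto dest: before_in_set)
  have uK: "u i k = 0" if "i \<notin> ?K" "i \<noteq> x" for i k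
    using Cons.prems that unfolding upper_inv_def upper_def by (auto dest: before_in_set)
  define w where "w = (\<lambda>i j. if i = x then (if j = x then 1 / u x x else
    - (\<Sum>k\<in>?K. u x k * v k j) / u x x) else v i j)"
  have wk: "w k j = v k j" if "k \<in> ?K" for k j using that x by (auto simp: w_def)
  have sum0: "(\<Sum>k\<in>?K. u x k * v k j) = 0" if "j \<notin> ?K" for j
    using vK[OF that] by simp
  have "w \<in> upper_inv (x # \<phi>)"
    using v(1) ux x sum0 unfolding upper_inv_def upper_def w_def
    by (auto split: if_splits dest: before_in_set)
  moreover have "mmult (set (x # \<phi>)) u w = mone (set (x # \<phi>))"
  proof (intro ext)
    fix i j
    have *: "mmult (set (x # \<phi>)) u w i j = u i x * w x j + (\<Sum>k\<in>?K. u i k * v k j)"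
      unfolding mmult_def using x by (simp add: wk)
    show "mmult (set (x # \<phi>)) u w i j = mone (set (x # \<phi>)) i j"
    proof (cases "i = x")
      case True
      then show ?thesis using * ux v0 by (auto simp: w_def mone_def)
    next
      case False
      have "(\<Sum>k\<in>?K. u i k * v k j) = mone ?K i j"
      proof (cases "i \<in> ?K")
        case True
        have "mmult ?K (restr_mat ?K u) v i j = (\<Sum>k\<in>?K. u i k * v k j)"
          unfolding mmult_def restr_mat_def using True by (intro sum.cong) auto
        then show ?thesis using v by simp
      next
        case F: False
        then show ?thesis using uK[OF F False] by (simp add: mone_def)
      qed
      then show ?thesis using * False u0 by (simp add: mone_def)
    qed
  qed
  ultimately show ?case by blast
qed

lemma upper_inverse:
  assumes "distinct \<phi>" "u \<in> upper_inv \<phi>"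
  obtains v where "v \<in> upper_inv \<phi>" "mmult (set \<phi>) u v = mone (set \<phi>)" "mmult (set \<phi>) v u = mone (set \<phi>)"
proof -
  let ?K = "set \<phi>"
  obtain v where v: "v \<in> upper_inv \<phi>" "mmult ?K u v = mone ?K"
    using upper_right_inverse assms by blast
  obtain w where w: "w \<in> upper_inv \<phi>" "mmult ?K v w = mone ?K"
    using upper_right_inverse assms v by blast
  have c: "u \<in> carrier (matrices ?K)" "w \<in> carrier (matrices ?K)"
    using assms w by (auto simp: upper_inv_def upper_carrier)
  have "u = mmult ?K u (mmult ?K v w)" using c w by (simp add: mmult_one_right)
  also have "\<dots> = w" using c v by (simp add: mmult_assoc[symmetric] mmult_one_left)
  finally show ?thesis using that v w by auto
qed

lemma upper_inv_Units:
  fixes u :: "('a, 'f::field) mat"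
  assumes "distinct \<phi>" "u \<in> upper_inv \<phi>"
  shows "u \<in> Units (matrices (set \<phi>))" and "inv\<^bsub>matrices (set \<phi>)\<^esub> u \<in> upper_inv \<phi>"
proof -
  interpret Group.monoid "matrices (set \<phi>) :: ('a, 'f) mat monoid" by (rule monoid_matrices) simp
  obtain v where v: "v \<in> upper_inv \<phi>" "mmult (set \<phi>) u v = mone (set \<phi>)" "mmult (set \<phi>) v u = mone (set \<phi>)"
    using upper_inverse assms by blast
  have c: "u \<in> carrier (matrices (set \<phi>))" "v \<in> carrier (matrices (set \<phi>))"
    using assms v by (auto simp: upper_inv_def upper_carrier)
  then show "u \<in> Units (matrices (set \<phi>))" unfolding Units_def using v by auto
  have "inv\<^bsub>matrices (set \<phi>)\<^esub> u = v" by (rule inv_unique'[symmetric]) (use c v in auto)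
  then show "inv\<^bsub>matrices (set \<phi>)\<^esub> u \<in> upper_inv \<phi>" using v by simp
qed

lemma unitriangular_iff:
  assumes "distinct \<phi>"
  shows "u \<in> unitriangular \<phi> \<longleftrightarrow> u \<in> upper \<phi> \<and> (\<forall>i\<in>set \<phi>. u i i = 1)"
proof
  assume u: "u \<in> unitriangular \<phi>"
  then have "u \<in> carrier (matrices (set \<phi>))" unfolding unitriangular_def Units_def by auto
  then show "u \<in> upper \<phi> \<and> (\<forall>i\<in>set \<phi>. u i i = 1)"
    using u unfolding unitriangular_def carrier_matrices upper_def by auto
next
  assume u: "u \<in> upper \<phi> \<and> (\<forall>i\<in>set \<phi>. u i i = 1)"
  then have "u \<in> upper_inv \<phi>" by (auto simp: upper_inv_def)
  then show "u \<in> unitriangular \<phi>"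
    using upper_inv_Units(1)[OF assms] u unfolding unitriangular_def upper_def by auto
qed

lemma unitriangular_minus_one:
  assumes "distinct \<phi>"
  shows "u \<in> unitriangular \<phi> \<longleftrightarrow> u - mone (set \<phi>) \<in> strict_upper \<phi>"
proof
  assume "u \<in> unitriangular \<phi>"
  then show "u - mone (set \<phi>) \<in> strict_upper \<phi>"
    unfolding unitriangular_iff[OF assms] upper_def strict_upper_def mone_def
    by (auto split: if_splits)
next
  assume *: "u - mone (set \<phi>) \<in> strict_upper \<phi>"
  have "u i j = mone (set \<phi>) i j" if "\<not> before \<phi> i j" for i j
    using * that unfolding strict_upper_def by auto
  then show "u \<in> unitriangular \<phi>"
    using before_irrefl[OF assms] before_in_set[of \<phi>]
    unfolding unitriangular_iff[OF assms] upper_def mone_def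
    by (auto split: if_splits) (metis zero_neq_one)+
qed

section \<open>Diagonal matrices and elementary row and column operations\<close>

definition diag_mat :: "'a set \<Rightarrow> ('a \<Rightarrow> 'f::field) \<Rightarrow> ('a, 'f) mat" where
  "diag_mat K d = (\<lambda>i j. if i = j \<and> i \<in> K then d i else 0)"

text \<open>The identity with an extra row \<open>r\<close>. Multiplying on the left adds
  \<open>c k\<close> times row \<open>k\<close> to row \<open>r\<close>, for every \<open>k\<close>
  after \<open>r\<close>; multiplying on the right adds \<open>c j\<close> times column
  \<open>r\<close> to column \<open>j\<close>, for every \<open>j\<close> after
  \<open>r\<close>.\<close>

definition row_mat :: "'a list \<Rightarrow> 'a \<Rightarrow> ('a \<Rightarrow> 'f::field) \<Rightarrow> ('a, 'f) mat" where
  "row_mat \<phi> r c = (\<lambda>i j. mone (set \<phi>) i j + (if i = r \<and> before \<phi> r j then c j else 0))"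

lemma diag_mat_upper_inv: "(\<And>i. i \<in> set \<phi> \<Longrightarrow> d i \<noteq> 0) \<Longrightarrow> diag_mat (set \<phi>) d \<in> upper_inv \<phi>"
  by (auto simp: diag_mat_def upper_inv_def upper_def split: if_splits)

lemma row_mat_upper_inv: "distinct \<phi> \<Longrightarrow> row_mat \<phi> r c \<in> upper_inv \<phi>"
  using before_irrefl[of \<phi>] before_in_set[of \<phi>]
  by (auto simp: row_mat_def mone_def upper_inv_def upper_def split: if_splits)

lemma row_mat_diag: "distinct \<phi> \<Longrightarrow> i \<in> set \<phi> \<Longrightarrow> row_mat \<phi> r c i i = 1"
  using before_irrefl[of \<phi>] by (auto simp: row_mat_def mone_def)

lemma mmult_diag_mat_left:
  assumes "finite K" "n \<in> carrier (matrices K)"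
  shows "mmult K (diag_mat K d) n = (\<lambda>i j. d i * n i j)"
proof (intro ext)
  fix i j
  have "mmult K (diag_mat K d) n i j = (\<Sum>k\<in>K. if k = i then d i * n i j else 0)"
    unfolding mmult_def diag_mat_def by (intro sum.cong) auto
  then show "mmult K (diag_mat K d) n i j = d i * n i j"
    using assms by (auto simp: carrier_matrices)
qed

lemma mmult_diag_mat_right:
  assumes "finite K" "n \<in> carrier (matrices K)"
  shows "mmult K n (diag_mat K d) = (\<lambda>i j. n i j * d j)"
proof (intro ext)
  fix i j
  have "mmult K n (diag_mat K d) i j = (\<Sum>k\<in>K. if k = j then n i j * d j else 0)"
    unfolding mmult_def diag_mat_def by (intro sum.cong) auto
  then show "mmult K n (diag_mat K d) i j = n i j * d j"
    using assms by (auto simp: carrier_matrices)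
qed

lemma mmult_row_mat_left:
  assumes "n \<in> carrier (matrices (set \<phi>))"
  shows "mmult (set \<phi>) (row_mat \<phi> r c) n i j =
    n i j + (if i = r then \<Sum>k | before \<phi> r k. c k * n k j else 0)"
proof -
  have "mmult (set \<phi>) (row_mat \<phi> r c) n i j = mmult (set \<phi>) (mone (set \<phi>)) n i j +
      (\<Sum>k\<in>set \<phi>. if before \<phi> r k \<and> i = r then c k * n k j else 0)"
    unfolding mmult_def row_mat_def sum.distrib[symmetric] by (intro sum.cong) (auto simp: algebra_simps)
  moreover have "(\<Sum>k\<in>set \<phi>. if before \<phi> r k then c k * n k j else 0) = (\<Sum>k | before \<phi> r k. c k * n k j)"
    by (rule sum.mono_neutral_cong_right) (auto dest: before_in_set)
  ultimately show ?thesis using mmult_one_left[OF _ assms] by auto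
qed

lemma mmult_row_mat_right:
  assumes "n \<in> carrier (matrices (set \<phi>))"
  shows "mmult (set \<phi>) n (row_mat \<phi> r c) i j = n i j + (if before \<phi> r j then n i r * c j else 0)"
proof -
  have "mmult (set \<phi>) n (row_mat \<phi> r c) i j = mmult (set \<phi>) n (mone (set \<phi>)) i j +
      (\<Sum>k\<in>set \<phi>. if k = r then (if before \<phi> r j then n i r * c j else 0) else 0)"
    unfolding mmult_def row_mat_def sum.distrib[symmetric] by (intro sum.cong) (auto simp: algebra_simps)
  then show ?thesis using mmult_one_right[OF _ assms] by (auto dest: before_in_set)
qed

lemma inv_upper_diag:
  fixes u :: "('a, 'f::field) mat"
  assumes "distinct \<phi>" "u \<in> upper_inv \<phi>" "i \<in> set \<phi>"
  shows "u i i * (inv\<^bsub>matrices (set \<phi>)\<^esub> u) i i = 1"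
proof -
  let ?v = "inv\<^bsub>matrices (set \<phi>)\<^esub> u"
  interpret Group.monoid "matrices (set \<phi>) :: ('a, 'f) mat monoid" by (rule monoid_matrices) simp
  have "mmult (set \<phi>) u ?v i i = u i i * ?v i i"
    using assms upper_inv_Units(2) by (intro mmult_diag) (auto simp: upper_inv_def)
  moreover have "mmult (set \<phi>) u ?v = mone (set \<phi>)"
    using Units_r_inv[OF upper_inv_Units(1)[OF assms(1,2)]] by simp
  ultimately show ?thesis using assms(3) by (simp add: mone_def)
qed


section \<open>Superclasses\<close>

text \<open>The diagonal matrix \<open>t\<close> of a superclass relation is absorbed into the triangular factors;
  the condition on the diagonals says that they carry \<open>t\<close> and its inverse.\<close>

definition sc_equiv :: "'a list \<Rightarrow> ('a, 'f::field) mat \<Rightarrow> ('a, 'f) mat \<Rightarrow> bool" where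
  "sc_equiv \<phi> n n' \<longleftrightarrow> (\<exists>a\<in>upper_inv \<phi>. \<exists>b\<in>upper_inv \<phi>. (\<forall>i\<in>set \<phi>. a i i * b i i = 1) \<and>
     n' = mmult (set \<phi>) (mmult (set \<phi>) a n) b)"

lemma superclass_rel_imp_sc_equiv:
  fixes u v :: "('a, 'f::field) mat"
  assumes d: "distinct \<phi>" and "superclass_rel \<phi> u v"
  shows "sc_equiv \<phi> (u - mone (set \<phi>)) (v - mone (set \<phi>))"
proof -
  let ?K = "set \<phi>" and ?M = "matrices (set \<phi>) :: ('a, 'f) mat monoid"
  interpret Group.monoid ?M by (rule monoid_matrices) simp
  obtain a b t where abt: "a \<in> unitriangular \<phi>" "b \<in> unitriangular \<phi>" "t \<in> inv_diagonal ?K"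
    "v - mone ?K = mmult ?K (mmult ?K (mmult ?K (mmult ?K t a) (u - mone ?K)) (inv\<^bsub>?M\<^esub> b)) (inv\<^bsub>?M\<^esub> t)"
    using assms(2) unfolding superclass_rel_def Let_def by auto
  have a: "a \<in> upper_inv \<phi>" "\<forall>i\<in>?K. a i i = 1" and b: "b \<in> upper_inv \<phi>" "\<forall>i\<in>?K. b i i = 1"
    using abt d by (auto simp: unitriangular_iff upper_inv_def)
  have tU: "t \<in> Units ?M" and t0: "\<And>i j. i \<noteq> j \<Longrightarrow> t i j = 0"
    using abt by (auto simp: inv_diagonal_def)
  have tc: "t \<in> carrier ?M" using tU by (simp add: Units_closed)
  have "t i i \<noteq> 0" if "i \<in> ?K" for i
  proof
    assume "t i i = 0"
    then have "t i k = 0" for k using t0 by (cases "i = k") auto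
    then have "mmult ?K t (inv\<^bsub>?M\<^esub> t) i i = 0" by (simp add: mmult_def)
    then show False using Units_r_inv[OF tU] that by (simp add: mone_def)
  qed
  then have t: "t \<in> upper_inv \<phi>"
    using t0 tc unfolding upper_inv_def upper_def carrier_matrices by auto
  let ?A = "mmult ?K t a" and ?B = "mmult ?K (inv\<^bsub>?M\<^esub> b) (inv\<^bsub>?M\<^esub> t)"
  have up: "t \<in> upper \<phi>" "a \<in> upper \<phi>" "inv\<^bsub>?M\<^esub> b \<in> upper \<phi>" "inv\<^bsub>?M\<^esub> t \<in> upper \<phi>"
    using a t upper_inv_Units(2)[OF d b(1)] upper_inv_Units(2)[OF d t] by (auto simp: upper_inv_def)
  have "?A \<in> upper_inv \<phi>" "?B \<in> upper_inv \<phi>"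
    using d a b t by (simp_all add: mmult_upper_inv upper_inv_Units(2))
  moreover have "?A i i * ?B i i = 1" if "i \<in> ?K" for i
    using inv_upper_diag[OF d b(1) that] inv_upper_diag[OF d t that] a b that
    by (simp add: mmult_diag[OF d up(1,2)] mmult_diag[OF d up(3,4)])
  moreover have "v - mone ?K = mmult ?K (mmult ?K ?A (u - mone ?K)) ?B"
    using abt(4) by (simp add: mmult_assoc)
  ultimately show ?thesis unfolding sc_equiv_def by blast
qed

lemma sc_equiv_imp_superclass_rel:
  fixes u v :: "('a, 'f::field) mat"
  assumes d: "distinct \<phi>" and "sc_equiv \<phi> (u - mone (set \<phi>)) (v - mone (set \<phi>))"
  shows "superclass_rel \<phi> u v"
proof -
  let ?K = "set \<phi>" and ?M = "matrices (set \<phi>) :: ('a, 'f) mat monoid"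
  interpret Group.monoid ?M by (rule monoid_matrices) simp
  obtain A B where AB: "A \<in> upper_inv \<phi>" "B \<in> upper_inv \<phi>" "\<forall>i\<in>?K. A i i * B i i = 1"
    "v - mone ?K = mmult ?K (mmult ?K A (u - mone ?K)) B"
    using assms(2) unfolding sc_equiv_def by blast
  \<comment> \<open>The diagonal of \<open>A\<close> is the only candidate for \<open>t\<close>.
    Then \<open>t' A\<close> is unitriangular, and so is \<open>B t\<close> because of the condition
    on the diagonals; the wanted \<open>b\<close> is the inverse of \<open>B t\<close>.\<close>
  define t where "t = diag_mat ?K (\<lambda>i. A i i)"
  define t' where "t' = inv\<^bsub>?M\<^esub> t"
  have t: "t \<in> upper_inv \<phi>" unfolding t_def using AB by (intro diag_mat_upper_inv) (auto simp: upper_inv_def)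
  have tU: "t \<in> Units ?M" and t': "t' \<in> upper_inv \<phi>"
    using upper_inv_Units[OF d t] by (auto simp: t'_def)
  have tt: "mmult ?K t t' = mone ?K" using Units_r_inv[OF tU] by (simp add: t'_def)
  define a where "a = mmult ?K t' A"
  define b' where "b' = mmult ?K B t"
  have b'i: "b' \<in> upper_inv \<phi>" using d AB t by (simp add: b'_def mmult_upper_inv)
  have ti: "t i i = A i i" if "i \<in> ?K" for i using that by (simp add: t_def diag_mat_def)
  have up: "A \<in> upper \<phi>" "B \<in> upper \<phi>" "t \<in> upper \<phi>" "t' \<in> upper \<phi>" using AB t t' by (auto simp: upper_inv_def)
  have c: "A \<in> carrier ?M" "B \<in> carrier ?M" using up by (auto intro: upper_carrier)
  have "a \<in> unitriangular \<phi>"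
    unfolding unitriangular_iff[OF d] a_def
    using mmult_upper[OF d up(4,1)] mmult_diag[OF d up(4,1)] inv_upper_diag[OF d t] ti
    by (auto simp: t'_def mult.commute)
  moreover have "inv\<^bsub>?M\<^esub> b' \<in> unitriangular \<phi>"
    unfolding unitriangular_iff[OF d]
    using upper_inv_Units(2)[OF d b'i] inv_upper_diag[OF d b'i] mmult_diag[OF d up(2,3)] ti AB(3)
    by (auto simp: upper_inv_def b'_def mult.commute)
  moreover have "t \<in> inv_diagonal ?K"
    using tU by (auto simp: inv_diagonal_def t_def diag_mat_def)
  moreover have "inv\<^bsub>?M\<^esub> (inv\<^bsub>?M\<^esub> b') = b'" by (rule Units_inv_inv[OF upper_inv_Units(1)[OF d b'i]])
  moreover have "mmult ?K t a = A"
    using c by (simp add: a_def mmult_assoc[symmetric] tt mmult_one_left)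
  moreover have "mmult ?K b' t' = B"
    using c by (simp add: b'_def mmult_assoc tt mmult_one_right)
  then have "v - mone ?K = mmult ?K (mmult ?K (mmult ?K A (u - mone ?K)) b') t'"
    using AB(4) by (simp add: mmult_assoc)
  ultimately show ?thesis
    unfolding superclass_rel_def Let_def mult_matrices one_matrices t'_def by metis
qed

lemma superclass_rel_iff:
  "distinct \<phi> \<Longrightarrow> superclass_rel \<phi> u v \<longleftrightarrow> sc_equiv \<phi> (u - mone (set \<phi>)) (v - mone (set \<phi>))"
  using superclass_rel_imp_sc_equiv sc_equiv_imp_superclass_rel by blast

lemma sc_equivI:
  "a \<in> upper_inv \<phi> \<Longrightarrow> b \<in> upper_inv \<phi> \<Longrightarrow> (\<And>i. i \<in> set \<phi> \<Longrightarrow> a i i * b i i = 1) \<Longrightarrow>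
    sc_equiv \<phi> n (mmult (set \<phi>) (mmult (set \<phi>) a n) b)"
  unfolding sc_equiv_def by blast

lemma sc_equiv_trans:
  assumes d: "distinct \<phi>" and "sc_equiv \<phi> n n'" "sc_equiv \<phi> n' n''"
  shows "sc_equiv \<phi> n n''"
proof -
  let ?K = "set \<phi>"
  obtain a b where ab: "a \<in> upper_inv \<phi>" "b \<in> upper_inv \<phi>" "\<forall>i\<in>?K. a i i * b i i = 1"
    "n' = mmult ?K (mmult ?K a n) b" using assms(2) unfolding sc_equiv_def by blast
  obtain c e where ce: "c \<in> upper_inv \<phi>" "e \<in> upper_inv \<phi>" "\<forall>i\<in>?K. c i i * e i i = 1"
    "n'' = mmult ?K (mmult ?K c n') e" using assms(3) unfolding sc_equiv_def by blast
  have up: "a \<in> upper \<phi>" "b \<in> upper \<phi>" "c \<in> upper \<phi>" "e \<in> upper \<phi>" using ab ce by (auto simp: upper_inv_def)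
  have "n'' = mmult ?K (mmult ?K (mmult ?K c a) n) (mmult ?K b e)"
    using ab(4) ce(4) by (simp add: mmult_assoc)
  moreover have "mmult ?K c a i i * mmult ?K b e i i = 1" if "i \<in> ?K" for i
  proof -
    have "mmult ?K c a i i * mmult ?K b e i i = (a i i * b i i) * (c i i * e i i)"
      using mmult_diag[OF d up(3,1)] mmult_diag[OF d up(2,4)] by simp
    then show ?thesis using ab(3) ce(3) that by simp
  qed
  ultimately show ?thesis
    using sc_equivI[of "mmult ?K c a" \<phi> "mmult ?K b e" n] mmult_upper_inv[OF d] ab(1,2) ce(1,2)
    by metis
qed

lemma sc_equiv_refl: "n \<in> carrier (matrices (set \<phi>)) \<Longrightarrow> sc_equiv \<phi> n n"
  unfolding sc_equiv_def
  by (intro bexI[of _ "mone (set \<phi>)"])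
    (simp_all add: mmult_one_left mmult_one_right mone_upper_inv, simp add: mone_def)

lemma sc_equiv_sym:
  assumes d: "distinct \<phi>" and n: "n \<in> carrier (matrices (set \<phi>))" and "sc_equiv \<phi> n n'"
  shows "sc_equiv \<phi> n' n"
proof -
  let ?K = "set \<phi>"
  obtain a b where ab: "a \<in> upper_inv \<phi>" "b \<in> upper_inv \<phi>" "\<forall>i\<in>?K. a i i * b i i = 1"
    "n' = mmult ?K (mmult ?K a n) b" using assms(3) unfolding sc_equiv_def by blast
  obtain c where c: "c \<in> upper_inv \<phi>" "mmult ?K c a = mone ?K" using upper_inverse[OF d ab(1)] by metis
  obtain e where e: "e \<in> upper_inv \<phi>" "mmult ?K b e = mone ?K" using upper_inverse[OF d ab(2)] by metis
  have up: "a \<in> upper \<phi>" "b \<in> upper \<phi>" "c \<in> upper \<phi>" "e \<in> upper \<phi>" using ab c e by (auto simp: upper_inv_def)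
  have "mmult ?K (mmult ?K c n') e = mmult ?K (mmult ?K (mmult ?K c a) n) (mmult ?K b e)"
    using ab(4) by (simp add: mmult_assoc)
  also have "\<dots> = n" using n by (simp add: c e mmult_one_left mmult_one_right)
  finally have "n = mmult ?K (mmult ?K c n') e" by simp
  moreover have "c i i * e i i = 1" if "i \<in> ?K" for i
  proof -
    have "c i i * a i i = 1" "b i i * e i i = 1"
      using mmult_diag[OF d up(3,1), of i] mmult_diag[OF d up(2,4), of i] c e that by (auto simp: mone_def)
    moreover have "(c i i * e i i) * (a i i * b i i) = (c i i * a i i) * (b i i * e i i)" by simp
    ultimately show ?thesis using ab(3) that by simp
  qed
  ultimately show ?thesis using sc_equivI[of c \<phi> e n'] c(1) e(1) by metis
qed

lemma sc_equiv_strict_upper: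
  "distinct \<phi> \<Longrightarrow> n \<in> strict_upper \<phi> \<Longrightarrow> sc_equiv \<phi> n n' \<Longrightarrow> n' \<in> strict_upper \<phi>"
  unfolding sc_equiv_def by (auto simp: upper_inv_def intro: mmult_strict_upper)

section \<open>Partial permutation matrices and uniqueness of the reduced form\<close>

definition arc_mat :: "'a arcs \<Rightarrow> ('a, 'f::field) mat" where
  "arc_mat \<mu> = (\<lambda>i j. if (i, j) \<in> \<mu> then 1 else 0)"

lemma arc_mat_strict_upper: "\<mu> \<in> set_partitions \<phi> \<Longrightarrow> arc_mat \<mu> \<in> strict_upper \<phi>"
  by (auto simp: strict_upper_def arc_mat_def dest: set_partitions_before)

lemma superclass_rep_eq:
  assumes "finite \<mu>"
  shows "superclass_rep \<phi> \<mu> = mone (set \<phi>) + arc_mat \<mu>"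
proof -
  have *: "(\<Sum>x\<in>S. f x) r s = (\<Sum>x\<in>S. f x r s)" for S and f :: "'x \<Rightarrow> ('a, 'f::field) mat" and r s
    by (induction S rule: infinite_finite_induct) auto
  have "(\<Sum>(i, j)\<in>\<mu>. elem_mat i j :: ('a, 'f::field) mat) = arc_mat \<mu>"
  proof (intro ext)
    fix r s
    have "(\<Sum>(i, j)\<in>\<mu>. elem_mat i j :: ('a, 'f::field) mat) r s = (\<Sum>p\<in>\<mu>. if p = (r, s) then 1 else 0)"
      unfolding * by (intro sum.cong) (auto simp: elem_mat_def split: prod.splits)
    then show "(\<Sum>(i, j)\<in>\<mu>. elem_mat i j :: ('a, 'f::field) mat) r s = arc_mat \<mu> r s"
      using assms by (simp add: arc_mat_def)
  qed
  then show ?thesis unfolding superclass_rep_def by simp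
qed

text \<open>Comparing the two sides of \<open>a e\<^sub>\<mu> = e\<^sub>\<nu> b\<^sup>-\<^sup>1\<close> at the positions of the arcs of \<open>\<mu>\<close>.\<close>

lemma sc_equiv_arc_mat_le:
  assumes d: "distinct \<phi>" and \<mu>: "\<mu> \<in> set_partitions \<phi>" and \<nu>: "\<nu> \<in> set_partitions \<phi>"
    and eq: "sc_equiv \<phi> (arc_mat \<mu> :: ('a, 'f::field) mat) (arc_mat \<nu>)" and kl: "(k, l) \<in> \<mu>"
  shows "\<exists>l'. (k, l') \<in> \<nu> \<and> (l' = l \<or> before \<phi> l' l)"
proof -
  let ?K = "set \<phi>"
  obtain a b :: "('a, 'f) mat" where ab: "a \<in> upper_inv \<phi>" "b \<in> upper_inv \<phi>"
    "arc_mat \<nu> = mmult ?K (mmult ?K a (arc_mat \<mu>)) b" using eq unfolding sc_equiv_def by blast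
  obtain e where e: "e \<in> upper_inv \<phi>" "mmult ?K b e = mone ?K" using upper_inverse[OF d ab(2)] by metis
  have c: "mmult ?K a (arc_mat \<mu>) \<in> carrier (matrices ?K)"
    using ab(1) \<mu> by (intro mmult_carrier) (auto simp: upper_inv_def intro: upper_carrier strict_upper_carrier arc_mat_strict_upper)
  have k: "k \<in> ?K" using before_in_set set_partitions_before[OF \<mu> kl] by metis
  have "mmult ?K a (arc_mat \<mu>) k l = (\<Sum>i\<in>?K. if i = k then a k k else 0)"
    unfolding mmult_def arc_mat_def using \<mu> kl by (intro sum.cong) (auto simp: set_partitions_iff)
  then have "mmult ?K a (arc_mat \<mu>) k l \<noteq> 0" using k ab(1) by (simp add: upper_inv_def)
  moreover have "mmult ?K (arc_mat \<nu>) e = mmult ?K a (arc_mat \<mu>)"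
    unfolding ab(3) using c e by (simp add: mmult_assoc[of _ _ b e] mmult_one_right)
  ultimately have "mmult ?K (arc_mat \<nu>) e k l \<noteq> 0" by simp
  then obtain l' where "arc_mat \<nu> k l' \<noteq> (0::'f)" "e l' l \<noteq> 0" by (rule mmult_nonzero)
  then show ?thesis using e(1) by (auto simp: arc_mat_def upper_inv_def upper_def split: if_splits)
qed

text \<open>Going from \<mu> to \<nu> and back can only move the right end of an arc from
  \<open>k\<close> to the left, and it comes back to an arc of \<mu> from \<open>k\<close>, which is
  the one it started from. So it never moved.\<close>

lemma sc_equiv_arc_mat_subset:
  assumes d: "distinct \<phi>" and \<mu>: "\<mu> \<in> set_partitions \<phi>" and \<nu>: "\<nu> \<in> set_partitions \<phi>"
    and eq: "sc_equiv \<phi> (arc_mat \<mu> :: ('a, 'f::field) mat) (arc_mat \<nu>)"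
  shows "\<mu> \<subseteq> \<nu>"
proof clarify
  fix k l assume kl: "(k, l) \<in> \<mu>"
  have eq': "sc_equiv \<phi> (arc_mat \<nu> :: ('a, 'f::field) mat) (arc_mat \<mu>)"
    by (rule sc_equiv_sym[OF d strict_upper_carrier[OF arc_mat_strict_upper[OF \<mu>]] eq])
  obtain l' where l': "(k, l') \<in> \<nu>" "l' = l \<or> before \<phi> l' l"
    using sc_equiv_arc_mat_le[OF d \<mu> \<nu> eq kl] by blast
  obtain l'' where l'': "(k, l'') \<in> \<mu>" "l'' = l' \<or> before \<phi> l'' l'"
    using sc_equiv_arc_mat_le[OF d \<nu> \<mu> eq' l'(1)] by blast
  have "l'' = l" using l''(1) kl \<mu> unfolding set_partitions_iff by blast
  then have "l' = l" using l'(2) l''(2) before_asym[OF d] by blast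
  then show "(k, l) \<in> \<nu>" using l' by simp
qed

lemma sc_equiv_arc_mat_unique:
  assumes "distinct \<phi>" "\<mu> \<in> set_partitions \<phi>" "\<nu> \<in> set_partitions \<phi>"
    "sc_equiv \<phi> (arc_mat \<mu> :: ('a, 'f::field) mat) (arc_mat \<nu>)"
  shows "\<mu> = \<nu>"
  by (meson assms sc_equiv_arc_mat_subset sc_equiv_sym subset_antisym strict_upper_carrier arc_mat_strict_upper)

section \<open>Reduction on diagonal blocks and on block sums\<close>

text \<open>For upper triangular factors only indices \<open>k\<close> weakly between
  \<open>i\<close> and \<open>j\<close> contribute to the entry at \<open>(i, j)\<close>. So the
  restriction to an order-convex \<open>J\<close> is multiplicative.\<close>

lemma restr_mat_mmult:
  assumes "distinct \<rho>" "u \<in> upper \<rho>" "v \<in> upper \<rho>"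
    and "\<And>i j k. i \<in> J \<Longrightarrow> j \<in> J \<Longrightarrow> before \<rho> i k \<Longrightarrow> before \<rho> k j \<Longrightarrow> k \<in> J"
  shows "restr_mat J (mmult (set \<rho>) u v) = mmult (set \<rho> \<inter> J) (restr_mat J u) (restr_mat J v)"
proof (intro ext)
  fix i j
  show "restr_mat J (mmult (set \<rho>) u v) i j = mmult (set \<rho> \<inter> J) (restr_mat J u) (restr_mat J v) i j"
  proof (cases "i \<in> J \<and> j \<in> J")
    case True
    have "u i k * v k j = 0" if "k \<notin> J" for k
      using assms(2,3) assms(4)[of i j k] True that unfolding upper_def by auto
    then have "(\<Sum>k\<in>set \<rho>. u i k * v k j) = (\<Sum>k\<in>set \<rho> \<inter> J. restr_mat J u i k * restr_mat J v k j)"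
      using True by (intro sum.mono_neutral_cong_right) (auto simp: restr_mat_def)
    then show ?thesis using True by (simp add: restr_mat_def mmult_def)
  next
    case False
    then show ?thesis by (auto simp: restr_mat_def mmult_def)
  qed
qed

lemma restr_mat_upper_inv: "u \<in> upper_inv \<rho> \<Longrightarrow> restr_mat J u \<in> upper_inv (restr_order J \<rho>)"
  by (auto simp: upper_inv_def upper_def restr_mat_def)

lemma sc_equiv_restr:
  assumes d: "distinct \<rho>" and n: "n \<in> strict_upper \<rho>" and eq: "sc_equiv \<rho> n n'"
    and conv: "\<And>i j k. i \<in> J \<Longrightarrow> j \<in> J \<Longrightarrow> before \<rho> i k \<Longrightarrow> before \<rho> k j \<Longrightarrow> k \<in> J"
  shows "sc_equiv (restr_order J \<rho>) (restr_mat J n) (restr_mat J n')"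
proof -
  let ?K = "set \<rho>"
  obtain a b where ab: "a \<in> upper_inv \<rho>" "b \<in> upper_inv \<rho>" "\<forall>i\<in>?K. a i i * b i i = 1"
    "n' = mmult ?K (mmult ?K a n) b" using eq unfolding sc_equiv_def by blast
  have up: "a \<in> upper \<rho>" "b \<in> upper \<rho>" "n \<in> upper \<rho>"
    using ab n by (auto simp: upper_inv_def strict_upper_upper)
  have "restr_mat J n' = mmult (?K \<inter> J) (mmult (?K \<inter> J) (restr_mat J a) (restr_mat J n)) (restr_mat J b)"
  proof -
    have "restr_mat J (mmult ?K a n) = mmult (?K \<inter> J) (restr_mat J a) (restr_mat J n)"
      by (rule restr_mat_mmult[OF d up(1,3)]) (use conv in blast)
    moreover have "restr_mat J n' = mmult (?K \<inter> J) (restr_mat J (mmult ?K a n)) (restr_mat J b)"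
      unfolding ab(4) by (rule restr_mat_mmult[OF d mmult_upper[OF d up(1,3)] up(2)]) (use conv in blast)
    ultimately show ?thesis by simp
  qed
  then show ?thesis
    unfolding sc_equiv_def using restr_mat_upper_inv[OF ab(1), of J] restr_mat_upper_inv[OF ab(2), of J] ab(3)
    by (intro bexI[of _ "restr_mat J a"] bexI[of _ "restr_mat J b"]) (auto simp: restr_mat_def)
qed

lemma mmult_block_sum:
  assumes "finite I" "finite J" "I \<inter> J = {}" "u \<in> carrier (matrices I)" "u' \<in> carrier (matrices I)"
    "v \<in> carrier (matrices J)" "v' \<in> carrier (matrices J)"
  shows "mmult (I \<union> J) (u + v) (u' + v') = mmult I u u' + mmult J v v'"
proof (intro ext)
  fix i j
  have z: "v i k = 0" "v k i = 0" "v' i k = 0" "v' k i = 0" if "k \<in> I" for i k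
    using that assms(3,6,7) unfolding carrier_matrices by blast+
  have z': "u i k = 0" "u k i = 0" "u' i k = 0" "u' k i = 0" if "k \<in> J" for i k
    using that assms(3,4,5) unfolding carrier_matrices by blast+
  have "(\<Sum>k\<in>I. (u + v) i k * (u' + v') k j) = (\<Sum>k\<in>I. u i k * u' k j)"
    by (intro sum.cong) (simp_all add: z)
  moreover have "(\<Sum>k\<in>J. (u + v) i k * (u' + v') k j) = (\<Sum>k\<in>J. v i k * v' k j)"
    by (intro sum.cong) (simp_all add: z')
  ultimately show "mmult (I \<union> J) (u + v) (u' + v') i j = (mmult I u u' + mmult J v v') i j"
    unfolding mmult_def using assms(1-3) by (simp add: sum.union_disjoint)
qed

lemma block_sum_upper_inv:
  assumes "I \<inter> J = {}" "set \<rho> = I \<union> J" "u \<in> upper_inv (restr_order I \<rho>)" "v \<in> upper_inv (restr_order J \<rho>)"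
  shows "u + v \<in> upper_inv \<rho>"
proof -
  have z: "u i i = 0" if "i \<notin> I" for i using assms(3) that by (auto simp: upper_inv_def upper_def)
  have z': "v i i = 0" if "i \<notin> J" for i using assms(4) that by (auto simp: upper_inv_def upper_def)
  have "u + v \<in> upper \<rho>" using assms(3,4) unfolding upper_inv_def upper_def
    by (auto) (metis add.left_neutral)+
  moreover have "(u + v) i i \<noteq> 0" if "i \<in> set \<rho>" for i
    using assms z[of i] z'[of i] that by (cases "i \<in> I") (auto simp: upper_inv_def disjoint_iff)
  ultimately show ?thesis by (simp add: upper_inv_def)
qed

text \<open>Block-diagonal matrices multiply blockwise whatever the order of the indices, so
  \<open>I\<close> and \<open>J\<close> may interleave in \<rho>. The coproduct needs this for all
  shuffles.\<close>

lemma sc_equiv_block_sum: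
  assumes IJ: "I \<inter> J = {}" "set \<rho> = I \<union> J"
    and n: "n \<in> strict_upper (restr_order I \<rho>)" and m: "m \<in> strict_upper (restr_order J \<rho>)"
    and eqs: "sc_equiv (restr_order I \<rho>) n n'" "sc_equiv (restr_order J \<rho>) m m'"
  shows "sc_equiv \<rho> (n + m) (n' + m')"
proof -
  have K: "set \<rho> \<inter> I = I" "set \<rho> \<inter> J = J" using IJ by auto
  have fin: "finite I" "finite J" using IJ(2) by (metis finite_Un List.finite_set)+
  obtain a b where ab: "a \<in> upper_inv (restr_order I \<rho>)" "b \<in> upper_inv (restr_order I \<rho>)"
    "\<forall>i\<in>I. a i i * b i i = 1" "n' = mmult I (mmult I a n) b" using eqs(1) unfolding sc_equiv_def by (auto simp: K)
  obtain c e where ce: "c \<in> upper_inv (restr_order J \<rho>)" "e \<in> upper_inv (restr_order J \<rho>)"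
    "\<forall>i\<in>J. c i i * e i i = 1" "m' = mmult J (mmult J c m) e" using eqs(2) unfolding sc_equiv_def by (auto simp: K)
  have c: "a \<in> carrier (matrices I)" "b \<in> carrier (matrices I)" "n \<in> carrier (matrices I)"
    "c \<in> carrier (matrices J)" "e \<in> carrier (matrices J)" "m \<in> carrier (matrices J)"
    using upper_carrier[of _ "restr_order I \<rho>"] upper_carrier[of _ "restr_order J \<rho>"] ab ce
      strict_upper_carrier[OF n] strict_upper_carrier[OF m]
    by (auto simp: upper_inv_def K)
  have "n' + m' = mmult (I \<union> J) (mmult (I \<union> J) (a + c) (n + m)) (b + e)"
    using ab(4) ce(4) fin IJ c by (simp add: mmult_block_sum mmult_carrier)
  moreover have "(a + c) i i * (b + e) i i = 1" if "i \<in> I \<union> J" for i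
  proof (cases "i \<in> I")
    case True
    then have "c i i = 0" "e i i = 0" using c IJ(1) unfolding carrier_matrices by blast+
    then show ?thesis using True ab(3) by simp
  next
    case False
    then have "a i i = 0" "b i i = 0" "i \<in> J" using c that unfolding carrier_matrices by blast+
    then show ?thesis using ce(3) by simp
  qed
  ultimately show ?thesis
    using sc_equivI[of "a + c" \<rho> "b + e" "n + m"] block_sum_upper_inv[OF IJ] ab(1,2) ce(1,2) IJ(2) by metis
qed

lemma restr_mat_arc_mat: "restr_mat J (arc_mat \<mu>) = arc_mat (restr_arcs J \<mu>)"
  by (auto simp: restr_mat_def arc_mat_def fun_eq_iff)

section \<open>Existence of the reduced form\<close>

text \<open>The letter \<open>x\<close> comes first, so every other row may be added to row
  \<open>x\<close>. This empties row \<open>x\<close> in the columns that already hold a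
  pivot.\<close>

lemma sc_equiv_clear_columns:
  assumes d: "distinct (x # \<phi>)" and \<mu>: "\<mu> \<in> set_partitions \<phi>"
    and n: "n \<in> strict_upper (x # \<phi>)" and r: "\<And>i j. i \<noteq> x \<Longrightarrow> n i j = arc_mat \<mu> i j"
  obtains n' where "n' \<in> strict_upper (x # \<phi>)" "sc_equiv (x # \<phi>) n n'"
    "\<And>i j. i \<noteq> x \<Longrightarrow> n' i j = arc_mat \<mu> i j" "\<And>i j. (i, j) \<in> \<mu> \<Longrightarrow> n' x j = 0"
proof -
  let ?K = "set (x # \<phi>)"
  have nc: "n \<in> carrier (matrices ?K)" by (rule strict_upper_carrier[OF n])
  \<comment> \<open>If \<open>(k, l)\<close> is an arc of \<mu>, row \<open>k\<close> of
    \<open>n\<close> is the unit vector at \<open>l\<close>, and subtracting \<open>n x l\<close>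
    times this row clears the entry. The sum picks out the at most one such \<open>l\<close> and is
    zero if no arc starts at \<open>k\<close>.\<close>
  define c where "c = (\<lambda>k. - (\<Sum>l\<in>set \<phi>. arc_mat \<mu> k l * n x l))"
  define n' where "n' = mmult ?K (row_mat (x # \<phi>) x c) n"
  have bx: "before (x # \<phi>) x k \<longleftrightarrow> k \<in> set \<phi>" for k using before_in_set[of \<phi>] by auto
  have n'_eq: "n' i j = n i j + (if i = x then \<Sum>k\<in>set \<phi>. c k * n k j else 0)" for i j
    unfolding n'_def mmult_row_mat_left[OF nc] bx by simp
  have cond: "row_mat (x # \<phi>) x c i i * mone ?K i i = 1" if "i \<in> ?K" for i
    using row_mat_diag[OF d that] that by (simp add: mone_def)
  have "sc_equiv (x # \<phi>) n (mmult ?K (mmult ?K (row_mat (x # \<phi>) x c) n) (mone ?K))"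
    by (intro sc_equivI row_mat_upper_inv[OF d] mone_upper_inv cond)
  then have eq: "sc_equiv (x # \<phi>) n n'"
    unfolding n'_def using mmult_one_right[OF _ mmult_carrier[OF upper_carrier nc]] row_mat_upper_inv[OF d, of x c]
    by (simp add: upper_inv_def)
  have z: "n' x j = 0" if ij: "(i, j) \<in> \<mu>" for i j
  proof -
    have i: "i \<in> set \<phi>" "j \<in> set \<phi>" using before_in_set set_partitions_before[OF \<mu> ij] by metis+
    have "c i = - (\<Sum>l\<in>set \<phi>. if l = j then n x j else 0)"
      unfolding c_def using \<mu> ij by (intro arg_cong[where f = uminus] sum.cong) (auto simp: arc_mat_def set_partitions_iff)
    then have ci: "c i = - n x j" using i by simp
    have "(\<Sum>k\<in>set \<phi>. c k * n k j) = (\<Sum>k\<in>set \<phi>. if k = i then - n x j else 0)"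
    proof (rule sum.cong)
      fix k assume "k \<in> set \<phi>"
      then have "k \<noteq> x" using d by auto
      then have "n k j = arc_mat \<mu> k j" by (rule r)
      then show "c k * n k j = (if k = i then - n x j else 0)"
        using \<mu> ij ci by (auto simp: arc_mat_def set_partitions_iff)
    qed simp
    then show ?thesis using n'_eq i by simp
  qed
  show ?thesis
    by (rule that[OF sc_equiv_strict_upper[OF d n eq] eq _ z]) (simp_all add: n'_eq r)
qed

text \<open>The first nonzero entry of row \<open>x\<close>, in column \<open>m\<close>, becomes the
  new pivot. By \<open>z\<close> no arc of \<mu> ends in \<open>m\<close>, so column
  \<open>m\<close> is zero outside row \<open>x\<close>: adding it to later columns clears row
  \<open>x\<close> and leaves the other rows alone.\<close>

lemma sc_equiv_clear_row:
  assumes d: "distinct (x # \<phi>)" and \<mu>: "\<mu> \<in> set_partitions \<phi>"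
    and n: "n \<in> strict_upper (x # \<phi>)" and r: "\<And>i j. i \<noteq> x \<Longrightarrow> n i j = arc_mat \<mu> i j"
    and z: "\<And>i j. (i, j) \<in> \<mu> \<Longrightarrow> n x j = 0"
  shows "\<exists>\<nu>\<in>set_partitions (x # \<phi>). sc_equiv (x # \<phi>) n (arc_mat \<nu>)"
proof (cases "\<exists>j\<in>set \<phi>. n x j \<noteq> 0")
  case False
  have "n i j = arc_mat \<mu> i j" for i j
  proof (cases "i = x")
    case True
    then have "n i j = 0" using False n unfolding strict_upper_def by (auto dest: before_in_set)
    moreover have "(x, j) \<notin> \<mu>" using set_partitions_before[OF \<mu>, of x j] before_in_set d by fastforce
    ultimately show ?thesis using True by (simp add: arc_mat_def)
  qed (simp add: r)
  then have "n = arc_mat \<mu>" by (intro ext)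
  moreover have "\<mu> \<in> set_partitions (x # \<phi>)" using \<mu> unfolding set_partitions_iff by simp
  ultimately show ?thesis using sc_equiv_refl[OF strict_upper_carrier[OF n]] by auto
next
  case True
  let ?K = "set (x # \<phi>)"
  obtain ys m zs where split: "\<phi> = ys @ m # zs" "n x m \<noteq> 0" "\<And>y. y \<in> set ys \<Longrightarrow> n x y = 0"
    using split_list_first_prop[OF True] by auto
  have m: "m \<in> set \<phi>" "m \<noteq> x" "x \<notin> set \<phi>" using split d by auto
  have nc: "n \<in> carrier (matrices ?K)" by (rule strict_upper_carrier[OF n])
  have col: "(i, m) \<notin> \<mu>" for i using z split(2) by blast
  have row: "(x, j) \<notin> \<mu>" for j using set_partitions_before[OF \<mu>, of x j] before_in_set m by fastforce
  define \<nu> where "\<nu> = insert (x, m) \<mu>"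
  have \<nu>: "\<nu> \<in> set_partitions (x # \<phi>)"
    using \<mu> col row m unfolding \<nu>_def set_partitions_iff by auto
  define b where "b = row_mat (x # \<phi>) m (\<lambda>j. - n x j / n x m)"
  define n1 where "n1 = mmult ?K n b"
  have b: "b \<in> upper_inv (x # \<phi>)" unfolding b_def by (rule row_mat_upper_inv[OF d])
  have n1_eq: "n1 i j = n i j + (if before \<phi> m j then n i m * (- n x j / n x m) else 0)" for i j
    unfolding n1_def b_def mmult_row_mat_right[OF nc] using m by simp
  have n1_x: "n1 x j = (if j = m then n x m else 0)" for j
  proof -
    consider "j \<notin> set \<phi>" | "j \<in> set ys" | "j = m" | "before \<phi> m j"
      using split(1) by (auto)
    then show ?thesis
    proof cases
      case 1
      then have "n x j = 0" using n unfolding strict_upper_def by (auto dest: before_in_set)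
      then show ?thesis using 1 m(1) by (auto simp: n1_eq)
    next
      case 2
      then have "before \<phi> j m" "n x j = 0" using split(1,3) by auto
      then show ?thesis using before_asym[of \<phi> j m] before_irrefl[of \<phi>] d by (auto simp: n1_eq)
    next
      case 3
      then show ?thesis using before_irrefl[of \<phi>] d by (auto simp: n1_eq)
    next
      case 4
      then show ?thesis using split(2) before_irrefl[of \<phi>] d by (auto simp: n1_eq)
    qed
  qed
  have n1_r: "n1 i j = arc_mat \<mu> i j" if "i \<noteq> x" for i j
    using r[OF that] col by (simp add: n1_eq arc_mat_def)
  \<comment> \<open>The pivot is scaled to one by dividing row \<open>x\<close> by
    \<open>n x m\<close>. The condition on the diagonals then forces column \<open>x\<close> to be
    multiplied by \<open>n x m\<close>, which has no effect because that column is zero.\<close>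
  define t where "t = (\<lambda>i. if i = x then n x m else 1)"
  define a where "a = diag_mat ?K (\<lambda>i. 1 / t i)"
  define b' where "b' = mmult ?K b (diag_mat ?K t)"
  have t0: "t i \<noteq> 0" for i using split(2) by (simp add: t_def)
  have a: "a \<in> upper_inv (x # \<phi>)" unfolding a_def by (rule diag_mat_upper_inv) (simp add: t0)
  have t: "diag_mat ?K t \<in> upper_inv (x # \<phi>)" by (rule diag_mat_upper_inv) (simp add: t0)
  have b': "b' \<in> upper_inv (x # \<phi>)" unfolding b'_def by (rule mmult_upper_inv[OF d b t])
  have diag: "a i i * b' i i = 1" if "i \<in> ?K" for i
  proof -
    have "b' i i = b i i * diag_mat ?K t i i"
      unfolding b'_def using b t by (intro mmult_diag[OF d]) (auto simp: upper_inv_def)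
    then show ?thesis using row_mat_diag[OF d that] that t0 by (simp add: a_def b_def diag_mat_def)
  qed
  have n1c: "n1 \<in> carrier (matrices ?K)"
    unfolding n1_def using b by (intro mmult_carrier[OF nc] upper_carrier) (simp add: upper_inv_def)
  have "mmult ?K (mmult ?K a n) b' = mmult ?K a (mmult ?K n1 (diag_mat ?K t))"
    by (simp add: b'_def n1_def mmult_assoc)
  also have "\<dots> = (\<lambda>i j. 1 / t i * (n1 i j * t j))"
  proof -
    have c: "mmult ?K n1 (diag_mat ?K t) \<in> carrier (matrices ?K)"
      using t by (intro mmult_carrier[OF n1c] upper_carrier) (simp add: upper_inv_def)
    show ?thesis
      unfolding a_def mmult_diag_mat_left[OF List.finite_set c]
      unfolding mmult_diag_mat_right[OF List.finite_set n1c] ..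
  qed
  also have "\<dots> = arc_mat \<nu>"
  proof (intro ext)
    fix i j
    show "1 / t i * (n1 i j * t j) = arc_mat \<nu> i j"
    proof (cases "i = x")
      case True
      then show ?thesis using split(2) m row by (auto simp: n1_x t_def arc_mat_def \<nu>_def)
    next
      case False
      have "(i, x) \<notin> \<mu>" using set_partitions_before[OF \<mu>, of i x] before_in_set m by fastforce
      then show ?thesis using False by (auto simp: n1_r t_def arc_mat_def \<nu>_def)
    qed
  qed
  finally have "sc_equiv (x # \<phi>) n (arc_mat \<nu>)" using sc_equivI[OF a b' diag, of n] by simp
  then show ?thesis using \<nu> by blast
qed

text \<open>Gaussian elimination from the last row upwards: the block without the first letter is
  reduced by induction, then row \<open>x\<close> is cleared at the old pivots and finally given its
  own pivot, if any entry is left.\<close>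

lemma sc_equiv_arc_mat_exists:
  "distinct \<phi> \<Longrightarrow> n \<in> strict_upper \<phi> \<Longrightarrow> \<exists>\<mu>\<in>set_partitions \<phi>. sc_equiv \<phi> n (arc_mat \<mu>)"
proof (induction \<phi> arbitrary: n)
  case Nil
  then have n: "n = arc_mat {}" by (auto simp: strict_upper_def arc_mat_def fun_eq_iff)
  have "sc_equiv [] n n" by (rule sc_equiv_refl[OF strict_upper_carrier[OF Nil.prems(2)]])
  moreover have "{} \<in> set_partitions []" by (simp add: set_partitions_def)
  ultimately show ?case using n by auto
next
  case (Cons x \<phi>)
  let ?J = "set \<phi>"
  have d: "distinct (x # \<phi>)" and x: "x \<notin> ?J" "distinct \<phi>" using Cons.prems by auto
  have "restr_mat ?J n \<in> strict_upper \<phi>"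
    using Cons.prems by (auto simp: restr_mat_def strict_upper_def)
  then obtain \<mu> where \<mu>: "\<mu> \<in> set_partitions \<phi>" "sc_equiv \<phi> (restr_mat ?J n) (arc_mat \<mu>)"
    using Cons.IH x by blast
  obtain a b where ab: "a \<in> upper_inv \<phi>" "b \<in> upper_inv \<phi>" "\<forall>i\<in>?J. a i i * b i i = 1"
    "arc_mat \<mu> = mmult ?J (mmult ?J a (restr_mat ?J n)) b" using \<mu>(2) unfolding sc_equiv_def by blast
  \<comment> \<open>Padding with a one at \<open>x\<close> lifts the operations found for the
    smaller block to the whole word.\<close>
  define e where "e = (\<lambda>c :: ('a, 'b) mat. c + mone {x})"
  have e: "e c \<in> upper_inv (x # \<phi>)" "restr_mat ?J (e c) = c" if "c \<in> upper_inv \<phi>" for c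
  proof -
    have "c \<in> carrier (matrices ?J)" using that by (intro upper_carrier) (simp add: upper_inv_def)
    then have z: "c i j = 0" if "i \<notin> ?J \<or> j \<notin> ?J" for i j
      using that unfolding carrier_matrices by blast
    have "restr_mat ?J (e c) i j = c i j" for i j
      using z[of i j] x by (auto simp: e_def restr_mat_def mone_def)
    then show "restr_mat ?J (e c) = c" by (intro ext)
    have "i \<in> ?J \<and> (i = j \<or> before \<phi> i j) \<or> i = x \<and> j = x" if "e c i j \<noteq> 0" for i j
      using that \<open>c \<in> upper_inv \<phi>\<close> by (auto simp: e_def mone_def upper_inv_def upper_def split: if_splits)
    moreover have "e c i i \<noteq> 0" if "i \<in> set (x # \<phi>)" for i
      using that \<open>c \<in> upper_inv \<phi>\<close> z[of x x] x by (auto simp: e_def mone_def upper_inv_def)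
    ultimately show "e c \<in> upper_inv (x # \<phi>)" unfolding upper_inv_def upper_def by auto
  qed
  define n1 where "n1 = mmult (set (x # \<phi>)) (mmult (set (x # \<phi>)) (e a) n) (e b)"
  have "e a i i * e b i i = 1" if i: "i \<in> set (x # \<phi>)" for i
  proof (cases "i = x")
    case True
    have "a x x = 0" "b x x = 0" using ab(1,2) x by (auto simp: upper_inv_def upper_def)
    then show ?thesis using True by (simp add: e_def mone_def)
  qed (use i ab(3) in \<open>auto simp: e_def mone_def\<close>)
  then have n1: "sc_equiv (x # \<phi>) n n1" unfolding n1_def by (intro sc_equivI e ab)
  have n1u: "n1 \<in> strict_upper (x # \<phi>)" by (rule sc_equiv_strict_upper[OF d Cons.prems(2) n1])
  have conv: "k \<in> ?J" if "i \<in> ?J" "j \<in> ?J" "before (x # \<phi>) i k" "before (x # \<phi>) k j" for i j k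
    using that x by (auto dest: before_in_set)
  have up: "e a \<in> upper (x # \<phi>)" "e b \<in> upper (x # \<phi>)" "n \<in> upper (x # \<phi>)"
    using e ab Cons.prems(2) by (auto simp: upper_inv_def strict_upper_upper)
  have K: "set (x # \<phi>) \<inter> ?J = ?J" by auto
  have "restr_mat ?J (mmult (set (x # \<phi>)) (e a) n) =
      mmult (set (x # \<phi>) \<inter> ?J) (restr_mat ?J (e a)) (restr_mat ?J n)"
    by (rule restr_mat_mmult[OF d up(1,3)]) (rule conv)
  moreover have "restr_mat ?J n1 =
      mmult (set (x # \<phi>) \<inter> ?J) (restr_mat ?J (mmult (set (x # \<phi>)) (e a) n)) (restr_mat ?J (e b))"
    unfolding n1_def by (rule restr_mat_mmult[OF d mmult_upper[OF d up(1,3)] up(2)]) (rule conv)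
  ultimately have r1: "restr_mat ?J n1 = arc_mat \<mu>"
    unfolding K e(2)[OF ab(1)] e(2)[OF ab(2)] using ab(4) by simp
  \<comment> \<open>Column \<open>x\<close> of a strictly upper triangular matrix is zero since
    \<open>x\<close> comes first, so the rows other than \<open>x\<close> are determined by the
    block.\<close>
  have r: "n1 i j = arc_mat \<mu> i j" if "i \<noteq> x" for i j
  proof (cases "i \<in> ?J \<and> j \<in> ?J")
    case True
    then show ?thesis using fun_cong[OF fun_cong[OF r1], of i j] by (simp add: restr_mat_def)
  next
    case False
    then have "n1 i j = 0" using n1u that x unfolding strict_upper_def by (auto dest: before_in_set)
    moreover have "(i, j) \<notin> \<mu>" using set_partitions_before[OF \<mu>(1)] False before_in_set by fastforce
    ultimately show ?thesis by (simp add: arc_mat_def)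
  qed
  obtain n2 where n2: "n2 \<in> strict_upper (x # \<phi>)" "sc_equiv (x # \<phi>) n1 n2"
    "\<And>i j. i \<noteq> x \<Longrightarrow> n2 i j = arc_mat \<mu> i j" "\<And>i j. (i, j) \<in> \<mu> \<Longrightarrow> n2 x j = 0"
    using sc_equiv_clear_columns[OF d \<mu>(1) n1u r] by blast
  obtain \<nu> where "\<nu> \<in> set_partitions (x # \<phi>)" "sc_equiv (x # \<phi>) n2 (arc_mat \<nu>)"
    using sc_equiv_clear_row[OF d \<mu>(1) n2(1)] n2(3,4) by blast
  then show ?case using sc_equiv_trans[OF d sc_equiv_trans[OF d n1 n2(2)]] by blast
qed

section \<open>The superclass label of a unitriangular matrix\<close>

definition sc_type :: "'a list \<Rightarrow> ('a, 'f::field) mat \<Rightarrow> 'a arcs" where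
  "sc_type \<phi> u = (THE \<mu>. \<mu> \<in> set_partitions \<phi> \<and> sc_equiv \<phi> (u - mone (set \<phi>)) (arc_mat \<mu>))"

lemma sc_type:
  assumes "distinct \<phi>" "u \<in> unitriangular \<phi>"
  shows "sc_type \<phi> u \<in> set_partitions \<phi>" (is ?A)
    and "sc_equiv \<phi> (u - mone (set \<phi>)) (arc_mat (sc_type \<phi> u))" (is ?B)
proof -
  let ?n = "u - mone (set \<phi>)"
  have n: "?n \<in> strict_upper \<phi>" using assms unitriangular_minus_one by blast
  have "\<exists>!\<mu>. \<mu> \<in> set_partitions \<phi> \<and> sc_equiv \<phi> ?n (arc_mat \<mu>)"
    using sc_equiv_arc_mat_exists[OF assms(1) n] sc_equiv_arc_mat_unique[OF assms(1)]
      sc_equiv_sym[OF assms(1) strict_upper_carrier[OF n]] sc_equiv_trans[OF assms(1)]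
    by metis
  then have "?A \<and> ?B" unfolding sc_type_def by (rule theI')
  then show ?A ?B by auto
qed

lemma sc_type_eqI:
  assumes "distinct \<phi>" "u \<in> unitriangular \<phi>" "\<mu> \<in> set_partitions \<phi>" "sc_equiv \<phi> (u - mone (set \<phi>)) (arc_mat \<mu>)"
  shows "sc_type \<phi> u = \<mu>"
  using assms sc_type[OF assms(1,2)] sc_equiv_arc_mat_unique[OF assms(1)]
      sc_equiv_sym[OF assms(1) strict_upper_carrier] sc_equiv_trans[OF assms(1)] unitriangular_minus_one
  by metis

lemma superclass_rep_minus_one:
  "\<mu> \<in> set_partitions \<phi> \<Longrightarrow> superclass_rep \<phi> \<mu> - mone (set \<phi>) = arc_mat \<mu>"
  by (simp add: superclass_rep_eq finite_set_partition)

lemma superclass_rep_unitriangular: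
  assumes "distinct \<phi>" "\<mu> \<in> set_partitions \<phi>"
  shows "superclass_rep \<phi> \<mu> \<in> unitriangular \<phi>" and "sc_type \<phi> (superclass_rep \<phi> \<mu>) = \<mu>"
proof -
  note m = superclass_rep_minus_one[OF assms(2)]
  then show u: "superclass_rep \<phi> \<mu> \<in> unitriangular \<phi>"
    using arc_mat_strict_upper[OF assms(2)] unfolding unitriangular_minus_one[OF assms(1)] by (simp add: m)
  show "sc_type \<phi> (superclass_rep \<phi> \<mu>) = \<mu>"
    by (rule sc_type_eqI[OF assms(1) u assms(2)])
      (simp add: m sc_equiv_refl strict_upper_carrier arc_mat_strict_upper assms(2))
qed

text \<open>Superclasses are the fibres of \<open>sc_type\<close>, so their indicators can now be
  evaluated without further matrix arithmetic.\<close>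

lemma kappa_eq:
  assumes "distinct \<phi>" "\<mu> \<in> set_partitions \<phi>"
  shows "kappa \<phi> \<mu> (\<tau>, v) = (if \<tau> = \<phi> \<and> v \<in> unitriangular \<phi> \<and> sc_type \<phi> v = \<mu> then 1 else 0)"
proof -
  have "superclass_rel \<phi> (superclass_rep \<phi> \<mu>) v \<longleftrightarrow> sc_type \<phi> v = \<mu>" if v: "v \<in> unitriangular \<phi>"
  proof -
    have n: "v - mone (set \<phi>) \<in> strict_upper \<phi>" using v assms(1) unitriangular_minus_one by blast
    have "superclass_rel \<phi> (superclass_rep \<phi> \<mu>) v \<longleftrightarrow> sc_equiv \<phi> (arc_mat \<mu>) (v - mone (set \<phi>))"
      by (simp add: superclass_rel_iff[OF assms(1)] superclass_rep_minus_one[OF assms(2)])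
    also have "\<dots> \<longleftrightarrow> sc_equiv \<phi> (v - mone (set \<phi>)) (arc_mat \<mu>)"
      using sc_equiv_sym[OF assms(1)] strict_upper_carrier[OF n]
        strict_upper_carrier[OF arc_mat_strict_upper[OF assms(2)]] by blast
    also have "\<dots> \<longleftrightarrow> sc_type \<phi> v = \<mu>"
      using sc_type[OF assms(1) v] sc_type_eqI[OF assms(1) v assms(2)] by blast
    finally show ?thesis .
  qed
  then show ?thesis by (auto simp: kappa_def)
qed

lemma restr_mat_unitriangular:
  assumes "distinct \<rho>" "w \<in> unitriangular \<rho>"
  shows "restr_mat J w \<in> unitriangular (restr_order J \<rho>)"
  using assms by (auto simp: unitriangular_iff upper_def restr_mat_def)

text \<open>This is the form needed for inflation: in a concatenated word both factors are
  order-convex, and the label of a diagonal block is the restricted label.\<close>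

lemma sc_type_restr_mat:
  assumes d: "distinct \<rho>" and w: "w \<in> unitriangular \<rho>"
    and conv: "\<And>i j k. i \<in> J \<Longrightarrow> j \<in> J \<Longrightarrow> before \<rho> i k \<Longrightarrow> before \<rho> k j \<Longrightarrow> k \<in> J"
  shows "sc_type (restr_order J \<rho>) (restr_mat J w) = restr_arcs J (sc_type \<rho> w)"
proof (rule sc_type_eqI)
  show "restr_mat J w \<in> unitriangular (restr_order J \<rho>)" by (rule restr_mat_unitriangular[OF d w])
  show "restr_arcs J (sc_type \<rho> w) \<in> set_partitions (restr_order J \<rho>)"
    by (rule restr_arcs_set_partitions[OF sc_type(1)[OF d w]])
  have "restr_mat J w - mone (set (restr_order J \<rho>)) = restr_mat J (w - mone (set \<rho>))"
    by (auto simp: restr_mat_def mone_def fun_eq_iff)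
  moreover have "sc_equiv (restr_order J \<rho>) (restr_mat J (w - mone (set \<rho>))) (restr_mat J (arc_mat (sc_type \<rho> w)))"
  proof (rule sc_equiv_restr[OF d _ sc_type(2)[OF d w]])
    show "w - mone (set \<rho>) \<in> strict_upper \<rho>" using w unitriangular_minus_one[OF d] by blast
  qed (rule conv)
  ultimately show "sc_equiv (restr_order J \<rho>) (restr_mat J w - mone (set (restr_order J \<rho>)))
      (arc_mat (restr_arcs J (sc_type \<rho> w)))"
    by (simp add: restr_mat_arc_mat)
qed (simp add: d)

lemma block_sum_unitriangular:
  assumes d: "distinct \<rho>" and IJ: "I \<inter> J = {}" "set \<rho> = I \<union> J"
    and uv: "u \<in> unitriangular (restr_order I \<rho>)" "v \<in> unitriangular (restr_order J \<rho>)"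
  shows "u + v \<in> unitriangular \<rho>" and "sc_type \<rho> (u + v) = sc_type (restr_order I \<rho>) u \<union> sc_type (restr_order J \<rho>) v"
proof -
  have dd: "distinct (restr_order I \<rho>)" "distinct (restr_order J \<rho>)" using d by auto
  have K: "set \<rho> \<inter> I = I" "set \<rho> \<inter> J = J" using IJ by auto
  let ?n = "u - mone (set (restr_order I \<rho>))" and ?m = "v - mone (set (restr_order J \<rho>))"
  have nm: "?n \<in> strict_upper (restr_order I \<rho>)" "?m \<in> strict_upper (restr_order J \<rho>)"
    using uv unitriangular_minus_one dd by blast+
  have "mone (set \<rho>) = (mone I + mone J :: ('a, 'b) mat)"
    using IJ by (auto simp: mone_def fun_eq_iff)
  then have s: "u + v - mone (set \<rho>) = ?n + ?m" by (simp add: K)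
  have "?n + ?m \<in> strict_upper \<rho>"
    unfolding strict_upper_def
  proof clarify
    fix i j assume "(?n + ?m) i j \<noteq> 0"
    then have "?n i j \<noteq> 0 \<or> ?m i j \<noteq> 0" by (cases "?n i j = 0") simp_all
    then show "before \<rho> i j" using nm unfolding strict_upper_def by fastforce
  qed
  then have "u + v - mone (set \<rho>) \<in> strict_upper \<rho>" unfolding s .
  then show uv': "u + v \<in> unitriangular \<rho>" using unitriangular_minus_one[OF d] by blast
  show "sc_type \<rho> (u + v) = sc_type (restr_order I \<rho>) u \<union> sc_type (restr_order J \<rho>) v"
  proof (rule sc_type_eqI[OF d uv'])
    let ?\<mu> = "sc_type (restr_order I \<rho>) u" and ?\<nu> = "sc_type (restr_order J \<rho>) v"
    show "?\<mu> \<union> ?\<nu> \<in> set_partitions \<rho>"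
      using sc_type(1)[OF dd(1) uv(1)] sc_type(1)[OF dd(2) uv(2)] IJ(1) by (rule Un_set_partitions)
    \<comment> \<open>Disjointness makes the 0-1 matrix of the union the sum of the two 0-1
      matrices.\<close>
    have "?\<mu> \<inter> ?\<nu> = {}"
      using set_partitions_subset[OF sc_type(1)[OF dd(1) uv(1)]]
        set_partitions_subset[OF sc_type(1)[OF dd(2) uv(2)]] IJ(1) by auto
    then have "arc_mat (?\<mu> \<union> ?\<nu>) = (arc_mat ?\<mu> + arc_mat ?\<nu> :: ('a, 'b) mat)"
      by (auto simp: arc_mat_def fun_eq_iff)
    then show "sc_equiv \<rho> (u + v - mone (set \<rho>)) (arc_mat (?\<mu> \<union> ?\<nu>))"
      unfolding s using sc_equiv_block_sum[OF IJ nm sc_type(2)[OF dd(1) uv(1)] sc_type(2)[OF dd(2) uv(2)]] by simp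
  qed
qed

section \<open>Triangular families and power sums\<close>

text \<open>Triangularity puts each family into the span of the other. Injectivity and independence
  then follow by counting: a spanning family with no more members than an independent one can
  neither repeat a vector nor be dependent. It is applied to power sums over superclass indicators
  and to monomials over power sums.\<close>

lemma (in vector_space) triangular_basis:
  fixes r :: "'i \<Rightarrow> nat"
  assumes fin: "finite S" and inj: "inj_on b S" and ind: "independent (b ` S)"
    and tri: "\<And>s. s \<in> S \<Longrightarrow> m s - b s \<in> span (b ` {t \<in> S. r s < r t})"
  shows "inj_on m S" and "independent (m ` S)" and "span (m ` S) = span (b ` S)"
proof -
  have "m s \<in> span (b ` S)" if "s \<in> S" for s
  proof -
    have "m s - b s \<in> span (b ` S)" using tri[OF that] span_mono[of "b ` {t \<in> S. r s < r t}" "b ` S"] by blast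
    then show ?thesis using span_add[OF _ span_base[of "b s" "b ` S"]] that by fastforce
  qed
  then have 1: "m ` S \<subseteq> span (b ` S)" by auto
  have "b s \<in> span (m ` S)" if "s \<in> S" for s
    using that
  \<comment> \<open>Elements of highest rank come first: for them the error term is zero. In general
    it involves only vectors of larger rank, which are already in the span.\<close>
  proof (induction "card {t \<in> S. r s < r t}" arbitrary: s rule: less_induct)
    case less
    have "b t \<in> span (m ` S)" if t: "t \<in> S" "r s < r t" for t
    proof (rule less.hyps[OF _ t(1)])
      have "{u \<in> S. r t < r u} \<subset> {u \<in> S. r s < r u}" using t by fastforce
      then show "card {u \<in> S. r t < r u} < card {u \<in> S. r s < r u}" using fin by (intro psubset_card_mono) auto
    qed
    then have "span (b ` {t \<in> S. r s < r t}) \<subseteq> span (m ` S)" by (intro span_minimal) auto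
    then have "m s - b s \<in> span (m ` S)" using tri[OF less.prems] by blast
    moreover have "m s \<in> span (m ` S)" using less.prems by (intro span_base) auto
    ultimately have "m s - (m s - b s) \<in> span (m ` S)" by (rule span_diff[rotated])
    then show ?case by simp
  qed
  then have 2: "b ` S \<subseteq> span (m ` S)" by auto
  show "span (m ` S) = span (b ` S)" by (simp add: 1 2 span_minimal subset_antisym)
  have "card S \<le> card (m ` S)"
    using independent_span_bound[OF _ ind 2] fin card_image[OF inj] by simp
  then have c: "card (m ` S) = card S" using card_image_le[OF fin, of m] by simp
  then show "inj_on m S" using eq_card_imp_inj_on[OF fin] by blast
  show "independent (m ` S)"
  proof
    assume "dependent (m ` S)"
    then obtain x where x: "x \<in> m ` S" "x \<in> span (m ` S - {x})" unfolding dependent_def by blast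
    then have "span (m ` S - {x}) = span (m ` S)"
      by (metis insert_Diff span_redundant)
    then have "card (b ` S) \<le> card (m ` S - {x})"
      using independent_span_bound[OF _ ind, of "m ` S - {x}"] 2 fin by simp
    then show False using x fin c card_image[OF inj] card_Diff1_less[OF _ x(1)] by simp
  qed
qed

section \<open>Superclass indicators and power sums as bases\<close>

lemma sum_fun_apply: "(\<Sum>i\<in>S. f i) x = (\<Sum>i\<in>S. f i x)"
  for f :: "'i \<Rightarrow> 'b \<Rightarrow> 'c::comm_monoid_add"
  by (induction S rule: infinite_finite_induct) auto

lemma cfun_independentI:
  assumes "\<And>x. x \<in> B \<Longrightarrow> \<exists>p. x p \<noteq> 0 \<and> (\<forall>y\<in>B - {x}. y p = 0)"
  shows "cfun.independent B"
proof
  assume "cfun.dependent B"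
  then obtain x where x: "x \<in> B" "x \<in> cfun.span (B - {x})" unfolding cfun.dependent_def by blast
  obtain p where p: "x p \<noteq> 0" "\<forall>y\<in>B - {x}. y p = 0" using assms[OF x(1)] by blast
  have "cfun.span (B - {x}) \<subseteq> {f. f p = 0}"
    using p(2) by (intro cfun.span_minimal cfun.subspaceI) (auto simp: cscale_def)
  then show False using x p by blast
qed

definition scf_index :: "'a set \<Rightarrow> ('a list \<times> 'a arcs) set" where
  "scf_index K = Sigma (lin_orders K) set_partitions"

lemma scf_index_iff: "(\<phi>, \<mu>) \<in> scf_index K \<longleftrightarrow> distinct \<phi> \<and> set \<phi> = K \<and> \<mu> \<in> set_partitions \<phi>"
  by (auto simp: scf_index_def lin_orders_iff)

lemma finite_scf_index: "finite (scf_index K)"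
proof (cases "finite K")
  case True
  then show ?thesis unfolding scf_index_def by (intro finite_SigmaI) auto
next
  case False
  then have "scf_index K = {}" by (auto simp: scf_index_def lin_orders_iff)
  then show ?thesis by simp
qed

text \<open>Evaluation at the superclass representatives is a dual family.\<close>

lemma kappa_basis:
  fixes K :: "'a set"
  defines "b \<equiv> (\<lambda>(\<phi>, \<mu>). kappa \<phi> \<mu> :: ('a, 'f::field) sfun)"
  shows "inj_on b (scf_index K)" and "cfun.independent (b ` scf_index K)"
    and "cfun.span (b ` scf_index K) = scf K"
proof -
  have delta: "b i (fst j, superclass_rep (fst j) (snd j)) = (if i = j then 1 else 0)"
    if "i \<in> scf_index K" "j \<in> scf_index K" for i j
  proof -
    obtain \<phi> \<mu> \<tau> \<nu> where ij: "i = (\<phi>, \<mu>)" "j = (\<tau>, \<nu>)" by (cases i; cases j)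
    have *: "distinct \<phi>" "\<mu> \<in> set_partitions \<phi>" "distinct \<tau>" "\<nu> \<in> set_partitions \<tau>"
      using that ij by (auto simp: scf_index_iff)
    show ?thesis
      using superclass_rep_unitriangular[OF *(3,4)]
      unfolding ij b_def prod.case kappa_eq[OF *(1,2)] fst_conv snd_conv by auto
  qed
  show "inj_on b (scf_index K)"
  proof (rule inj_onI)
    fix i j assume ij: "i \<in> scf_index K" "j \<in> scf_index K" "b i = b j"
    then show "i = j" using delta[OF ij(1,2)] delta[OF ij(2,2)] by (metis zero_neq_one)
  qed
  show "cfun.independent (b ` scf_index K)"
  proof (rule cfun_independentI)
    fix x assume "x \<in> b ` scf_index K"
    then obtain j where j: "j \<in> scf_index K" "x = b j" by blast
    have y: "y (fst j, superclass_rep (fst j) (snd j)) = 0" if y: "y \<in> b ` scf_index K - {x}" for y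
    proof -
      obtain i where i: "i \<in> scf_index K" "y = b i" "i \<noteq> j" using y j(2) by blast
      then show ?thesis using delta[OF i(1) j(1)] by simp
    qed
    show "\<exists>p. x p \<noteq> 0 \<and> (\<forall>y\<in>b ` scf_index K - {x}. y p = 0)"
      by (rule exI[of _ "(fst j, superclass_rep (fst j) (snd j))"])
        (simp add: y, simp add: delta[OF j(1) j(1)] j(2))
  qed
  have "b ` scf_index K = {kappa \<phi> \<mu> |\<phi> \<mu>. \<phi> \<in> lin_orders K \<and> \<mu> \<in> set_partitions \<phi>}"
    by (auto simp: b_def scf_index_def)
  then show "cfun.span (b ` scf_index K) = scf K" by (simp add: scf_def)
qed

lemma power_sum_basis:
  fixes R :: "'a list \<Rightarrow> 'a arcs rel" and K :: "'a set"
  assumes R: "power_sum_friendly R"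
  defines "P \<equiv> (\<lambda>(\<phi>, \<mu>). power_sum R \<phi> \<mu> :: ('a, 'f::field) sfun)"
  shows "inj_on P (scf_index K)" and "cfun.independent (P ` scf_index K)"
    and "cfun.span (P ` scf_index K) = scf K"
proof -
  define b where "b = (\<lambda>(\<phi>, \<mu>). kappa \<phi> \<mu> :: ('a, 'f) sfun)"
  \<comment> \<open>The size of the down-set is strictly increasing along the partial order, so it
    serves as a rank.\<close>
  define r where "r = (\<lambda>(\<phi>, \<mu>). card {\<nu> \<in> set_partitions \<phi>. (\<nu>, \<mu>) \<in> R \<phi>})"
  have tri: "P s - b s \<in> cfun.span (b ` {t \<in> scf_index K. r s < r t})" if s: "s \<in> scf_index K" for s
  proof -
    obtain \<phi> \<kappa> where s': "s = (\<phi>, \<kappa>)" by (cases s)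
    have \<phi>: "distinct \<phi>" "set \<phi> = K" "\<kappa> \<in> set_partitions \<phi>" using s s' by (auto simp: scf_index_iff)
    have po: "partial_order_on (set_partitions \<phi>) (R \<phi>)" using R \<phi>(1) by (simp add: power_sum_friendly_def)
    then have refl: "(\<mu>, \<mu>) \<in> R \<phi>" if "\<mu> \<in> set_partitions \<phi>" for \<mu>
      using that unfolding partial_order_on_def preorder_on_def refl_on_def by blast
    have trans: "trans (R \<phi>)" and antisym: "antisym (R \<phi>)"
      using po unfolding partial_order_on_def preorder_on_def by auto
    let ?U = "{\<mu>. \<mu> \<in> set_partitions \<phi> \<and> (\<kappa>, \<mu>) \<in> R \<phi>}"
    have "P s = b s + (\<Sum>\<mu>\<in>?U - {\<kappa>}. kappa \<phi> \<mu>)"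
      unfolding P_def b_def s' power_sum_def prod.case using \<phi>(3) refl by (intro sum.remove) auto
    then have "P s - b s = (\<Sum>\<mu>\<in>?U - {\<kappa>}. b (\<phi>, \<mu>))" by (simp add: b_def)
    moreover have "b (\<phi>, \<mu>) \<in> cfun.span (b ` {t \<in> scf_index K. r s < r t})" if \<mu>: "\<mu> \<in> ?U - {\<kappa>}" for \<mu>
    proof -
      have sub: "{\<nu> \<in> set_partitions \<phi>. (\<nu>, \<kappa>) \<in> R \<phi>} \<subseteq> {\<nu> \<in> set_partitions \<phi>. (\<nu>, \<mu>) \<in> R \<phi>}"
        using \<mu> transD[OF trans, of _ \<kappa> \<mu>] by blast
      have "\<mu> \<in> {\<nu> \<in> set_partitions \<phi>. (\<nu>, \<mu>) \<in> R \<phi>}" "\<mu> \<notin> {\<nu> \<in> set_partitions \<phi>. (\<nu>, \<kappa>) \<in> R \<phi>}"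
        using \<mu> refl[of \<mu>] antisymD[OF antisym, of \<kappa> \<mu>] by auto
      then have "{\<nu> \<in> set_partitions \<phi>. (\<nu>, \<kappa>) \<in> R \<phi>} \<subset> {\<nu> \<in> set_partitions \<phi>. (\<nu>, \<mu>) \<in> R \<phi>}" using sub by blast
      then have "r s < r (\<phi>, \<mu>)" unfolding r_def s' prod.case by (intro psubset_card_mono) simp_all
      moreover have "(\<phi>, \<mu>) \<in> scf_index K" using \<mu> \<phi> by (simp add: scf_index_iff)
      ultimately show ?thesis by (intro cfun.span_base imageI) simp
    qed
    ultimately show ?thesis by (simp only: cfun.span_sum)
  qed
  note b = kappa_basis[where ?'f = 'f, of K, folded b_def]
  note triangular = cfun.triangular_basis[OF finite_scf_index b(1,2), of P r]
  show "inj_on P (scf_index K)" by (rule triangular(1)) (rule tri)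
  show "cfun.independent (P ` scf_index K)" by (rule triangular(2)) (rule tri)
  show "cfun.span (P ` scf_index K) = scf K" unfolding b(3)[symmetric] by (rule triangular(3)) (rule tri)
qed

lemma power_sum_in_scf:
  "distinct \<phi> \<Longrightarrow> power_sum R \<phi> \<kappa> \<in> scf (set \<phi>)"
  unfolding power_sum_def scf_def
  by (intro cfun.span_sum cfun.span_base) (auto simp: lin_orders_iff)

section \<open>Product and coproduct of power sums\<close>

text \<open>Distinct superclasses are disjoint, so at most one summand survives: the one labelled by
  the type of \<open>v\<close>.\<close>

lemma power_sum_apply:
  assumes "distinct \<phi>"
  shows "power_sum R \<phi> \<kappa> (\<tau>, v) =
    (if \<tau> = \<phi> \<and> v \<in> unitriangular \<phi> \<and> (\<kappa>, sc_type \<phi> v) \<in> R \<phi> then 1 else 0)"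
proof (cases "\<tau> = \<phi> \<and> v \<in> unitriangular \<phi>")
  case True
  let ?U = "{\<mu>. \<mu> \<in> set_partitions \<phi> \<and> (\<kappa>, \<mu>) \<in> R \<phi>}"
  have "power_sum R \<phi> \<kappa> (\<tau>, v) = (\<Sum>\<mu>\<in>?U. if \<mu> = sc_type \<phi> v then 1 else 0)"
    unfolding power_sum_def sum_fun_apply by (intro sum.cong) (use True assms in \<open>auto simp: kappa_eq\<close>)
  then show ?thesis using True sc_type(1)[OF assms, of v] by simp
next
  case False
  then have "power_sum R \<phi> \<kappa> (\<tau>, v) = 0"
    unfolding power_sum_def sum_fun_apply by (intro sum.neutral) (auto simp: kappa_eq assms)
  then show ?thesis using False by auto
qed

lemma power_sum_friendly_Un:
  assumes R: "power_sum_friendly R" and \<rho>: "distinct \<rho>" "set \<rho> = I \<union> J" "I \<inter> J = {}"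
    and \<kappa>: "\<kappa> \<in> set_partitions (restr_order I \<rho>)" and \<nu>: "\<nu> \<in> set_partitions (restr_order J \<rho>)"
    and \<mu>: "\<mu> \<in> set_partitions \<rho>"
  shows "(\<kappa> \<union> \<nu>, \<mu>) \<in> R \<rho> \<longleftrightarrow>
    (\<kappa>, restr_arcs I \<mu>) \<in> R (restr_order I \<rho>) \<and> (\<nu>, restr_arcs J \<mu>) \<in> R (restr_order J \<rho>)"
proof -
  have "finite I" "finite J" using \<rho>(2) by (metis finite_Un List.finite_set)+
  moreover have "restr_order I \<rho> \<in> lin_orders I" "restr_order J \<rho> \<in> lin_orders J" "\<rho> \<in> lin_orders (I \<union> J)"
    using \<rho> by (auto simp: lin_orders_iff)
  ultimately show ?thesis
    using R[unfolded power_sum_friendly_def, THEN conjunct2, THEN conjunct1, rule_format,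
        of I J "restr_order I \<rho>" "restr_order J \<rho>" \<rho> \<kappa> \<nu> \<mu>] \<rho>(3) \<kappa> \<nu> \<mu> by simp
qed

text \<open>Move \<open>J\<close> in front of \<open>I\<close>. The arc from \<open>I\<close> to
  \<open>J\<close> now points backwards, so \<kappa> is not a set partition for the new word, and by
  the condition comparing two orders neither is anything above \<kappa>. But a \<mu> that splits
  along \<open>I\<close> and \<open>J\<close> would remain one.\<close>

lemma power_sum_friendly_no_arc:
  assumes R: "power_sum_friendly R" and \<rho>: "distinct \<rho>" "set \<rho> = I \<union> J" "I \<inter> J = {}"
    and \<kappa>: "\<kappa> \<in> set_partitions \<rho>" and ij: "(i, j) \<in> \<kappa>" "i \<in> I" "j \<in> J"
    and \<mu>: "\<mu> \<in> set_partitions \<rho>" "(\<kappa>, \<mu>) \<in> R \<rho>"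
  shows "\<mu> \<noteq> restr_arcs I \<mu> \<union> restr_arcs J \<mu>"
proof
  let ?\<tau> = "restr_order J \<rho> @ restr_order I \<rho>"
  assume s: "\<mu> = restr_arcs I \<mu> \<union> restr_arcs J \<mu>"
  have "restr_arcs J \<mu> \<union> restr_arcs I \<mu> \<in> set_partitions ?\<tau>"
    using \<rho>(3) \<mu>(1) by (intro set_partitions_append restr_arcs_set_partitions) auto
  then have "\<mu> \<in> set_partitions ?\<tau>" using s by (simp add: Un_commute)
  moreover have "\<not> before ?\<tau> i j" using ij \<rho>(3) by auto
  then have "\<kappa> \<notin> set_partitions ?\<tau>" using ij(1) set_partitions_before[of \<kappa> ?\<tau> i j] by blast
  moreover have "?\<tau> \<in> lin_orders (I \<union> J)" "\<rho> \<in> lin_orders (I \<union> J)" "finite (I \<union> J)"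
    using \<rho> by (auto simp: lin_orders_iff) (metis finite_Un List.finite_set)+
  ultimately show False
    using R[unfolded power_sum_friendly_def, THEN conjunct2, THEN conjunct2, rule_format,
        of "I \<union> J" \<rho> ?\<tau> \<kappa> \<mu>] \<kappa> \<mu>(2) by blast
qed

lemma power_sum_friendly_split:
  assumes R: "power_sum_friendly R" and \<rho>: "distinct \<rho>" "set \<rho> = I \<union> J" "I \<inter> J = {}"
    and \<kappa>: "\<kappa> \<in> set_partitions \<rho>" "\<kappa> \<noteq> restr_arcs I \<kappa> \<union> restr_arcs J \<kappa>"
    and \<mu>: "\<mu> \<in> set_partitions \<rho>" "(\<kappa>, \<mu>) \<in> R \<rho>"
  shows "\<mu> \<noteq> restr_arcs I \<mu> \<union> restr_arcs J \<mu>"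
proof -
  obtain i j where ij: "(i, j) \<in> \<kappa>" "\<not> (i \<in> I \<and> j \<in> I)" "\<not> (i \<in> J \<and> j \<in> J)"
    using \<kappa>(2) unfolding restr_arcs_def by fast
  moreover have "i \<in> I \<union> J" "j \<in> I \<union> J" using set_partitions_subset[OF \<kappa>(1)] ij(1) \<rho>(2) by auto
  ultimately consider "i \<in> I" "j \<in> J" | "i \<in> J" "j \<in> I" by blast
  then show ?thesis
  proof cases
    case 1
    then show ?thesis using power_sum_friendly_no_arc[OF R \<rho> \<kappa>(1) ij(1) _ _ \<mu>] by blast
  next
    case 2
    have \<rho>': "set \<rho> = J \<union> I" "J \<inter> I = {}" using \<rho> by auto
    show ?thesis
      using power_sum_friendly_no_arc[OF R \<rho>(1) \<rho>' \<kappa>(1) ij(1) 2 \<mu>] by (simp add: Un_commute)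
  qed
qed

text \<open>Both sides are 0-1 valued. At \<open>w\<close> the claim is the restriction condition of
  friendliness for the type of \<open>w\<close>, whose restrictions are the types of the two
  diagonal blocks.\<close>

lemma power_sum_mult:
  assumes R: "power_sum_friendly R" and d: "distinct (\<phi> @ \<tau>)"
    and \<kappa>: "\<kappa> \<in> set_partitions \<phi>" and \<nu>: "\<nu> \<in> set_partitions \<tau>"
  shows "mult2 (set \<phi>) (set \<tau>) (tensor2 (power_sum R \<phi> \<kappa>) (power_sum R \<tau> \<nu>)) =
    (power_sum R (\<phi> @ \<tau>) (\<kappa> \<union> \<nu>) :: ('a, 'f::field) sfun)"
proof (rule ext, clarify)
  let ?I = "set \<phi>" and ?J = "set \<tau>" and ?\<rho> = "\<phi> @ \<tau>"
  fix \<rho> :: "'a list" and w :: "('a, 'f) mat"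
  have disj: "?I \<inter> ?J = {}" and dd: "distinct \<phi>" "distinct \<tau>" using d by auto
  have r: "restr_order ?I ?\<rho> = \<phi>" "restr_order ?J ?\<rho> = \<tau>"
    using disj by (simp_all add: restr_order_id restr_order_disjoint Int_commute)
  show "mult2 ?I ?J (tensor2 (power_sum R \<phi> \<kappa>) (power_sum R \<tau> \<nu>)) (\<rho>, w) = power_sum R ?\<rho> (\<kappa> \<union> \<nu>) (\<rho>, w)"
  proof (cases "\<rho> = ?\<rho> \<and> w \<in> unitriangular ?\<rho>")
    case False
    then have "power_sum R ?\<rho> (\<kappa> \<union> \<nu>) (\<rho>, w) = 0" unfolding power_sum_apply[OF d] by auto
    moreover have "mult2 ?I ?J (tensor2 (power_sum R \<phi> \<kappa>) (power_sum R \<tau> \<nu>)) (\<rho>, w) = 0"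
    proof (cases "(\<rho>, w) \<in> points (?I \<union> ?J) \<and> \<rho> = restr_order ?I \<rho> @ restr_order ?J \<rho>")
      case True
      then have "restr_order ?I \<rho> \<noteq> \<phi> \<or> restr_order ?J \<rho> \<noteq> \<tau>"
        using False unfolding points_def by (metis mem_Sigma_iff)
      then show ?thesis by (auto simp: mult2_def tensor2_def power_sum_apply dd)
    qed (auto simp: mult2_def)
    ultimately show ?thesis by simp
  next
    case True
    then have w: "w \<in> unitriangular ?\<rho>" by simp
    have u: "restr_mat ?I w \<in> unitriangular \<phi>" "restr_mat ?J w \<in> unitriangular \<tau>"
      using restr_mat_unitriangular[OF d w] r by metis+
    have t1: "sc_type \<phi> (restr_mat ?I w) = restr_arcs ?I (sc_type ?\<rho> w)"
      using sc_type_restr_mat[OF d w, of ?I] r disj by (auto dest: before_in_set)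
    have t2: "sc_type \<tau> (restr_mat ?J w) = restr_arcs ?J (sc_type ?\<rho> w)"
      using sc_type_restr_mat[OF d w, of ?J] r disj by (auto dest: before_in_set)
    have "(\<rho>, w) \<in> points (?I \<union> ?J)" using True d by (auto simp: points_def lin_orders_iff)
    then have "mult2 ?I ?J (tensor2 (power_sum R \<phi> \<kappa>) (power_sum R \<tau> \<nu>)) (\<rho>, w) =
        power_sum R \<phi> \<kappa> (\<phi>, restr_mat ?I w) * power_sum R \<tau> \<nu> (\<tau>, restr_mat ?J w)"
      using True r by (simp add: mult2_def tensor2_def)
    also have "\<dots> = power_sum R ?\<rho> (\<kappa> \<union> \<nu>) (\<rho>, w)"
      using power_sum_friendly_Un[OF R d _ disj _ _ sc_type(1)[OF d w], unfolded r, OF _ \<kappa> \<nu>] True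
      by (simp add: power_sum_apply[OF d] power_sum_apply dd u t1 t2)
    finally show ?thesis .
  qed
qed

text \<open>At \<open>(u, v)\<close> the left side asks whether \<kappa> lies below the type of
  \<open>u + v\<close>, which splits along \<open>I\<close> and \<open>J\<close>. If \<kappa> splits
  too, the restriction condition answers factor by factor; if not, nothing that splits lies above
  \<kappa>.\<close>

lemma power_sum_comult:
  assumes R: "power_sum_friendly R" and \<rho>: "distinct \<rho>" "set \<rho> = I \<union> J" and disj: "I \<inter> J = {}"
    and \<kappa>: "\<kappa> \<in> set_partitions \<rho>"
  shows "comult2 I J (power_sum R \<rho> \<kappa> :: ('a, 'f::field) sfun) =
    (if \<kappa> = restr_arcs I \<kappa> \<union> restr_arcs J \<kappa>
     then tensor2 (power_sum R (restr_order I \<rho>) (restr_arcs I \<kappa>)) (power_sum R (restr_order J \<rho>) (restr_arcs J \<kappa>))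
     else 0)" (is "?L = ?T")
proof (rule ext, clarify)
  fix \<phi> \<tau> :: "'a list" and u v :: "('a, 'f) mat"
  let ?\<phi> = "restr_order I \<rho>" and ?\<tau> = "restr_order J \<rho>"
  have dd: "distinct ?\<phi>" "distinct ?\<tau>" using \<rho> by auto
  have K: "set ?\<phi> = I" "set ?\<tau> = J" using \<rho> by auto
  show "?L ((\<phi>, u), (\<tau>, v)) = ?T ((\<phi>, u), (\<tau>, v))"
  proof (cases "\<phi> = ?\<phi> \<and> \<tau> = ?\<tau> \<and> u \<in> unitriangular ?\<phi> \<and> v \<in> unitriangular ?\<tau>")
    case False
    then have "?T ((\<phi>, u), (\<tau>, v)) = 0" by (auto simp: tensor2_def power_sum_apply dd)
    moreover have "?L ((\<phi>, u), (\<tau>, v)) = 0"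
    proof (cases "(\<phi>, u) \<in> points I \<and> (\<tau>, v) \<in> points J")
      case True
      then have "\<phi> \<noteq> ?\<phi> \<or> \<tau> \<noteq> ?\<tau>" using False by (auto simp: points_def)
      then have "power_sum R \<rho> \<kappa> (\<rho>', u + v) = 0"
        if "restr_order I \<rho>' = \<phi>" "restr_order J \<rho>' = \<tau>" for \<rho>'
        using that by (auto simp: power_sum_apply[OF \<rho>(1)])
      then show ?thesis by (auto simp: comult2_def intro!: sum.neutral)
    qed (auto simp: comult2_def)
    ultimately show ?thesis by simp
  next
    case True
    let ?S = "{\<rho>'. \<rho>' \<in> lin_orders (I \<union> J) \<and> restr_order I \<rho>' = \<phi> \<and> restr_order J \<rho>' = \<tau>}"
    have pts: "(\<phi>, u) \<in> points I \<and> (\<tau>, v) \<in> points J"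
      using True dd K by (auto simp: points_def lin_orders_iff)
    have fin: "finite ?S" using \<rho>(2) by (metis (no_types, lifting) finite_permutations_of_set finite_subset List.finite_set mem_Collect_eq subsetI)
    have in_S: "\<rho> \<in> ?S" using True \<rho> by (simp add: lin_orders_iff)
    have "?L ((\<phi>, u), (\<tau>, v)) = (\<Sum>\<rho>'\<in>?S. power_sum R \<rho> \<kappa> (\<rho>', u + v))"
      using pts by (simp add: comult2_def)
    \<comment> \<open>Of all shuffles of the two words only \<rho> itself supports the power
      sum.\<close>
    also have "\<dots> = (\<Sum>\<rho>'\<in>?S. if \<rho>' = \<rho> then power_sum R \<rho> \<kappa> (\<rho>, u + v) else 0)"
      by (intro sum.cong) (auto simp: power_sum_apply[OF \<rho>(1)])
    also have "\<dots> = power_sum R \<rho> \<kappa> (\<rho>, u + v)" using fin in_S by simp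
    finally have L: "?L ((\<phi>, u), (\<tau>, v)) = power_sum R \<rho> \<kappa> (\<rho>, u + v)" .
    have uv: "u \<in> unitriangular ?\<phi>" "v \<in> unitriangular ?\<tau>" using True by auto
    let ?\<mu> = "sc_type ?\<phi> u" and ?\<nu> = "sc_type ?\<tau> v"
    have t: "?\<mu> \<in> set_partitions ?\<phi>" "?\<nu> \<in> set_partitions ?\<tau>" using sc_type(1) dd uv by blast+
    have ty: "sc_type \<rho> (u + v) = ?\<mu> \<union> ?\<nu>" "u + v \<in> unitriangular \<rho>"
      using block_sum_unitriangular[OF \<rho>(1) disj \<rho>(2) uv] by auto
    have UN: "?\<mu> \<union> ?\<nu> \<in> set_partitions \<rho>" using Un_set_partitions[OF t disj] .
    have res: "restr_arcs I (?\<mu> \<union> ?\<nu>) = ?\<mu>" "restr_arcs J (?\<mu> \<union> ?\<nu>) = ?\<nu>"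
      using restr_arcs_id[OF t(1), of I] restr_arcs_disjoint[OF t(1), of J]
        restr_arcs_id[OF t(2), of J] restr_arcs_disjoint[OF t(2), of I]
      by (simp_all only: restr_arcs_Un K disj Int_commute[of J I] subset_refl simp_thms Un_empty_left Un_empty_right)
    show ?thesis
    proof (cases "\<kappa> = restr_arcs I \<kappa> \<union> restr_arcs J \<kappa>")
      case split: True
      have "(\<kappa>, ?\<mu> \<union> ?\<nu>) \<in> R \<rho> \<longleftrightarrow> (restr_arcs I \<kappa>, ?\<mu>) \<in> R ?\<phi> \<and> (restr_arcs J \<kappa>, ?\<nu>) \<in> R ?\<tau>"
        using power_sum_friendly_Un[OF R \<rho> disj restr_arcs_set_partitions[OF \<kappa>] restr_arcs_set_partitions[OF \<kappa>] UN] split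
        unfolding res by simp
      then show ?thesis unfolding L if_P[OF split] using True ty
        by (simp add: tensor2_def power_sum_apply[OF \<rho>(1)] power_sum_apply[OF dd(1)] power_sum_apply[OF dd(2)])
    next
      case False
      then have "(\<kappa>, ?\<mu> \<union> ?\<nu>) \<notin> R \<rho>"
        using power_sum_friendly_split[OF R \<rho> disj \<kappa> False UN] unfolding res by blast
      then show ?thesis unfolding L if_not_P[OF False] using ty by (simp add: power_sum_apply[OF \<rho>(1)])
    qed
  qed
qed

section \<open>Iterated products and coproducts of power sums\<close>

lemma tensor_Cons [simp]: "tensor (x # xs) (p # ps) = x p * tensor xs ps"
  by (simp add: tensor_def prod.lessThan_Suc_shift del: prod.lessThan_Suc)

lemma tensor_Nil_right [simp]: "tensor (x # xs) [] = 0"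
  by (simp add: tensor_def)

lemma tensor_Nil [simp]: "tensor [] ps = (if ps = [] then 1 else 0)"
  by (simp add: tensor_def)

text \<open>The shape that arises when \<open>mult_iter\<close> is unfolded on a pure tensor: the
  remaining factors contribute the constant \<open>c\<close>.\<close>

lemma mult2_scale: "mult2 A B (\<lambda>(q, r). x q * (y r * c)) p = mult2 A B (tensor2 x y) p * c"
  by (cases p) (simp add: mult2_def tensor2_def)

lemma comult2_scale: "comult2 A B (\<lambda>p. x p * c) qr = comult2 A B x qr * c"
  by (cases qr) (simp add: comult2_def sum_distrib_right split: prod.split)

lemma mult_iter_tensor_singleton [simp]: "mult_iter [A] (tensor [x]) = x"
  by (simp add: fun_eq_iff)

lemma mult_iter_tensor_Cons:
  "mult_iter (A # B # Js) (tensor (x # y # xs)) =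
    mult_iter ((A \<union> B) # Js) (tensor (mult2 A B (tensor2 x y) # xs))"
proof -
  have "(\<lambda>ps. case ps of [] \<Rightarrow> 0 | p # rs \<Rightarrow> mult2 A B (\<lambda>(q, r). tensor (x # y # xs) (q # r # rs)) p) =
      tensor (mult2 A B (tensor2 x y) # xs)"
    by (rule ext) (simp add: mult2_scale split: list.split)
  then show ?thesis by (simp only: mult_iter.simps)
qed

lemma mult_iter_zero: "mult_iter Js (\<lambda>_. 0) = (\<lambda>_ :: ('a, 'f::field) point. 0)"
proof (induction "length Js" arbitrary: Js rule: less_induct)
  case less
  consider "Js = []" | A where "Js = [A]" | A B Ks where "Js = A # B # Ks" by (metis list.exhaust)
  then show ?case
  proof cases
    case (3 A B Ks)
    have "(\<lambda>ps. case ps of [] \<Rightarrow> 0 | p # rs \<Rightarrow> mult2 A B (\<lambda>(q, r). 0) p) =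
        (\<lambda>_ :: ('a, 'f) point list. 0)"
      by (intro ext) (simp add: mult2_def split: list.split)
    then show ?thesis using less[of "(A \<union> B) # Ks"] 3 by (simp only: mult_iter.simps) simp
  qed (auto simp: cscale_def)
qed

text \<open>\<open>mult_iter\<close> merges from the front. Splitting off the last factor instead
  exhibits an iterated product as a binary product, which is what inductions over monomials
  use.\<close>

lemma mult_iter_tensor_snoc:
  "Js \<noteq> [] \<Longrightarrow> length xs = length Js \<Longrightarrow>
    mult_iter (Js @ [B]) (tensor (xs @ [y])) = mult2 (\<Union>(set Js)) B (tensor2 (mult_iter Js (tensor xs)) y)"
proof (induction "length Js" arbitrary: Js xs rule: less_induct)
  case less
  then obtain A Js' x xs' where J: "Js = A # Js'" "xs = x # xs'" by (cases Js; cases xs) auto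
  show ?case
  proof (cases Js')
    case Nil
    then show ?thesis using J less.prems by (simp add: mult_iter_tensor_Cons del: mult_iter.simps(3))
  next
    case (Cons A' Ks)
    then obtain x' ys where x: "xs' = x' # ys" using J less.prems by (cases xs') auto
    have "mult_iter (((A \<union> A') # Ks) @ [B]) (tensor ((mult2 A A' (tensor2 x x') # ys) @ [y])) =
        mult2 (\<Union>(set ((A \<union> A') # Ks))) B
          (tensor2 (mult_iter ((A \<union> A') # Ks) (tensor (mult2 A A' (tensor2 x x') # ys))) y)"
      by (rule less.hyps) (use J Cons x less.prems in auto)
    then show ?thesis using J Cons x by (simp add: mult_iter_tensor_Cons Un_assoc del: mult_iter.simps(3))
  qed
qed

section \<open>Words of pairs, set compositions and rearranged words\<close>

text \<open>The operation on labels that the product of power sums realizes. Atomic pairs will turn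
  out to be its free generators.\<close>

definition pair_prod :: "('a list \<times> 'a arcs) list \<Rightarrow> 'a list \<times> 'a arcs" where
  "pair_prod ws = (concat (map fst ws), \<Union>(set (map snd ws)))"

lemma pair_prod_Nil [simp]: "pair_prod [] = ([], {})"
  by (simp add: pair_prod_def)

lemma pair_prod_append:
  "pair_prod (vs @ ws) = (fst (pair_prod vs) @ fst (pair_prod ws), snd (pair_prod vs) \<union> snd (pair_prod ws))"
  by (simp add: pair_prod_def)

lemma pair_prod_Cons:
  "pair_prod (w # ws) = (fst w @ fst (pair_prod ws), snd w \<union> snd (pair_prod ws))"
  by (simp add: pair_prod_def)

lemma pair_prod_set_partitions:
  "distinct (fst (pair_prod ws)) \<Longrightarrow> \<forall>(\<phi>, \<mu>)\<in>set ws. \<mu> \<in> set_partitions \<phi> \<Longrightarrow>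
    snd (pair_prod ws) \<in> set_partitions (fst (pair_prod ws))"
proof (induction ws)
  case Nil
  then show ?case by (simp add: set_partitions_def)
next
  case (Cons w ws)
  then show ?case by (cases w) (auto simp: pair_prod_Cons intro!: set_partitions_append)
qed

definition power_sum_pair :: "('a list \<Rightarrow> 'a arcs rel) \<Rightarrow> 'a list \<times> 'a arcs \<Rightarrow> ('a, 'f::field) sfun" where
  "power_sum_pair R = (\<lambda>(\<phi>, \<mu>). power_sum R \<phi> \<mu>)"

lemma mult_iter_power_sum:
  assumes R: "power_sum_friendly R"
  shows "ws \<noteq> [] \<Longrightarrow> distinct (fst (pair_prod ws)) \<Longrightarrow> \<forall>(\<phi>, \<mu>)\<in>set ws. \<mu> \<in> set_partitions \<phi> \<Longrightarrow>
    mult_iter (map (\<lambda>w. set (fst w)) ws) (tensor (map (power_sum_pair R) ws)) =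
    (power_sum_pair R (pair_prod ws) :: ('a, 'f::field) sfun)"
proof (induction "length ws" arbitrary: ws rule: less_induct)
  case less
  then obtain \<phi> \<mu> vs where w: "ws = (\<phi>, \<mu>) # vs" by (metis list.exhaust surj_pair)
  show ?case
  proof (cases vs)
    case Nil
    then show ?thesis using w by (simp add: pair_prod_Cons)
  next
    case (Cons v us)
    obtain \<tau> \<nu> where v: "v = (\<tau>, \<nu>)" by (cases v)
    have *: "distinct (\<phi> @ \<tau>)" "\<mu> \<in> set_partitions \<phi>" "\<nu> \<in> set_partitions \<tau>"
      using less.prems by (auto simp: w Cons v pair_prod_Cons)
    then have "\<mu> \<union> \<nu> \<in> set_partitions (\<phi> @ \<tau>)" by (intro set_partitions_append) auto
    then have "mult_iter (map (\<lambda>w. set (fst w)) ((\<phi> @ \<tau>, \<mu> \<union> \<nu>) # us))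
        (tensor (map (power_sum_pair R) ((\<phi> @ \<tau>, \<mu> \<union> \<nu>) # us))) =
        (power_sum_pair R (pair_prod ((\<phi> @ \<tau>, \<mu> \<union> \<nu>) # us)) :: ('a, 'f) sfun)"
      using less.prems by (intro less.hyps) (auto simp: w Cons v pair_prod_Cons)
    then show ?thesis
      using power_sum_mult[where 'f = 'f, OF R *]
      by (simp add: w Cons v mult_iter_tensor_Cons power_sum_pair_def pair_prod_Cons Un_assoc
          del: mult_iter.simps(3))
  qed
qed

definition blockwise :: "'a set list \<Rightarrow> 'a arcs \<Rightarrow> bool" where
  "blockwise Js \<kappa> \<longleftrightarrow> (\<forall>(i, j)\<in>\<kappa>. \<exists>J\<in>set Js. i \<in> J \<and> j \<in> J)"

text \<open>The composite of iterated coproduct and product along \<open>Js\<close> changes only the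
  order of a power sum: \<phi> becomes \<open>rearrange Js \<phi>\<close> and the arcs stay, or the
  result is zero if some arc joins two blocks.\<close>

definition rearrange :: "'a set list \<Rightarrow> 'a list \<Rightarrow> 'a list" where
  "rearrange Js \<phi> = concat (map (\<lambda>J. restr_order J \<phi>) Js)"

text \<open>Disjoint nonempty blocks are distinct, so distinctness and pairwise disjointness merge
  into one \<open>sorted_wrt\<close> condition that suits list induction.\<close>

lemma set_compositions_iff:
  "Js \<in> set_compositions K \<longleftrightarrow> {} \<notin> set Js \<and> sorted_wrt disjnt Js \<and> \<Union>(set Js) = K"
proof -
  have "distinct Js \<and> pairwise disjnt (set Js) \<longleftrightarrow> sorted_wrt disjnt Js" if "{} \<notin> set Js"
    using that by (induction Js) (auto simp: pairwise_insert disjnt_sym disjnt_def)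
  then show ?thesis unfolding set_compositions_def by blast
qed

lemma finite_set_compositions: "finite K \<Longrightarrow> finite (set_compositions K)"
  by (rule finite_subset[of _ "{Js. set Js \<subseteq> Pow K \<and> distinct Js}"])
    (auto simp: set_compositions_def intro!: finite_subset_distinct)

lemma set_rearrange: "\<Union>(set Js) = set \<phi> \<Longrightarrow> set (rearrange Js \<phi>) = set \<phi>"
  by (auto simp: rearrange_def)

lemma distinct_rearrange: "distinct \<phi> \<Longrightarrow> sorted_wrt disjnt Js \<Longrightarrow> distinct (rearrange Js \<phi>)"
  by (induction Js) (auto simp: rearrange_def disjnt_def)

lemma pair_prod_restr:
  assumes "blockwise Js \<kappa>"
  shows "pair_prod (map (\<lambda>J. (restr_order J \<phi>, restr_arcs J \<kappa>)) Js) = (rearrange Js \<phi>, \<kappa>)"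
  using assms by (auto simp: pair_prod_def rearrange_def o_def blockwise_def)

lemma rearrange_set_partitions:
  assumes "distinct \<phi>" "\<kappa> \<in> set_partitions \<phi>" "sorted_wrt disjnt Js" "blockwise Js \<kappa>"
  shows "\<kappa> \<in> set_partitions (rearrange Js \<phi>)"
  using pair_prod_set_partitions[of "map (\<lambda>J. (restr_order J \<phi>, restr_arcs J \<kappa>)) Js"]
    distinct_rearrange[OF assms(1,3)] restr_arcs_set_partitions[OF assms(2)]
  by (auto simp: pair_prod_restr[OF assms(4)])

lemma comult_iter_power_sum:
  assumes R: "power_sum_friendly R" and \<phi>: "distinct \<phi>" "\<kappa> \<in> set_partitions \<phi>"
  shows "Js \<noteq> [] \<Longrightarrow> sorted_wrt disjnt Js \<Longrightarrow> \<Union>(set Js) = set \<phi> \<Longrightarrow>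
    comult_iter Js (power_sum R \<phi> \<kappa> :: ('a, 'f::field) sfun) =
    (if blockwise Js \<kappa> then tensor (map (\<lambda>J. power_sum R (restr_order J \<phi>) (restr_arcs J \<kappa>)) Js) else (\<lambda>_. 0))"
proof (induction "length Js" arbitrary: Js rule: less_induct)
  case less
  let ?P = "\<lambda>J. power_sum R (restr_order J \<phi>) (restr_arcs J \<kappa>) :: ('a, 'f) sfun"
  consider A where "Js = [A]" | A B Ks where "Js = A # B # Ks" by (metis list.exhaust less.prems(1))
  then show ?case
  proof cases
    case (1 A)
    then have A: "A = set \<phi>" using less.prems by simp
    have "blockwise Js \<kappa>" using set_partitions_subset[OF \<phi>(2)] by (auto simp: blockwise_def 1 A)
    moreover have "comult_iter [A] (power_sum R \<phi> \<kappa>) = (tensor [power_sum R \<phi> \<kappa>] :: ('a, 'f) point list \<Rightarrow> complex)"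
      by (rule ext) (simp split: list.split)
    ultimately show ?thesis using 1 \<phi>(2) by (simp add: A restr_order_id restr_arcs_id del: comult_iter.simps)
  next
    case (2 A B Ks)
    let ?AB = "A \<union> B"
    have disj: "A \<inter> B = {}" "\<And>J. J \<in> set Ks \<Longrightarrow> A \<inter> J = {} \<and> B \<inter> J = {}"
      using less.prems(2) 2 by (auto simp: disjnt_def)
    have IH: "comult_iter (?AB # Ks) (power_sum R \<phi> \<kappa> :: ('a, 'f) sfun) =
        (if blockwise (?AB # Ks) \<kappa> then tensor (map ?P (?AB # Ks)) else (\<lambda>_. 0))"
      by (rule less.hyps) (use less.prems 2 in \<open>auto simp: disjnt_def\<close>)
    \<comment> \<open>The recursion of \<open>comult_iter\<close> splits \<open>A \<union> B\<close>
      last. The arcs lost in this last split are those joining \<open>A\<close> and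
      \<open>B\<close>.\<close>
    have bw: "blockwise Js \<kappa> \<longleftrightarrow> blockwise (?AB # Ks) \<kappa> \<and>
        restr_arcs ?AB \<kappa> = restr_arcs A \<kappa> \<union> restr_arcs B \<kappa>" (is "?l \<longleftrightarrow> ?r1 \<and> ?r2")
    proof (intro iffI conjI)
      assume l: ?l
      then show ?r1 unfolding blockwise_def 2 by fastforce
      show ?r2
      proof (intro equalityI subrelI)
        fix i j assume ij: "(i, j) \<in> restr_arcs ?AB \<kappa>"
        then obtain J where J: "J \<in> set Js" "i \<in> J" "j \<in> J" using l by (auto simp: blockwise_def)
        then have "J \<notin> set Ks" using ij disj(2) by auto
        then show "(i, j) \<in> restr_arcs A \<kappa> \<union> restr_arcs B \<kappa>" using J ij 2 by auto
      qed auto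
    next
      assume r: "?r1 \<and> ?r2"
      have "\<exists>J\<in>set Js. i \<in> J \<and> j \<in> J" if ij: "(i, j) \<in> \<kappa>" for i j
      proof -
        obtain J where J: "J \<in> set (?AB # Ks)" "i \<in> J" "j \<in> J"
          using r ij unfolding blockwise_def by blast
        show ?thesis
        proof (cases "J \<in> set Ks")
          case False
          then have "(i, j) \<in> restr_arcs ?AB \<kappa>" using J ij by auto
          then have "(i, j) \<in> restr_arcs A \<kappa> \<union> restr_arcs B \<kappa>" using r by blast
          then show ?thesis using 2 by auto
        qed (use J 2 in auto)
      qed
      then show ?l unfolding blockwise_def by blast
    qed
    have c2: "comult2 A B (?P ?AB) = (if restr_arcs ?AB \<kappa> = restr_arcs A \<kappa> \<union> restr_arcs B \<kappa>
        then tensor2 (?P A) (?P B) else 0)"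
    proof -
      have "set (restr_order ?AB \<phi>) = ?AB" using less.prems(3) 2 by auto
      moreover have "A \<inter> ?AB = A" "B \<inter> ?AB = B" by auto
      ultimately show ?thesis
        using power_sum_comult[where 'f = 'f, OF R _ _ disj(1) restr_arcs_set_partitions[OF \<phi>(2), of ?AB]] \<phi>(1)
        by (simp only: restr_order_restr_order restr_arcs_restr_arcs distinct_restr_order)
    qed
    show ?thesis
    proof (rule ext)
      fix ps :: "('a, 'f) point list"
      consider "ps = []" | p where "ps = [p]" | q r rs where "ps = q # r # rs" by (metis list.exhaust)
      then show "comult_iter Js (power_sum R \<phi> \<kappa>) ps = (if blockwise Js \<kappa> then tensor (map ?P Js) else (\<lambda>_. 0)) ps"
      proof cases
        case (3 q r rs)
        have "comult_iter Js (power_sum R \<phi> \<kappa>) ps =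
            comult2 A B (\<lambda>p. comult_iter (?AB # Ks) (power_sum R \<phi> \<kappa>) (p # rs)) (q, r)"
          by (simp add: 2 3)
        also have "\<dots> = comult2 A B (\<lambda>p. ?P ?AB p * (if blockwise (?AB # Ks) \<kappa> then tensor (map ?P Ks) rs else 0)) (q, r)"
          by (simp add: IH)
        also have "\<dots> = comult2 A B (?P ?AB) (q, r) * (if blockwise (?AB # Ks) \<kappa> then tensor (map ?P Ks) rs else 0)"
          by (rule comult2_scale)
        also have "\<dots> = (if blockwise Js \<kappa> then tensor (map ?P Js) else (\<lambda>_. 0)) ps"
          unfolding c2 bw by (simp add: 2 3 tensor2_def)
        finally show ?thesis .
      qed (simp_all add: 2)
    qed
  qed
qed

definition rooted_blocks :: "'a \<Rightarrow> 'a set \<Rightarrow> 'a arcs \<Rightarrow> 'a set list set" where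
  "rooted_blocks k K \<kappa> = {Js \<in> set_compositions K. Js \<noteq> [] \<and> k \<in> hd Js \<and> blockwise Js \<kappa>}"

lemma finite_rooted_blocks: "finite K \<Longrightarrow> finite (rooted_blocks k K \<kappa>)"
  by (simp add: rooted_blocks_def finite_set_compositions)

text \<open>Compositions cut by an arc drop out and the others only reorder the word, so all
  surviving terms share the arcs \<kappa>.\<close>

lemma Psi_power_sum:
  assumes R: "power_sum_friendly R" and \<phi>: "distinct \<phi>" "\<kappa> \<in> set_partitions \<phi>"
  shows "Psi k (set \<phi>) (power_sum R \<phi> \<kappa> :: ('a, 'f::field) sfun) =
    (\<Sum>Js\<in>rooted_blocks k (set \<phi>) \<kappa>. cscale ((-1) ^ (length Js - 1)) (power_sum R (rearrange Js \<phi>) \<kappa>))"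
  unfolding Psi_def
proof (rule sum.mono_neutral_cong_right)
  let ?x = "power_sum R \<phi> \<kappa> :: ('a, 'f) sfun"
  have ci: "comult_iter Js ?x =
      (if blockwise Js \<kappa> then tensor (map (\<lambda>J. power_sum R (restr_order J \<phi>) (restr_arcs J \<kappa>)) Js) else (\<lambda>_. 0))"
    if "Js \<in> set_compositions (set \<phi>)" "Js \<noteq> []" for Js
    using that by (intro comult_iter_power_sum[OF R \<phi>]) (auto simp: set_compositions_iff)
  show "finite {Js \<in> set_compositions (set \<phi>). Js \<noteq> [] \<and> k \<in> hd Js}"
    using finite_set_compositions[of "set \<phi>"] by simp
  show "rooted_blocks k (set \<phi>) \<kappa> \<subseteq> {Js \<in> set_compositions (set \<phi>). Js \<noteq> [] \<and> k \<in> hd Js}"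
    by (auto simp: rooted_blocks_def)
  show "\<forall>Js\<in>{Js \<in> set_compositions (set \<phi>). Js \<noteq> [] \<and> k \<in> hd Js} - rooted_blocks k (set \<phi>) \<kappa>.
      cscale ((- 1) ^ (length Js - 1)) (mult_iter Js (comult_iter Js ?x)) = 0"
    by (auto simp: ci mult_iter_zero rooted_blocks_def cscale_def fun_eq_iff)
  fix Js assume Js: "Js \<in> rooted_blocks k (set \<phi>) \<kappa>"
  then have *: "Js \<in> set_compositions (set \<phi>)" "Js \<noteq> []" "blockwise Js \<kappa>" by (auto simp: rooted_blocks_def)
  let ?ws = "map (\<lambda>J. (restr_order J \<phi>, restr_arcs J \<kappa>)) Js"
  have "mult_iter (map (\<lambda>w. set (fst w)) ?ws) (tensor (map (power_sum_pair R) ?ws)) =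
      (power_sum_pair R (pair_prod ?ws) :: ('a, 'f) sfun)"
    using * \<phi> distinct_rearrange[OF \<phi>(1), of Js] restr_arcs_set_partitions[OF \<phi>(2)]
    by (intro mult_iter_power_sum[OF R]) (auto simp: pair_prod_restr set_compositions_iff)
  moreover have "map (\<lambda>w. set (fst w)) ?ws = Js"
    using *(1) by (auto simp: set_compositions_iff intro!: map_idI)
  ultimately have "mult_iter Js (comult_iter Js ?x) = power_sum R (rearrange Js \<phi>) \<kappa>"
    using ci[OF *(1,2)] *(3) by (simp add: pair_prod_restr power_sum_pair_def o_def)
  then show "cscale ((- 1) ^ (length Js - 1)) (mult_iter Js (comult_iter Js ?x)) =
      cscale ((- 1) ^ (length Js - 1)) (power_sum R (rearrange Js \<phi>) \<kappa>)" by simp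
qed

section \<open>Primitivity\<close>

text \<open>The sign-reversing involution on set compositions whose first block is not contained in
  \<open>B\<close>: the first block meeting \<open>B\<close> is split into its parts outside and inside \<open>B\<close>, unless
  it is contained in \<open>B\<close>, in which case it is merged with its predecessor.\<close>

fun flip_block :: "'a set \<Rightarrow> 'a set list \<Rightarrow> 'a set list" where
  "flip_block B [] = []"
| "flip_block B [X] = (if X \<inter> B = {} then [X] else [X - B, X \<inter> B])"
| "flip_block B (X # Y # Js) =
    (if X \<inter> B \<noteq> {} then (X - B) # (X \<inter> B) # Y # Js
     else if Y \<subseteq> B then (X \<union> Y) # Js else X # flip_block B (Y # Js))"

text \<open>The new head is still not inside \<open>B\<close>, so a second application takes the
  recursive branch again and can undo the first; and the new head keeps all letters of the old one
  outside \<open>B\<close>, the root among them.\<close>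

lemma flip_block_Cons:
  assumes "\<not> X \<subseteq> B"
  shows "\<exists>Y Zs. flip_block B (X # Js) = Y # Zs \<and> \<not> Y \<subseteq> B \<and> X - B \<subseteq> Y"
  using assms by (cases Js) auto

lemma flip_block_flip_block:
  "\<not> hd Js \<subseteq> B \<Longrightarrow> {} \<notin> set Js \<Longrightarrow> flip_block B (flip_block B Js) = Js"
proof (induction B Js rule: flip_block.induct)
  case (1 B)
  then show ?case by simp
next
  case (2 B X)
  then show ?case by auto
next
  case (3 B X Y Js)
  consider "X \<inter> B \<noteq> {}" | "X \<inter> B = {}" "Y \<subseteq> B" | "X \<inter> B = {}" "\<not> Y \<subseteq> B" by blast
  then show ?case
  proof cases
    case 1
    have "X - B \<union> X \<inter> B = X" "(X - B) \<inter> B = {}" by auto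
    then show ?thesis using 1 by simp
  next
    case 2
    \<comment> \<open>Since \<open>Y\<close> is nonempty, the merged block meets \<open>B\<close>,
      so the second application splits it exactly where it was joined.\<close>
    then have "(X \<union> Y) \<inter> B = Y" "X \<union> Y - B = X" "Y \<noteq> {}" using 3(3) by auto
    then show ?thesis using 2 by (cases Js) simp_all
  next
    case c: 3
    then have IH: "flip_block B (flip_block B (Y # Js)) = Y # Js" using 3 by simp
    obtain Z Zs where "flip_block B (Y # Js) = Z # Zs" "\<not> Z \<subseteq> B" using flip_block_Cons[OF c(2)] by blast
    then show ?thesis using c IH by simp
  qed
qed

text \<open>Some block meets \<open>B\<close>, so the recursion reaches a split or a merge: the
  length changes by one and there are no fixed points.\<close>

lemma flip_block_length:
  "\<Union>(set Js) \<inter> B \<noteq> {} \<Longrightarrow> \<not> hd Js \<subseteq> B \<Longrightarrow>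
    length (flip_block B Js) = Suc (length Js) \<or> length Js = Suc (length (flip_block B Js))"
  by (induction B Js rule: flip_block.induct) auto

lemma Union_flip_block: "\<Union>(set (flip_block B Js)) = \<Union>(set Js)"
  by (induction B Js rule: flip_block.induct) auto

lemma flip_block_disjnt: "sorted_wrt disjnt Js \<Longrightarrow> sorted_wrt disjnt (flip_block B Js)"
proof (induction B Js rule: flip_block.induct)
  case (3 B X Y Js)
  have "\<forall>Z\<in>set (flip_block B (Y # Js)). disjnt X Z"
    using 3(2) Union_flip_block[of B "Y # Js"] by (auto simp: disjnt_def)
  then show ?case using 3 by (auto simp: disjnt_def)
qed (auto simp: disjnt_def)

lemma flip_block_nonempty:
  "{} \<notin> set Js \<Longrightarrow> \<not> hd Js \<subseteq> B \<Longrightarrow> {} \<notin> set (flip_block B Js)"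
  by (induction B Js rule: flip_block.induct) auto

text \<open>A split separates only a letter in \<open>B\<close> from a letter outside
  \<open>B\<close>, and a merge separates nothing.\<close>

lemma flip_block_arc:
  "i \<in> B \<longleftrightarrow> j \<in> B \<Longrightarrow> \<exists>J\<in>set Js. i \<in> J \<and> j \<in> J \<Longrightarrow> \<exists>J\<in>set (flip_block B Js). i \<in> J \<and> j \<in> J"
  by (induction B Js rule: flip_block.induct) auto

lemma restr_order_empty [simp]: "restr_order {} \<phi> = []"
  by (simp add: restr_order_def)

lemma restr_order_rearrange_Cons:
  "restr_order A (rearrange (X # Js) \<phi>) = restr_order (A \<inter> X) \<phi> @ restr_order A (rearrange Js \<phi>)"
  by (simp add: rearrange_def)

lemma restr_order_rearrange_Nil [simp]: "restr_order A (rearrange [] \<phi>) = []"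
  by (simp add: rearrange_def restr_order_def)

text \<open>Splitting or merging moves letters of \<open>B\<close> past letters outside
  \<open>B\<close> and keeps the order within each of the two classes.\<close>

lemma restr_order_flip_block_disjoint:
  assumes "A \<inter> B = {}"
  shows "restr_order A (rearrange (flip_block B Js) \<phi>) = restr_order A (rearrange Js \<phi>)"
  using assms
proof (induction B Js rule: flip_block.induct)
  case (2 B X)
  then have "A \<inter> (X - B) = A \<inter> X" "A \<inter> (X \<inter> B) = {}" by auto
  then show ?case by (simp add: restr_order_rearrange_Cons)
next
  case (3 B X Y Js)
  then have "A \<inter> (X - B) = A \<inter> X" "A \<inter> (X \<inter> B) = {}"
    "Y \<subseteq> B \<Longrightarrow> A \<inter> (X \<union> Y) = A \<inter> X \<and> A \<inter> Y = {}" by auto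
  then show ?case using 3 by (simp add: restr_order_rearrange_Cons)
qed simp

lemma restr_order_flip_block:
  "restr_order B (rearrange (flip_block B Js) \<phi>) = restr_order B (rearrange Js \<phi>)"
proof (induction B Js rule: flip_block.induct)
  case (2 B X)
  have "B \<inter> (X - B) = {}" "B \<inter> (X \<inter> B) = B \<inter> X" by auto
  then show ?case by (simp add: restr_order_rearrange_Cons)
next
  case (3 B X Y Js)
  have "B \<inter> (X - B) = {}" "B \<inter> (X \<inter> B) = B \<inter> X"
    "X \<inter> B = {} \<Longrightarrow> B \<inter> (X \<union> Y) = B \<inter> Y \<and> B \<inter> X = {}" by auto
  then show ?case using 3 by (simp add: restr_order_rearrange_Cons)
qed simp

text \<open>\<open>G\<close> stands for the value of a coproduct at a fixed pair of points, which
  sees only the two restricted words. The root lies in the first block and in \<open>A\<close>, so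
  the first block is not contained in \<open>B\<close>, as the involution requires.\<close>

lemma sum_rooted_blocks_cancel:
  fixes G :: "'a list \<Rightarrow> 'a list \<Rightarrow> complex"
  assumes AB: "A \<inter> B = {}" "B \<noteq> {}" "B \<subseteq> K" and k: "k \<in> A"
    and \<kappa>: "\<And>i j. (i, j) \<in> \<kappa> \<Longrightarrow> i \<in> B \<longleftrightarrow> j \<in> B"
  shows "(\<Sum>Js\<in>rooted_blocks k K \<kappa>. (-1) ^ (length Js - 1) *
    G (restr_order A (rearrange Js \<phi>)) (restr_order B (rearrange Js \<phi>))) = 0" (is "sum ?f ?C = 0")
proof -
  have hd: "Js \<noteq> []" "\<not> hd Js \<subseteq> B" "{} \<notin> set Js" "\<Union>(set Js) = K" "sorted_wrt disjnt Js"
    "k \<in> hd Js" "blockwise Js \<kappa>" if "Js \<in> ?C" for Js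
    using that k AB(1) by (auto simp: rooted_blocks_def set_compositions_iff)
  have flip: "flip_block B Js \<in> ?C" if Js: "Js \<in> ?C" for Js
  proof -
    obtain X Ks where X: "Js = X # Ks" using hd(1)[OF Js] by (cases Js) auto
    have "\<not> X \<subseteq> B" using hd(2)[OF Js] X by simp
    from flip_block_Cons[OF this, of Ks]
    obtain Y Zs where Y: "flip_block B Js = Y # Zs" "X - B \<subseteq> Y" unfolding X by auto
    have "k \<in> Y" using Y(2) hd(6)[OF Js] X k AB(1) by auto
    moreover have "blockwise (flip_block B Js) \<kappa>"
      unfolding blockwise_def
    proof clarify
      fix i j assume ij: "(i, j) \<in> \<kappa>"
      then have "\<exists>J\<in>set Js. i \<in> J \<and> j \<in> J" using hd(7)[OF Js] unfolding blockwise_def by blast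
      then show "\<exists>J\<in>set (flip_block B Js). i \<in> J \<and> j \<in> J" by (rule flip_block_arc[OF \<kappa>[OF ij]])
    qed
    ultimately show ?thesis
      using flip_block_nonempty[OF hd(3,2)[OF Js]] Union_flip_block[of B Js] hd(4)[OF Js]
        flip_block_disjnt[OF hd(5)[OF Js], of B] Y(1)
      by (auto simp: rooted_blocks_def set_compositions_iff)
  qed
  have sign: "?f (flip_block B Js) = - ?f Js" if Js: "Js \<in> ?C" for Js
  proof -
    have "\<Union>(set Js) \<inter> B \<noteq> {}" using hd(4)[OF Js] AB by auto
    then have l: "length (flip_block B Js) = Suc (length Js) \<or> length Js = Suc (length (flip_block B Js))"
      by (rule flip_block_length[OF _ hd(2)[OF Js]])
    \<comment> \<open>Both compositions are nonempty, so the exponents are true predecessors and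
      differ by one.\<close>
    have "length Js \<noteq> 0" "length (flip_block B Js) \<noteq> 0" using hd(1)[OF Js] hd(1)[OF flip[OF Js]] by auto
    then have "length (flip_block B Js) - 1 = Suc (length Js - 1) \<or> length Js - 1 = Suc (length (flip_block B Js) - 1)"
      using l by auto
    then have "(-1 :: complex) ^ (length (flip_block B Js) - 1) = - ((-1) ^ (length Js - 1))" by auto
    then show ?thesis by (simp add: restr_order_flip_block restr_order_flip_block_disjoint[OF AB(1)])
  qed
  have "sum ?f ?C = (\<Sum>Js\<in>?C. - ?f Js)"
    by (rule sum.reindex_bij_witness[where i = "flip_block B" and j = "flip_block B"])
      (simp_all only: flip flip_block_flip_block[OF hd(2,3)] sign minus_minus)
  then show ?thesis by (simp add: sum_negf)
qed

lemma comult2_zero: "comult2 I J 0 pq = 0"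
  by (cases pq) (simp add: comult2_def split: prod.split)

lemma comult2_add: "comult2 I J (x + y) pq = comult2 I J x pq + comult2 I J y pq"
  by (cases pq) (simp add: comult2_def sum.distrib split: prod.split)

lemma comult2_cscale: "comult2 I J (cscale c x) pq = c * comult2 I J x pq"
  by (cases pq) (simp add: comult2_def cscale_def sum_distrib_left split: prod.split)

lemma comult2_sum:
  "comult2 I J (\<Sum>s\<in>S. cscale (c s) (x s)) pq = (\<Sum>s\<in>S. c s * comult2 I J (x s) pq)"
proof (induction S rule: infinite_finite_induct)
  case (insert s S)
  show ?case unfolding sum.insert[OF insert.hyps] comult2_add comult2_cscale insert.IH ..
next
  case (infinite S)
  show ?case unfolding sum.infinite[OF infinite] comult2_zero ..
next
  case empty
  show ?case unfolding sum.empty comult2_zero ..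
qed

text \<open>If \<kappa> does not split along \<open>I\<close> and \<open>J\<close>, every term
  vanishes; if it does, the terms cancel in pairs.\<close>

lemma comult2_Psi_power_sum:
  assumes R: "power_sum_friendly R" and \<phi>: "distinct \<phi>" "\<kappa> \<in> set_partitions \<phi>"
    and k: "k \<in> set \<phi>" and IJ: "[I, J] \<in> set_compositions (set \<phi>)"
  shows "comult2 I J (Psi k (set \<phi>) (power_sum R \<phi> \<kappa> :: ('a, 'f::field) sfun)) = 0"
proof
  fix pq :: "('a, 'f) point \<times> ('a, 'f) point"
  have K: "I \<inter> J = {}" "set \<phi> = I \<union> J" "I \<noteq> {}" "J \<noteq> {}"
    using IJ by (auto simp: set_compositions_iff disjnt_def)
  let ?C = "rooted_blocks k (set \<phi>) \<kappa>"
  let ?P = "\<lambda>\<psi>. power_sum R \<psi> \<kappa> :: ('a, 'f) sfun"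
  define G where "G = (\<lambda>\<alpha> \<beta>. tensor2 (power_sum R \<alpha> (restr_arcs I \<kappa>)) (power_sum R \<beta> (restr_arcs J \<kappa>) :: ('a, 'f) sfun) pq)"
  have c: "comult2 I J (?P (rearrange Js \<phi>)) pq =
      (if \<kappa> = restr_arcs I \<kappa> \<union> restr_arcs J \<kappa> then
        G (restr_order I (rearrange Js \<phi>)) (restr_order J (rearrange Js \<phi>)) else 0)"
    if "Js \<in> ?C" for Js
  proof -
    have Js: "sorted_wrt disjnt Js" "blockwise Js \<kappa>" "\<Union>(set Js) = set \<phi>"
      using that by (auto simp: rooted_blocks_def set_compositions_iff)
    have "set (rearrange Js \<phi>) = I \<union> J" using set_rearrange[OF Js(3)] K(2) by simp
    from power_sum_comult[where 'f = 'f, OF R distinct_rearrange[OF \<phi>(1) Js(1)] this K(1)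
        rearrange_set_partitions[OF \<phi> Js(1,2)]]
    show ?thesis by (simp only: G_def) (simp del: restr_order_append)
  qed
  have "comult2 I J (Psi k (set \<phi>) (?P \<phi>)) pq =
      (\<Sum>Js\<in>?C. (-1) ^ (length Js - 1) * comult2 I J (?P (rearrange Js \<phi>)) pq)"
    by (simp add: Psi_power_sum[OF R \<phi>] comult2_sum)
  also have "\<dots> = 0"
  proof (cases "\<kappa> = restr_arcs I \<kappa> \<union> restr_arcs J \<kappa>")
    case False
    then show ?thesis by (simp add: c)
  next
    case True
    have arcs: "i \<in> I \<and> j \<in> I \<or> i \<in> J \<and> j \<in> J" if "(i, j) \<in> \<kappa>" for i j
    proof -
      have "(i, j) \<in> restr_arcs I \<kappa> \<union> restr_arcs J \<kappa>" using True that by blast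
      then show ?thesis by auto
    qed
    have "(\<Sum>Js\<in>?C. (-1) ^ (length Js - 1) * comult2 I J (?P (rearrange Js \<phi>)) pq) =
        (\<Sum>Js\<in>?C. (-1) ^ (length Js - 1) * G (restr_order I (rearrange Js \<phi>)) (restr_order J (rearrange Js \<phi>)))"
      by (intro sum.cong refl) (simp only: c if_P[OF True])
    also have "\<dots> = 0"
    proof (cases "k \<in> I")
      case True
      show ?thesis
        by (rule sum_rooted_blocks_cancel) (use K True arcs in blast)+
    next
      case False
      \<comment> \<open>The involution has to split along the side without the root, here
        \<open>I\<close>, so the two arguments of \<open>G\<close> change places.\<close>
      then have kJ: "k \<in> J" using k K by auto
      show ?thesis
        by (rule sum_rooted_blocks_cancel[where G = "\<lambda>\<beta> \<alpha>. G \<alpha> \<beta>" and A = J and B = I])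
          (use K kJ arcs in blast)+
    qed
    finally show ?thesis .
  qed
  finally show "comult2 I J (Psi k (set \<phi>) (?P \<phi>)) pq = 0 pq" by simp
qed

lemma Psi_power_sum_in_scf:
  assumes R: "power_sum_friendly R" and \<phi>: "distinct \<phi>" "\<kappa> \<in> set_partitions \<phi>"
  shows "Psi k (set \<phi>) (power_sum R \<phi> \<kappa>) \<in> scf (set \<phi>)"
proof -
  have "power_sum R (rearrange Js \<phi>) \<kappa> \<in> scf (set \<phi>)" if "Js \<in> rooted_blocks k (set \<phi>) \<kappa>" for Js
    using power_sum_in_scf[OF distinct_rearrange[OF \<phi>(1)], of Js R \<kappa>] set_rearrange[of Js \<phi>] that
    by (auto simp: rooted_blocks_def set_compositions_iff)
  then show ?thesis
    unfolding Psi_power_sum[OF R \<phi>] scf_def by (intro cfun.span_sum cfun.span_scale) auto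
qed


section \<open>Factorization into atomic pairs\<close>

lemma atomic_pairsD:
  "(\<phi>, \<mu>) \<in> atomic_pairs \<Longrightarrow> distinct \<phi> \<and> \<phi> \<noteq> [] \<and> \<mu> \<in> set_partitions \<phi>"
  by (simp add: atomic_pairs_def)

lemma append_not_atomic:
  assumes "\<alpha> \<noteq> []" "\<beta> \<noteq> []"
    and "\<And>i j. (i, j) \<in> \<mu> \<Longrightarrow> i \<in> set \<alpha> \<and> j \<in> set \<alpha> \<or> i \<in> set \<beta> \<and> j \<in> set \<beta>"
  shows "(\<alpha> @ \<beta>, \<mu>) \<notin> atomic_pairs"
proof
  assume at: "(\<alpha> @ \<beta>, \<mu>) \<in> atomic_pairs"
  then have d: "set \<alpha> \<inter> set \<beta> = {}" using atomic_pairsD by fastforce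
  have "[set \<alpha>, set \<beta>] \<in> set_compositions (set (\<alpha> @ \<beta>))"
    using assms(1,2) d by (auto simp: set_compositions_iff disjnt_def)
  moreover have "\<alpha> @ \<beta> = restr_order (set \<alpha>) (\<alpha> @ \<beta>) @ restr_order (set \<beta>) (\<alpha> @ \<beta>)"
    using d by (simp add: restr_order_id restr_order_disjoint Int_commute)
  moreover have "\<mu> = restr_arcs (set \<alpha>) \<mu> \<union> restr_arcs (set \<beta>) \<mu>"
    using assms(3) by (auto simp: restr_arcs_def)
  ultimately show False using at unfolding atomic_pairs_def by blast
qed

lemma atomic_factorization_exists:
  "distinct \<phi> \<Longrightarrow> \<mu> \<in> set_partitions \<phi> \<Longrightarrow> \<exists>ws. set ws \<subseteq> atomic_pairs \<and> pair_prod ws = (\<phi>, \<mu>)"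
proof (induction "length \<phi>" arbitrary: \<phi> \<mu> rule: less_induct)
  case less
  consider "\<phi> = []" | "(\<phi>, \<mu>) \<in> atomic_pairs" | "\<phi> \<noteq> []" "(\<phi>, \<mu>) \<notin> atomic_pairs" by blast
  then show ?case
  proof cases
    case 1
    then have "\<mu> = {}" using less.prems(2) set_partitions_subset by fastforce
    then show ?thesis using 1 by (intro exI[of _ "[]"]) simp
  next
    case 2
    then show ?thesis by (intro exI[of _ "[(\<phi>, \<mu>)]"]) (simp add: pair_prod_Cons)
  next
    case 3
    then obtain A B where AB: "[A, B] \<in> set_compositions (set \<phi>)"
      "\<phi> = restr_order A \<phi> @ restr_order B \<phi>" "\<mu> = restr_arcs A \<mu> \<union> restr_arcs B \<mu>"
      using less.prems by (auto simp: atomic_pairs_def)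
    have "set (restr_order A \<phi>) \<noteq> {}" "set (restr_order B \<phi>) \<noteq> {}"
      using AB(1) by (auto simp: set_compositions_iff)
    then have ne: "restr_order A \<phi> \<noteq> []" "restr_order B \<phi> \<noteq> []" by (metis set_empty)+
    have l: "length (restr_order A \<phi>) + length (restr_order B \<phi>) = length \<phi>"
      using arg_cong[OF AB(2), of length] by simp
    have l': "length (restr_order A \<phi>) < length \<phi>" "length (restr_order B \<phi>) < length \<phi>"
      using l ne[THEN length_greater_0_conv[THEN iffD2]] by linarith+
    obtain vs where vs: "set vs \<subseteq> atomic_pairs" "pair_prod vs = (restr_order A \<phi>, restr_arcs A \<mu>)"
      using less.hyps[of "restr_order A \<phi>" "restr_arcs A \<mu>"] less.prems(1) l'
        restr_arcs_set_partitions[OF less.prems(2), of A] by auto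
    obtain us where us: "set us \<subseteq> atomic_pairs" "pair_prod us = (restr_order B \<phi>, restr_arcs B \<mu>)"
      using less.hyps[of "restr_order B \<phi>" "restr_arcs B \<mu>"] less.prems(1) l'
        restr_arcs_set_partitions[OF less.prems(2), of B] by auto
    have "pair_prod (vs @ us) = (\<phi>, \<mu>)"
      unfolding pair_prod_append vs(2) us(2) using AB(2,3) by simp
    then show ?thesis using vs us by (intro exI[of _ "vs @ us"]) simp
  qed
qed

text \<open>Each nonempty factor contributes at least one atomic factor. The bound on the lengths is
  what later places a term in the filtration.\<close>

lemma atomic_refinement:
  assumes "\<forall>(\<phi>, \<mu>)\<in>set ps. distinct \<phi> \<and> \<phi> \<noteq> [] \<and> \<mu> \<in> set_partitions \<phi>"
  shows "\<exists>ws. set ws \<subseteq> atomic_pairs \<and> pair_prod ws = pair_prod ps \<and> length ps \<le> length ws"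
  using assms
proof (induction ps)
  case Nil
  then show ?case by (intro exI[of _ "[]"]) simp
next
  case (Cons p ps)
  obtain \<phi> \<mu> where p: "p = (\<phi>, \<mu>)" by (cases p)
  obtain ws where ws: "set ws \<subseteq> atomic_pairs" "pair_prod ws = pair_prod ps" "length ps \<le> length ws"
    using Cons by auto
  obtain vs where vs: "set vs \<subseteq> atomic_pairs" "pair_prod vs = (\<phi>, \<mu>)"
    using atomic_factorization_exists[of \<phi> \<mu>] Cons.prems p by auto
  have "vs \<noteq> []" using vs(2) Cons.prems p by (cases vs) auto
  then have "length (p # ps) \<le> length (vs @ ws)" using ws(3) by (cases vs) auto
  moreover have "pair_prod (vs @ ws) = pair_prod (p # ps)"
    by (simp add: pair_prod_append pair_prod_Cons vs(2) ws(2) p)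
  ultimately show ?case using ws(1) vs(1) by (intro exI[of _ "vs @ ws"]) simp
qed

text \<open>Of two competing first factors, the shorter word \<psi> cuts the longer word \<phi>.
  Arcs of \<mu> come from \<nu> or \<xi> and so do not cross the cut, which contradicts atomicity
  unless the cut is at the end.\<close>

lemma atomic_factor_prefix:
  assumes at: "(\<phi>, \<mu>) \<in> atomic_pairs" and d: "distinct (\<psi> @ \<chi>)" and \<psi>: "\<psi> \<noteq> []" "\<phi> = \<psi> @ us"
    and sub: "\<mu> \<subseteq> \<nu> \<union> \<xi>" and \<nu>: "\<nu> \<in> set_partitions \<psi>" and \<xi>: "\<xi> \<in> set_partitions \<chi>"
  shows "us = []"
proof (rule ccontr)
  assume us: "us \<noteq> []"
  have "i \<in> set \<psi> \<and> j \<in> set \<psi> \<or> i \<in> set us \<and> j \<in> set us" if "(i, j) \<in> \<mu>" for i j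
  proof -
    have "i \<in> set \<phi> \<and> j \<in> set \<phi>" using set_partitions_subset[of \<mu> \<phi>] at that atomic_pairsD by blast
    moreover have "i \<in> set \<psi> \<and> j \<in> set \<psi> \<or> i \<in> set \<chi> \<and> j \<in> set \<chi>"
      using that sub set_partitions_subset[OF \<nu>] set_partitions_subset[OF \<xi>] by blast
    ultimately show ?thesis using d \<psi>(2) by auto
  qed
  then show False using append_not_atomic[OF \<psi>(1) us] at \<psi>(2) by blast
qed

lemma atomic_factorization_unique:
  "set ws \<subseteq> atomic_pairs \<Longrightarrow> set vs \<subseteq> atomic_pairs \<Longrightarrow> distinct (fst (pair_prod ws)) \<Longrightarrow>
    pair_prod ws = pair_prod vs \<Longrightarrow> ws = vs"
proof (induction ws arbitrary: vs)
  case Nil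
  then show ?case by (cases vs) (auto simp: pair_prod_Cons dest: atomic_pairsD)
next
  case (Cons w ws)
  obtain \<phi> \<mu> where w: "w = (\<phi>, \<mu>)" by (cases w)
  have \<phi>: "\<phi> \<noteq> []" "\<mu> \<in> set_partitions \<phi>" using Cons.prems(1) w atomic_pairsD by auto
  then obtain v us where vs: "vs = v # us" using Cons.prems(4) w by (cases vs) (auto simp: pair_prod_Cons)
  obtain \<psi> \<nu> where v: "v = (\<psi>, \<nu>)" by (cases v)
  have \<psi>: "\<psi> \<noteq> []" "\<nu> \<in> set_partitions \<psi>" using Cons.prems(2) vs v atomic_pairsD by auto
  define \<alpha> \<sigma> \<beta> \<tau> where "\<alpha> = fst (pair_prod ws)" "\<sigma> = snd (pair_prod ws)"
    "\<beta> = fst (pair_prod us)" "\<tau> = snd (pair_prod us)"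
  have eq: "\<phi> @ \<alpha> = \<psi> @ \<beta>" "\<mu> \<union> \<sigma> = \<nu> \<union> \<tau>"
    using Cons.prems(4) by (simp_all add: w vs v pair_prod_Cons \<alpha>_\<sigma>_\<beta>_\<tau>_def)
  have "distinct (\<phi> @ \<alpha>)" using Cons.prems(3) by (simp add: w pair_prod_Cons \<alpha>_\<sigma>_\<beta>_\<tau>_def)
  then have d: "distinct (\<phi> @ \<alpha>)" "distinct (\<psi> @ \<beta>)" using eq(1) by auto
  have \<sigma>: "\<sigma> \<in> set_partitions \<alpha>"
    unfolding \<alpha>_\<sigma>_\<beta>_\<tau>_def using Cons.prems(1) d(1) atomic_pairsD
    by (intro pair_prod_set_partitions) (auto simp: \<alpha>_\<sigma>_\<beta>_\<tau>_def)
  have \<tau>: "\<tau> \<in> set_partitions \<beta>"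
    unfolding \<alpha>_\<sigma>_\<beta>_\<tau>_def using Cons.prems(2) vs d(2) atomic_pairsD
    by (intro pair_prod_set_partitions) (auto simp: \<alpha>_\<sigma>_\<beta>_\<tau>_def)
  have at: "(\<phi>, \<mu>) \<in> atomic_pairs" "(\<psi>, \<nu>) \<in> atomic_pairs" using Cons.prems(1,2) w vs v by auto
  have "\<phi> = \<psi>"
  proof -
    obtain xs where "\<phi> = \<psi> @ xs \<or> \<psi> = \<phi> @ xs" using eq(1) by (auto simp: append_eq_append_conv2)
    then show ?thesis
    proof
      assume "\<phi> = \<psi> @ xs"
      moreover have "\<mu> \<subseteq> \<nu> \<union> \<tau>" using eq(2) by blast
      ultimately show ?thesis using atomic_factor_prefix[OF at(1) d(2) \<psi>(1) _ _ \<psi>(2) \<tau>] by simp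
    next
      assume "\<psi> = \<phi> @ xs"
      moreover have "\<nu> \<subseteq> \<mu> \<union> \<sigma>" using eq(2) by blast
      ultimately show ?thesis using atomic_factor_prefix[OF at(2) d(1) \<phi>(1) _ _ \<phi>(2) \<sigma>] by simp
    qed
  qed
  then have ab: "\<alpha> = \<beta>" using eq(1) by simp
  \<comment> \<open>Once the words agree, restriction to their letters recovers the arcs of each
    factor from the union.\<close>
  have "set \<phi> \<inter> set \<alpha> = {}" using d by auto
  then have "restr_arcs (set \<phi>) (\<mu> \<union> \<sigma>) = \<mu>" "restr_arcs (set \<alpha>) (\<mu> \<union> \<sigma>) = \<sigma>"
    "restr_arcs (set \<phi>) (\<nu> \<union> \<tau>) = \<nu>" "restr_arcs (set \<alpha>) (\<nu> \<union> \<tau>) = \<tau>"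
    using \<phi>(2) \<psi>(2) \<sigma> \<tau> \<open>\<phi> = \<psi>\<close> ab
    by (simp_all add: restr_arcs_id restr_arcs_disjoint Int_commute)
  then have "\<mu> = \<nu>" "\<sigma> = \<tau>" using eq(2) by simp_all
  moreover have "ws = us"
    by (rule Cons.IH) (use Cons.prems vs d(1) ab \<open>\<sigma> = \<tau>\<close> in \<open>auto simp: \<alpha>_\<sigma>_\<beta>_\<tau>_def prod_eq_iff\<close>)
  ultimately show ?case using w vs v \<open>\<phi> = \<psi>\<close> by simp
qed

section \<open>Atomic words as an index set of the basis\<close>

abbreviation atomic_words :: "'a set \<Rightarrow> ('a list \<times> 'a arcs) list set" where
  "atomic_words K \<equiv> monomial_words (\<lambda>(\<phi>, \<mu>). set \<phi>) atomic_pairs K"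

lemma atomic_words_iff:
  "ws \<in> atomic_words K \<longleftrightarrow>
    set ws \<subseteq> atomic_pairs \<and> distinct (fst (pair_prod ws)) \<and> set (fst (pair_prod ws)) = K"
proof (cases "set ws \<subseteq> atomic_pairs")
  case True
  let ?D = "\<lambda>w :: 'a list \<times> 'a arcs. set (fst w)"
  have D: "(\<lambda>(\<phi>, \<mu>). set \<phi>) = ?D" by auto
  have "{} \<notin> set (map ?D ws)" using True by (auto dest!: atomic_pairsD)
  moreover have "\<Union>(set (map ?D ws)) = set (fst (pair_prod ws))" by (auto simp: pair_prod_def)
  moreover have "sorted_wrt disjnt (map ?D ws) \<longleftrightarrow> distinct (fst (pair_prod ws))"
    using True
  proof (induction ws)
    case (Cons w ws)
    obtain \<phi> \<mu> where w: "w = (\<phi>, \<mu>)" by (cases w)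
    have "distinct \<phi>" using Cons.prems w atomic_pairsD by auto
    moreover have "(\<forall>v\<in>set ws. disjnt (set \<phi>) (?D v)) \<longleftrightarrow> set \<phi> \<inter> set (fst (pair_prod ws)) = {}"
    proof -
      have "set (fst (pair_prod ws)) = (\<Union>v\<in>set ws. ?D v)" by (simp add: pair_prod_def)
      then show ?thesis unfolding disjnt_def by blast
    qed
    ultimately show ?case using Cons w by (auto simp: pair_prod_Cons)
  qed simp
  ultimately show ?thesis using True unfolding monomial_words_def set_compositions_iff D by auto
qed (auto simp: monomial_words_def)

text \<open>Unique factorization, read as a count: there are as many monomials in the atomic
  generators as basis elements in each component.\<close>

lemma bij_betw_atomic_words: "bij_betw pair_prod (atomic_words K) (scf_index K)"
proof (rule bij_betwI')
  fix ws vs assume "ws \<in> atomic_words K" "vs \<in> atomic_words K"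
  then show "pair_prod ws = pair_prod vs \<longleftrightarrow> ws = vs"
    using atomic_factorization_unique[of ws vs] by (auto simp: atomic_words_iff)
next
  fix ws assume ws: "ws \<in> atomic_words K"
  have "snd (pair_prod ws) \<in> set_partitions (fst (pair_prod ws))"
    using ws atomic_pairsD by (intro pair_prod_set_partitions) (auto simp: atomic_words_iff)
  then show "pair_prod ws \<in> scf_index K"
    using ws by (cases "pair_prod ws") (auto simp: atomic_words_iff scf_index_iff)
next
  fix p assume "p \<in> scf_index K"
  moreover obtain \<phi> \<mu> where p: "p = (\<phi>, \<mu>)" by (cases p)
  ultimately have *: "distinct \<phi>" "set \<phi> = K" "\<mu> \<in> set_partitions \<phi>" by (auto simp: scf_index_iff)
  then obtain ws where "set ws \<subseteq> atomic_pairs" "pair_prod ws = (\<phi>, \<mu>)"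
    using atomic_factorization_exists by blast
  then show "\<exists>ws\<in>atomic_words K. p = pair_prod ws" using * p by (auto simp: atomic_words_iff intro!: bexI[of _ ws])
qed

section \<open>Filtration by the number of atomic factors\<close>

abbreviation power_sum_word :: "('a list \<Rightarrow> 'a arcs rel) \<Rightarrow> ('a list \<times> 'a arcs) list \<Rightarrow> ('a, 'f::field) sfun" where
  "power_sum_word R ws \<equiv> power_sum_pair R (pair_prod ws)"

text \<open>A decreasing filtration whose levels add up under the product, so error terms stay
  errors when multiplied.\<close>

definition factor_filtration :: "('a list \<Rightarrow> 'a arcs rel) \<Rightarrow> 'a set \<Rightarrow> nat \<Rightarrow> ('a, 'f::field) sfun set" where
  "factor_filtration R K r = cfun.span (power_sum_word R ` {ws \<in> atomic_words K. r \<le> length ws})"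

lemma subspace_factor_filtration: "cfun.subspace (factor_filtration R K r)"
  by (simp add: factor_filtration_def)

lemma factor_filtration_base:
  "ws \<in> atomic_words K \<Longrightarrow> r \<le> length ws \<Longrightarrow> power_sum_word R ws \<in> factor_filtration R K r"
  unfolding factor_filtration_def by (intro cfun.span_base imageI) simp

lemma factor_filtration_antimono: "r \<le> s \<Longrightarrow> factor_filtration R K s \<subseteq> factor_filtration R K r"
  unfolding factor_filtration_def by (intro cfun.span_mono image_mono) auto

lemma mult2_tensor2_add_left:
  "mult2 I J (tensor2 (x + x') y) = mult2 I J (tensor2 x y) + mult2 I J (tensor2 x' y)"
  by (auto simp: mult2_def tensor2_def fun_eq_iff algebra_simps)

lemma mult2_tensor2_add_right:
  "mult2 I J (tensor2 x (y + y')) = mult2 I J (tensor2 x y) + mult2 I J (tensor2 x y')"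
  by (auto simp: mult2_def tensor2_def fun_eq_iff algebra_simps)

lemma mult2_tensor2_cscale:
  "mult2 I J (tensor2 (cscale c x) y) = cscale c (mult2 I J (tensor2 x y))"
  "mult2 I J (tensor2 x (cscale c y)) = cscale c (mult2 I J (tensor2 x y))"
  by (auto simp: mult2_def tensor2_def cscale_def fun_eq_iff)

lemma mult2_tensor2_zero: "mult2 I J (tensor2 0 y) = 0" "mult2 I J (tensor2 x 0) = 0"
  by (auto simp: mult2_def tensor2_def fun_eq_iff)

lemma mult2_tensor2_span:
  assumes x: "x \<in> cfun.span X" and y: "y \<in> cfun.span Y" and V: "cfun.subspace V"
    and base: "\<And>x y. x \<in> X \<Longrightarrow> y \<in> Y \<Longrightarrow> mult2 I J (tensor2 x y) \<in> V"
  shows "mult2 I J (tensor2 x y) \<in> V"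
proof -
  have 1: "mult2 I J (tensor2 a y) \<in> V" if "a \<in> X" for a
  proof -
    have "cfun.span Y \<subseteq> {b. mult2 I J (tensor2 a b) \<in> V}"
      using V base[OF that]
      by (intro cfun.span_minimal cfun.subspaceI)
        (auto simp: mult2_tensor2_add_right mult2_tensor2_cscale mult2_tensor2_zero
          cfun.subspace_0 cfun.subspace_add cfun.subspace_scale simp del: plus_fun_apply)
    then show ?thesis using y by blast
  qed
  have "cfun.span X \<subseteq> {a. mult2 I J (tensor2 a y) \<in> V}"
    using V 1
    by (intro cfun.span_minimal cfun.subspaceI)
      (auto simp: mult2_tensor2_add_left mult2_tensor2_cscale mult2_tensor2_zero
        cfun.subspace_0 cfun.subspace_add cfun.subspace_scale)
  then show ?thesis using x by blast
qed

lemma atomic_words_append: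
  "vs \<in> atomic_words I \<Longrightarrow> ws \<in> atomic_words J \<Longrightarrow> I \<inter> J = {} \<Longrightarrow> vs @ ws \<in> atomic_words (I \<union> J)"
  by (auto simp: atomic_words_iff pair_prod_append)

lemma atomic_words_split:
  assumes "vs @ ws \<in> atomic_words K"
  obtains I J where "vs \<in> atomic_words I" "ws \<in> atomic_words J" "I \<inter> J = {}" "K = I \<union> J"
proof
  show "vs \<in> atomic_words (set (fst (pair_prod vs)))" "ws \<in> atomic_words (set (fst (pair_prod ws)))"
    "set (fst (pair_prod vs)) \<inter> set (fst (pair_prod ws)) = {}"
    "K = set (fst (pair_prod vs)) \<union> set (fst (pair_prod ws))"
    using assms by (auto simp: atomic_words_iff pair_prod_append)
qed

lemma atomic_words_pair_prod:
  assumes "ws \<in> atomic_words K"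
  shows "distinct (fst (pair_prod ws))" "set (fst (pair_prod ws)) = K"
    "snd (pair_prod ws) \<in> set_partitions (fst (pair_prod ws))"
  using assms bij_betwE[OF bij_betw_atomic_words, of K]
  by (cases "pair_prod ws"; auto simp: scf_index_iff)+

lemma mult2_power_sum_word:
  assumes R: "power_sum_friendly R" and "vs \<in> atomic_words I" "ws \<in> atomic_words J" "I \<inter> J = {}"
  shows "mult2 I J (tensor2 (power_sum_word R vs) (power_sum_word R ws)) = power_sum_word R (vs @ ws)"
  using power_sum_mult[OF R _ atomic_words_pair_prod(3)[OF assms(2)] atomic_words_pair_prod(3)[OF assms(3)]]
    atomic_words_pair_prod(1,2)[OF assms(2)] atomic_words_pair_prod(1,2)[OF assms(3)] assms(4)
  by (simp add: power_sum_pair_def pair_prod_append split_beta)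

lemma factor_filtration_mult:
  assumes R: "power_sum_friendly R" and IJ: "I \<inter> J = {}"
    and x: "x \<in> factor_filtration R I r" and y: "y \<in> factor_filtration R J s"
  shows "mult2 I J (tensor2 x y) \<in> factor_filtration R (I \<union> J) (r + s)"
  by (rule mult2_tensor2_span[OF x[unfolded factor_filtration_def] y[unfolded factor_filtration_def]
        subspace_factor_filtration])
    (auto simp: mult2_power_sum_word[OF R _ _ IJ] intro!: factor_filtration_base atomic_words_append IJ)

lemma atomic_singleton: "(\<phi>, \<mu>) \<in> atomic_pairs \<Longrightarrow> [(\<phi>, \<mu>)] \<in> atomic_words (set \<phi>)"
  by (auto simp: atomic_words_iff pair_prod_Cons dest: atomic_pairsD)

text \<open>The one-block composition contributes the power sum itself with sign plus. Any other
  composition has at least two nonempty blocks, and refining the rearranged word into atomic pairs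
  gives at least two factors.\<close>

lemma Q_elem_triangular:
  fixes R :: "'a list \<Rightarrow> 'a arcs rel"
  assumes R: "power_sum_friendly R" and at: "(\<phi>, \<mu>) \<in> atomic_pairs"
  shows "(Q_elem R (\<phi>, \<mu>) - power_sum R \<phi> \<mu> :: ('a, 'f::field) sfun) \<in> factor_filtration R (set \<phi>) 2"
proof -
  let ?K = "set \<phi>" and ?P = "\<lambda>\<psi>. power_sum R \<psi> \<mu> :: ('a, 'f) sfun"
  let ?C = "rooted_blocks (hd \<phi>) ?K \<mu>"
  have \<phi>: "distinct \<phi>" "\<phi> \<noteq> []" "\<mu> \<in> set_partitions \<phi>" using at atomic_pairsD by auto
  have "blockwise [?K] \<mu>" using set_partitions_subset[OF \<phi>(3)] by (auto simp: blockwise_def)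
  then have K: "[?K] \<in> ?C" using \<phi> by (auto simp: rooted_blocks_def set_compositions_iff)
  have rK: "rearrange [?K] \<phi> = \<phi>" by (simp add: rearrange_def restr_order_id)
  have "Q_elem R (\<phi>, \<mu>) = (\<Sum>Js\<in>?C. cscale ((-1) ^ (length Js - 1)) (?P (rearrange Js \<phi>)))"
    unfolding Q_elem_def by (simp add: Psi_power_sum[OF R \<phi>(1,3)])
  also have "\<dots> = cscale ((-1) ^ (length [?K] - 1)) (?P (rearrange [?K] \<phi>)) +
      (\<Sum>Js\<in>?C - {[?K]}. cscale ((-1) ^ (length Js - 1)) (?P (rearrange Js \<phi>)))"
    by (rule sum.remove) (simp_all add: finite_rooted_blocks K)
  also have "cscale ((-1) ^ (length [?K] - 1)) (?P (rearrange [?K] \<phi>)) = ?P \<phi>"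
    unfolding rK by (simp add: cscale_def)
  finally have eq: "Q_elem R (\<phi>, \<mu>) - ?P \<phi> =
      (\<Sum>Js\<in>?C - {[?K]}. cscale ((-1) ^ (length Js - 1)) (?P (rearrange Js \<phi>)))"
    by (simp only: add_diff_cancel_left')
  have mem: "?P (rearrange Js \<phi>) \<in> factor_filtration R ?K 2" if Js: "Js \<in> ?C - {[?K]}" for Js
  proof -
    have *: "Js \<noteq> []" "{} \<notin> set Js" "sorted_wrt disjnt Js" "\<Union>(set Js) = ?K" "blockwise Js \<mu>"
      using Js by (auto simp: rooted_blocks_def set_compositions_iff)
    have l: "2 \<le> length Js"
    proof (rule ccontr)
      assume "\<not> 2 \<le> length Js"
      then obtain X where "Js = [X]" using *(1) by (cases Js) (auto simp: not_le less_2_cases_iff)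
      then show False using *(4) Js by simp
    qed
    let ?ps = "map (\<lambda>J. (restr_order J \<phi>, restr_arcs J \<mu>)) Js"
    have "\<forall>(\<psi>, \<nu>)\<in>set ?ps. distinct \<psi> \<and> \<psi> \<noteq> [] \<and> \<nu> \<in> set_partitions \<psi>"
    proof clarify
      fix \<psi> \<nu> assume "(\<psi>, \<nu>) \<in> set ?ps"
      then obtain J where J: "J \<in> set Js" "\<psi> = restr_order J \<phi>" "\<nu> = restr_arcs J \<mu>" by auto
      have "set \<psi> = J" using J *(4) by auto
      then have "\<psi> \<noteq> []" using J(1) *(2) by auto
      then show "distinct \<psi> \<and> \<psi> \<noteq> [] \<and> \<nu> \<in> set_partitions \<psi>"
        using J \<phi>(1) restr_arcs_set_partitions[OF \<phi>(3)] by simp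
    qed
    then obtain ws where ws: "set ws \<subseteq> atomic_pairs" "pair_prod ws = pair_prod ?ps" "length ?ps \<le> length ws"
      using atomic_refinement by blast
    have pp: "pair_prod ws = (rearrange Js \<phi>, \<mu>)" using ws(2) pair_prod_restr[OF *(5)] by simp
    have "ws \<in> atomic_words ?K"
      using ws(1) pp distinct_rearrange[OF \<phi>(1) *(3)] set_rearrange[OF *(4)] by (simp add: atomic_words_iff)
    then have "power_sum_word R ws \<in> factor_filtration R ?K 2"
      using l ws(3) by (intro factor_filtration_base) auto
    then show ?thesis by (simp add: pp power_sum_pair_def)
  qed
  show ?thesis
    unfolding eq
    by (intro cfun.subspace_sum cfun.subspace_scale subspace_factor_filtration mem)
qed

lemma Q_elem_filtration:
  fixes R :: "'a list \<Rightarrow> 'a arcs rel"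
  assumes R: "power_sum_friendly R" and at: "(\<phi>, \<mu>) \<in> atomic_pairs"
  shows "(Q_elem R (\<phi>, \<mu>) :: ('a, 'f::field) sfun) \<in> factor_filtration R (set \<phi>) 1"
proof -
  have "power_sum_word R [(\<phi>, \<mu>)] \<in> (factor_filtration R (set \<phi>) 1 :: ('a, 'f) sfun set)"
    by (rule factor_filtration_base[OF atomic_singleton[OF at]]) simp
  moreover have "(Q_elem R (\<phi>, \<mu>) - power_sum R \<phi> \<mu> :: ('a, 'f) sfun) \<in> factor_filtration R (set \<phi>) 1"
    using Q_elem_triangular[OF R at] factor_filtration_antimono[of 1 2 R "set \<phi>"] by auto
  ultimately have "(Q_elem R (\<phi>, \<mu>) - power_sum R \<phi> \<mu>) + power_sum R \<phi> \<mu> \<in> (factor_filtration R (set \<phi>) 1 :: ('a, 'f) sfun set)"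
    by (intro cfun.subspace_add[OF subspace_factor_filtration]) (simp_all add: power_sum_pair_def pair_prod_Cons)
  then show ?thesis by simp
qed

section \<open>Monomials in the primitive elements\<close>

lemma monomial_Nil [simp]: "monomial D g [] = unit_elem"
  by (simp add: monomial_def cscale_def)

lemma monomial_singleton [simp]: "monomial D g [w] = g w"
  by (simp add: monomial_def del: mult_iter.simps)

lemma monomial_snoc:
  "ws \<noteq> [] \<Longrightarrow> monomial D g (ws @ [w]) = mult2 (\<Union>(D ` set ws)) (D w) (tensor2 (monomial D g ws) (g w))"
  using mult_iter_tensor_snoc[of "map D ws" "map g ws" "D w" "g w"] by (simp add: monomial_def)

text \<open>By reflexivity the only set partition of the empty word lies above itself, so the empty
  monomial agrees with the power sum of the empty pair.\<close>

lemma power_sum_Nil: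
  assumes R: "power_sum_friendly R"
  shows "power_sum R [] {} = unit_elem"
proof -
  have S: "set_partitions [] = {{}}" by (auto simp: set_partitions_iff)
  have "partial_order_on (set_partitions []) (R [])" using R by (simp add: power_sum_friendly_def)
  then have "({}, {}) \<in> R []" unfolding S partial_order_on_def preorder_on_def refl_on_def by blast
  then have "{\<mu>. \<mu> \<in> set_partitions [] \<and> ({}, \<mu>) \<in> R []} = {{}}" unfolding S by auto
  then show ?thesis by (simp add: power_sum_def unit_elem_def)
qed

lemma monomial_triangular:
  fixes R :: "'a list \<Rightarrow> 'a arcs rel"
  assumes R: "power_sum_friendly R"
  shows "ws \<in> atomic_words K \<Longrightarrow>
    (monomial (\<lambda>(\<phi>, \<mu>). set \<phi>) (Q_elem R) ws - power_sum_word R ws :: ('a, 'f::field) sfun)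
      \<in> factor_filtration R K (Suc (length ws))"
proof (induction ws arbitrary: K rule: rev_induct)
  case Nil
  have "power_sum_word R [] = (unit_elem :: ('a, 'f) sfun)"
    by (simp add: power_sum_pair_def power_sum_Nil[OF R])
  then show ?case
    unfolding monomial_Nil by (simp only: diff_self cfun.subspace_0[OF subspace_factor_filtration])
next
  case (snoc w ws)
  let ?D = "\<lambda>(\<phi> :: 'a list, \<mu> :: 'a arcs). set \<phi>"
  obtain \<phi> \<mu> where w: "w = (\<phi>, \<mu>)" by (cases w)
  obtain I J where IJ: "ws \<in> atomic_words I" "[w] \<in> atomic_words J" "I \<inter> J = {}" "K = I \<union> J"
    using snoc.prems by (rule atomic_words_split)
  have J: "J = set \<phi>" "(\<phi>, \<mu>) \<in> atomic_pairs" using IJ(2) by (auto simp: atomic_words_iff pair_prod_Cons w)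
  let ?Q = "Q_elem R w :: ('a, 'f) sfun" and ?P = "power_sum_word R [w] :: ('a, 'f) sfun"
  have QP: "?Q - ?P \<in> factor_filtration R J 2"
    using Q_elem_triangular[OF R J(2)] by (simp add: w J power_sum_pair_def pair_prod_Cons)
  show ?case
  \<comment> \<open>Splitting off the last factor as a binary product presupposes a nonempty rest,
    so a single factor is treated on its own.\<close>
  proof (cases "ws = []")
    case True
    then have "K = J" using IJ by (auto simp: atomic_words_iff)
    moreover have "Suc (length (ws @ [w])) = 2" using True by simp
    ultimately show ?thesis using QP by (simp only: True append_Nil monomial_singleton)
  next
    case False
    let ?m = "monomial ?D (Q_elem R) ws :: ('a, 'f) sfun" and ?F = "power_sum_word R ws :: ('a, 'f) sfun"
    let ?mult = "\<lambda>x y :: ('a, 'f) sfun. mult2 I J (tensor2 x y)"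
    have I: "\<Union>(?D ` set ws) = I"
      using IJ(1) by (auto simp: monomial_words_def set_compositions_iff)
    have "monomial ?D (Q_elem R) (ws @ [w]) = ?mult ?m ?Q"
      using monomial_snoc[OF False, of ?D "Q_elem R" w] by (simp add: I w J(1))
    moreover have "power_sum_word R (ws @ [w]) = ?mult ?F ?P"
      by (rule mult2_power_sum_word[OF R IJ(1-3), symmetric])
    \<comment> \<open>Telescoping: \<open>m Q - F P = (m - F) Q + F (Q - P)\<close>, so each error
      is multiplied by a factor whose level is known.\<close>
    moreover have "?mult ?m ?Q = ?mult (?m - ?F) ?Q + (?mult ?F (?Q - ?P) + ?mult ?F ?P)"
      unfolding mult2_tensor2_add_right[symmetric] mult2_tensor2_add_left[symmetric] diff_add_cancel ..
    ultimately have eq: "monomial ?D (Q_elem R) (ws @ [w]) - power_sum_word R (ws @ [w]) =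
        ?mult (?m - ?F) ?Q + ?mult ?F (?Q - ?P)" by simp
    \<comment> \<open>The levels are \<open>Suc (length ws)\<close> and 1 for the first product,
      \<open>length ws\<close> and 2 for the second. Both sums are one more than the new
      length.\<close>
    have l: "Suc (length ws) + 1 = Suc (length (ws @ [w]))" "length ws + 2 = Suc (length (ws @ [w]))"
      by simp_all
    have "?mult (?m - ?F) ?Q \<in> factor_filtration R K (Suc (length ws) + 1)"
    proof -
      have "?Q \<in> factor_filtration R J 1" unfolding w J(1) by (rule Q_elem_filtration[OF R J(2)])
      then show ?thesis unfolding IJ(4) by (intro factor_filtration_mult[OF R IJ(3)] snoc.IH[OF IJ(1)])
    qed
    moreover have "?mult ?F (?Q - ?P) \<in> factor_filtration R K (length ws + 2)"
      unfolding IJ(4) by (intro factor_filtration_mult[OF R IJ(3)] factor_filtration_base IJ(1) QP order_refl)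
    ultimately show ?thesis
      unfolding eq l by (rule cfun.subspace_add[OF subspace_factor_filtration])
  qed
qed

text \<open>Unique factorization reindexes the power-sum basis by atomic words. Relative to it the
  monomials are triangular, with the length of the word as rank.\<close>

lemma monomial_basis:
  fixes R :: "'a list \<Rightarrow> 'a arcs rel" and K :: "'a set"
  assumes R: "power_sum_friendly R"
  defines "m \<equiv> (monomial (\<lambda>(\<phi>, \<mu>). set \<phi>) (Q_elem R) :: _ \<Rightarrow> ('a, 'f::field) sfun)"
  shows "inj_on m (atomic_words K)" and "cfun.independent (m ` atomic_words K)"
    and "cfun.span (m ` atomic_words K) = scf K"
proof -
  let ?F = "power_sum_word R :: _ \<Rightarrow> ('a, 'f) sfun"
  note bij = bij_betw_atomic_words[of K]
  note P = power_sum_basis[where 'f = 'f, OF R, of K, folded power_sum_pair_def]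
  have im: "?F ` atomic_words K = power_sum_pair R ` scf_index K"
    using bij_betw_imp_surj_on[OF bij] by (metis image_image)
  have fin: "finite (atomic_words K)" using bij_betw_finite[OF bij] finite_scf_index by blast
  have inj: "inj_on ?F (atomic_words K)"
    using comp_inj_on[OF bij_betw_imp_inj_on[OF bij]] P(1) bij_betw_imp_surj_on[OF bij] by (simp add: o_def)
  have ind: "cfun.independent (?F ` atomic_words K)" unfolding im by (rule P(2))
  have tri: "m ws - ?F ws \<in> cfun.span (?F ` {vs \<in> atomic_words K. length ws < length vs})"
    if "ws \<in> atomic_words K" for ws
    using monomial_triangular[OF R that, where 'f = 'f] unfolding m_def factor_filtration_def Suc_le_eq .
  note triangular = cfun.triangular_basis[OF fin inj ind, of m length]
  show "inj_on m (atomic_words K)" by (rule triangular(1)) (rule tri)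
  show "cfun.independent (m ` atomic_words K)" by (rule triangular(2)) (rule tri)
  have "cfun.span (m ` atomic_words K) = cfun.span (?F ` atomic_words K)" by (rule triangular(3)) (rule tri)
  then show "cfun.span (m ` atomic_words K) = scf K" unfolding im P(3) .
qed

text \<open>A submonoid is closed under binary products only, so the last factor is split off at
  each step.\<close>

lemma monomial_in_submonoid:
  assumes W: "scf_submonoid W" and g: "\<And>i. i \<in> X \<Longrightarrow> g i \<in> W (D i)"
  shows "finite K \<Longrightarrow> ws \<in> monomial_words D X K \<Longrightarrow> monomial D g ws \<in> W K"
proof (induction ws arbitrary: K rule: rev_induct)
  case Nil
  then have "K = {}" by (auto simp: monomial_words_def set_compositions_iff)
  then show ?case using W by (simp add: scf_submonoid_def)
next
  case (snoc w ws)
  let ?I = "\<Union>(D ` set ws)"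
  have w: "w \<in> X" "set ws \<subseteq> X" using snoc.prems(2) by (auto simp: monomial_words_def)
  have K: "K = ?I \<union> D w" using snoc.prems(2) by (auto simp: monomial_words_def set_compositions_iff)
  have disj: "?I \<inter> D w = {}"
    using snoc.prems(2) by (auto simp: monomial_words_def set_compositions_iff sorted_wrt_append disjnt_def)
  have fin: "finite ?I" "finite (D w)" using snoc.prems(1) unfolding K by blast+
  show ?case
  proof (cases "ws = []")
    case True
    then show ?thesis using g[OF w(1)] K by simp
  next
    case False
    have "ws \<in> monomial_words D X ?I"
      using snoc.prems(2) by (auto simp: monomial_words_def set_compositions_iff sorted_wrt_append)
    then have "monomial D g ws \<in> W ?I" by (rule snoc.IH[OF fin(1)])
    then show ?thesis
      unfolding monomial_snoc[OF False] K using W g[OF w(1)] fin disj unfolding scf_submonoid_def by blast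
  qed
qed

theorem theorem7p2:
  fixes R :: "'a list \<Rightarrow> 'a arcs rel"
    and Qf :: "'a list \<times> 'a arcs \<Rightarrow> ('a, 'f::{field,finite}) sfun"
  assumes "power_sum_friendly R"
    and "Qf = Q_elem R"
  shows "(\<forall>(\<phi>, \<mu>)\<in>atomic_pairs. primitive (set \<phi>) (Qf (\<phi>, \<mu>))) \<and>
         alg_independent (\<lambda>(\<phi>, \<mu>). set \<phi>) atomic_pairs Qf \<and>
         generates_scf (\<lambda>(\<phi>, \<mu>). set \<phi>) atomic_pairs Qf"
proof (intro conjI)
  let ?D = "\<lambda>(\<phi> :: 'a list, \<mu> :: 'a arcs). set \<phi>"
  note basis = monomial_basis[where 'f = 'f, OF assms(1), folded assms(2)]
  have scf: "Qf (\<phi>, \<mu>) \<in> scf (set \<phi>)" if "(\<phi>, \<mu>) \<in> atomic_pairs" for \<phi> \<mu>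
    using atomic_pairsD[OF that] unfolding assms(2) Q_elem_def prod.case
    by (intro Psi_power_sum_in_scf[OF assms(1)]) auto
  show "\<forall>(\<phi>, \<mu>)\<in>atomic_pairs. primitive (set \<phi>) (Qf (\<phi>, \<mu>))"
  proof clarify
    fix \<phi> :: "'a list" and \<mu> assume at: "(\<phi>, \<mu>) \<in> atomic_pairs"
    have \<phi>: "distinct \<phi>" "\<mu> \<in> set_partitions \<phi>" "hd \<phi> \<in> set \<phi>" using atomic_pairsD[OF at] by auto
    show "primitive (set \<phi>) (Qf (\<phi>, \<mu>))"
      unfolding primitive_def
    proof (intro conjI allI impI)
      show "Qf (\<phi>, \<mu>) \<in> scf (set \<phi>)" by (rule scf[OF at])
      fix I J assume "[I, J] \<in> set_compositions (set \<phi>)"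
      then show "comult2 I J (Qf (\<phi>, \<mu>)) = 0"
        unfolding assms(2) Q_elem_def prod.case by (rule comult2_Psi_power_sum[OF assms(1) \<phi>])
    qed
  qed
  show "alg_independent ?D atomic_pairs Qf"
    unfolding alg_independent_def using basis(1,2) by blast
  show "generates_scf ?D atomic_pairs Qf"
    unfolding generates_scf_def
  proof (intro conjI allI impI)
    show "\<forall>i\<in>atomic_pairs. Qf i \<in> scf (?D i)" using scf by auto
    fix W :: "'a set \<Rightarrow> ('a, 'f) sfun set" and K :: "'a set"
    assume W: "scf_submonoid W \<and> (\<forall>i\<in>atomic_pairs. Qf i \<in> W (?D i))" and K: "finite K"
    have sub: "cfun.subspace (W K)" "W K \<subseteq> scf K"
      using W[THEN conjunct1, unfolded scf_submonoid_def, THEN conjunct1, rule_format, OF K] by auto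
    have "monomial ?D Qf ws \<in> W K" if "ws \<in> atomic_words K" for ws
      using monomial_in_submonoid[of W atomic_pairs Qf ?D K ws] W K that by blast
    then have "scf K \<subseteq> W K"
      unfolding basis(3)[symmetric] using sub(1) by (intro cfun.span_minimal) auto
    then show "W K = scf K" using sub(2) by blast
  qed
qed

end
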